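(* Let $\alpha,\beta,\theta_2$ be non-zero real numbers. Let $\mathfrak{g}$ be the real vector space with basis $\{X,Y,Z,W\}$, equipped with the skew-symmetric bilinear bracket determined by $$[W,Z]=-2\alpha W,\quad [Z,X]=\alpha X+\beta Y,\quad [Z,Y]=-\beta X+\alpha Y,\quad [Y,X]=\theta_2W,\quad [W,X]=[W,Y]=0.$$ Then $\mathfrak{g}$ is a Lie algebra. Let $G$ be a Lie group with Lie algebra $\mathfrak{g}$, equipped with the left-invariant Riemannian metric for which $\{X,Y,Z,W\}$ is orthonormal. Let $\mathcal{V}$ be the left-invariant distribution on $G$ spanned by $Z,W$, and let $J_1,J_2$ be the left-invariant almost Hermitian structures on $G$ given by $$J_1X=Y,\quad J_1Y=-X,\quad J_1Z=W,\quad J_1W=-Z,$$ $$J_2X=Y,\quad J_2Y=-X,\quad J_2W=Z,\quad J_2Z=-W.$$ Then the following hold: (1) $\mathcal{V}$ is integrable and the foliation $\mathcal{F}$ tangent to $\mathcal{V}$ is conformal with minimal leaves of codimension $2$; (2) $J_1$ and $J_2$ are both integrable, and $\mathcal{F}$ is holomorphic with respect to each of them; (3) $J_1$ is Kähler if and only if $\theta_2=-2\alpha$, and $J_2$ is Kähler if and only if $\theta_2=2\alpha$; in particular at least one of $J_1,J_2$ is not Kähler; (4) if $4\alpha^2\neq\theta_2^2$, then the Riemannian manifold $G$ is not an Einstein manifold.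
   Context: Elements of $\mathfrak{g}$ are regarded as left-invariant vector fields on $G$, and $\nabla$ is the Levi-Civita connection of the Riemannian metric $g$. For an involutive distribution $\mathcal{V}$ with orthogonal complement $\mathcal{H}$, the symbols $\mathcal{V},\mathcal{H}$ also denote the orthogonal projections of the tangent bundle onto these subbundles. Define $$B^{\mathcal{V}}(U,V)=\tfrac12\mathcal{H}(\nabla_UV+\nabla_VU)\ (U,V\in\mathcal{V}),\qquad B^{\mathcal{H}}(E,F)=\tfrac12\mathcal{V}(\nabla_EF+\nabla_FE)\ (E,F\in\mathcal{H}).$$ The foliation $\mathcal{F}$ tangent to $\mathcal{V}$ is conformal if there is a vector field $V\in\mathcal{V}$ with $B^{\mathcal{H}}=g\otimes V$. It is minimal (has minimal leaves) if $\operatorname{trace}B^{\mathcal{V}}=0$. The leaves of a conformal foliation are locally the fibres of horizontally conformal submersions. A conformal foliation $\mathcal{F}$ of codimension $2$ is holomorphic with respect to a Hermitian structure $J$ if locally its leaves are the fibres of a horizontally conformal submersion $\phi:U\to\mathbb{C}$ ($U$ open in $G$) satisfying $d\phi\circ J=i\,d\phi$. An almost Hermitian structure is integrable if its Nijenhuis tensor vanishes, in which case it is called a Hermitian structure. A Hermitian structure $J$ is Kähler if $\nabla J=0$. A Riemannian manifold is Einstein if its Ricci tensor is a constant multiple of the metric. *)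

theory Defs
  imports "HOL-Analysis.Analysis" "HOL-Library.Function_Algebras"
begin

section \<open>Functions with values in a real vector space\<close>

instantiation "fun" :: (type, real_vector) real_vector
begin

definition scaleR_fun :: "real \<Rightarrow> ('a \<Rightarrow> 'b) \<Rightarrow> 'a \<Rightarrow> 'b"
  where "scaleR_fun r f = (\<lambda>x. r *\<^sub>R f x)"

instance
  by standard (simp_all add: scaleR_fun_def fun_eq_iff scaleR_add_right scaleR_add_left)

end

lemma scaleR_fun_apply [simp]: "(r *\<^sub>R f) x = r *\<^sub>R f x"
  by (simp add: scaleR_fun_def)

definition lie_algebra :: "('g::real_vector \<Rightarrow> 'g \<Rightarrow> 'g) \<Rightarrow> bool"
  where "lie_algebra br \<longleftrightarrow>
    bilinear br \<and> (\<forall>u. br u u = 0) \<and>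
    (\<forall>u v w. br u (br v w) + br v (br w u) + br w (br u v) = 0)"

section \<open>Smooth manifolds\<close>

text \<open>Used for open sets only.\<close>

primrec Ck_on ::
  "nat \<Rightarrow> 'e::real_normed_vector set \<Rightarrow> ('e \<Rightarrow> 'f::real_normed_vector) \<Rightarrow> bool"
where
  "Ck_on 0 S f \<longleftrightarrow> continuous_on S f"
| "Ck_on (Suc k) S f \<longleftrightarrow>
     (\<forall>x\<in>S. f differentiable at x) \<and> (\<forall>v. Ck_on k S (\<lambda>x. frechet_derivative f (at x) v))"

definition smooth_on ::
  "'e::real_normed_vector set \<Rightarrow> ('e \<Rightarrow> 'f::real_normed_vector) \<Rightarrow> bool"
  where "smooth_on S f \<longleftrightarrow> (\<forall>k. Ck_on k S f)"

text \<open>A chart is a pair of its domain and its coordinate map; the coordinate map is only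
  meaningful on the domain. The manifold is the whole type, with the topology of the type.\<close>

type_synonym ('a, 'e) chart = "'a set \<times> ('a \<Rightarrow> 'e)"

abbreviation chart_inv :: "('a, 'e) chart \<Rightarrow> 'e \<Rightarrow> 'a"
  where "chart_inv C \<equiv> inv_into (fst C) (snd C)"

definition smooth_atlas ::
  "('a::topological_space, 'e::euclidean_space) chart set \<Rightarrow> bool"
  where "smooth_atlas A \<longleftrightarrow>
    (\<forall>C\<in>A. open (fst C) \<and> open (snd C ` fst C) \<and>
       homeomorphism (fst C) (snd C ` fst C) (snd C) (chart_inv C)) \<and>
    (\<Union>C\<in>A. fst C) = UNIV \<and>
    (\<forall>C\<in>A. \<forall>C'\<in>A. smooth_on (snd C ` (fst C \<inter> fst C')) (snd C' \<circ> chart_inv C))"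

definition prod_atlas ::
  "('a, 'e) chart set \<Rightarrow> ('b, 'f) chart set \<Rightarrow> ('a \<times> 'b, 'e \<times> 'f) chart set"
  where "prod_atlas A B =
    {(fst C \<times> fst C', map_prod (snd C) (snd C')) | C C'. C \<in> A \<and> C' \<in> B}"

definition smooth_map ::
  "('a::topological_space, 'e::euclidean_space) chart set \<Rightarrow>
   ('b::topological_space, 'f::euclidean_space) chart set \<Rightarrow> ('a \<Rightarrow> 'b) \<Rightarrow> bool"
  where "smooth_map A B F \<longleftrightarrow>
    continuous_on UNIV F \<and>
    (\<forall>C\<in>A. \<forall>C'\<in>B. smooth_on (snd C ` (fst C \<inter> F -` fst C')) (snd C' \<circ> F \<circ> chart_inv C))"

text \<open>Smoothness on an open set of a (totally defined) function.\<close>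

definition smooth_fun ::
  "('a::topological_space, 'e::euclidean_space) chart set \<Rightarrow> 'a set \<Rightarrow>
   ('a \<Rightarrow> 'b::real_normed_vector) \<Rightarrow> bool"
  where "smooth_fun A U f \<longleftrightarrow>
    (\<forall>C\<in>A. smooth_on (snd C ` (U \<inter> fst C)) (f \<circ> chart_inv C))"

definition smooth_near ::
  "('a::topological_space, 'e::euclidean_space) chart set \<Rightarrow> 'a \<Rightarrow>
   ('a \<Rightarrow> 'b::real_normed_vector) \<Rightarrow> bool"
  where "smooth_near A p f \<longleftrightarrow> (\<exists>U. open U \<and> p \<in> U \<and> smooth_fun A U f)"

section \<open>Tangent vectors and vector fields\<close>

text \<open>A tangent vector at a point is the directional derivative, taken in some chart, on
  real functions that are smooth near the point. On all other functions it is put to 0, so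
  that equality of tangent vectors is equality of functionals.\<close>

type_synonym 'a tvec = "('a \<Rightarrow> real) \<Rightarrow> real"
type_synonym 'a vfield = "'a \<Rightarrow> 'a tvec"
type_synonym 'a distr = "'a \<Rightarrow> 'a tvec set"
type_synonym 'a metric = "'a \<Rightarrow> 'a tvec \<Rightarrow> 'a tvec \<Rightarrow> real"
type_synonym 'a endo = "'a \<Rightarrow> 'a tvec \<Rightarrow> 'a tvec"
type_synonym 'a connection = "'a vfield \<Rightarrow> 'a vfield \<Rightarrow> 'a vfield"

definition chart_tvec ::
  "('a::topological_space, 'e::euclidean_space) chart set \<Rightarrow> ('a, 'e) chart \<Rightarrow> 'a \<Rightarrow> 'e \<Rightarrow> 'a tvec"
  where "chart_tvec A C p u =
    (\<lambda>f. if smooth_near A p f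
         then frechet_derivative (f \<circ> chart_inv C) (at (snd C p)) u else 0)"

definition tangent_space ::
  "('a::topological_space, 'e::euclidean_space) chart set \<Rightarrow> 'a distr"
  where "tangent_space A p = {chart_tvec A C p u | C u. C \<in> A \<and> p \<in> fst C}"

definition pushforward ::
  "('b::topological_space, 'f::euclidean_space) chart set \<Rightarrow> ('a \<Rightarrow> 'b) \<Rightarrow> 'a \<Rightarrow> 'a tvec \<Rightarrow> 'b tvec"
  where "pushforward B F p v = (\<lambda>h. if smooth_near B (F p) h then v (h \<circ> F) else 0)"

definition vector_field ::
  "('a::topological_space, 'e::euclidean_space) chart set \<Rightarrow> 'a vfield \<Rightarrow> bool"
  where "vector_field A U \<longleftrightarrow>
    (\<forall>p. U p \<in> tangent_space A p) \<and>
    (\<forall>S f. open S \<longrightarrow> smooth_fun A S f \<longrightarrow> smooth_fun A S (\<lambda>p. U p f))"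

definition fun_times :: "('a \<Rightarrow> real) \<Rightarrow> 'a vfield \<Rightarrow> 'a vfield"
  where "fun_times f U = (\<lambda>p. f p *\<^sub>R U p)"

definition lie_bracket ::
  "('a::topological_space, 'e::euclidean_space) chart set \<Rightarrow> 'a vfield \<Rightarrow> 'a vfield \<Rightarrow> 'a vfield"
  where "lie_bracket A U V =
    (\<lambda>p f. if smooth_near A p f then U p (\<lambda>q. V q f) - V p (\<lambda>q. U q f) else 0)"

section \<open>Lie groups\<close>

definition lie_group ::
  "('a::{second_countable_topology, t2_space}, 'e::euclidean_space) chart set \<Rightarrow>
   ('a \<Rightarrow> 'a \<Rightarrow> 'a) \<Rightarrow> 'a \<Rightarrow> ('a \<Rightarrow> 'a) \<Rightarrow> bool"
  where "lie_group A mul e ginv \<longleftrightarrow>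
    smooth_atlas A \<and> group mul e ginv \<and>
    smooth_map (prod_atlas A A) A (\<lambda>(a, b). mul a b) \<and> smooth_map A A ginv"

definition left_invariant_fields ::
  "('a::topological_space, 'e::euclidean_space) chart set \<Rightarrow> ('a \<Rightarrow> 'a \<Rightarrow> 'a) \<Rightarrow> 'a vfield set"
  where "left_invariant_fields A mul =
    {U. vector_field A U \<and> (\<forall>a p. pushforward A (mul a) p (U p) = U (mul a p))}"

text \<open>The isomorphism \<open>\<iota>\<close> identifies the Lie algebra with the left-invariant vector fields.\<close>

definition lie_algebra_of ::
  "('a::topological_space, 'e::euclidean_space) chart set \<Rightarrow> ('a \<Rightarrow> 'a \<Rightarrow> 'a) \<Rightarrow>
   ('g::real_vector \<Rightarrow> 'g \<Rightarrow> 'g) \<Rightarrow> ('g \<Rightarrow> 'a vfield) \<Rightarrow> bool"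
  where "lie_algebra_of A mul br \<iota> \<longleftrightarrow>
    linear \<iota> \<and> bij_betw \<iota> UNIV (left_invariant_fields A mul) \<and>
    (\<forall>u v. \<iota> (br u v) = lie_bracket A (\<iota> u) (\<iota> v))"

section \<open>Riemannian geometry\<close>

definition riemannian_metric ::
  "('a::topological_space, 'e::euclidean_space) chart set \<Rightarrow> 'a metric \<Rightarrow> bool"
  where "riemannian_metric A g \<longleftrightarrow>
    (\<forall>p. \<forall>u\<in>tangent_space A p. \<forall>v\<in>tangent_space A p. g p u v = g p v u) \<and>
    (\<forall>p. \<forall>u\<in>tangent_space A p. \<forall>v\<in>tangent_space A p. \<forall>w\<in>tangent_space A p.
       g p (u + v) w = g p u w + g p v w) \<and>
    (\<forall>p r. \<forall>u\<in>tangent_space A p. \<forall>v\<in>tangent_space A p. g p (r *\<^sub>R u) v = r * g p u v) \<and>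
    (\<forall>p. \<forall>u\<in>tangent_space A p. u \<noteq> 0 \<longrightarrow> g p u u > 0) \<and>
    (\<forall>U V. vector_field A U \<longrightarrow> vector_field A V \<longrightarrow> smooth_fun A UNIV (\<lambda>p. g p (U p) (V p)))"

definition left_invariant_metric ::
  "('a::topological_space, 'e::euclidean_space) chart set \<Rightarrow> ('a \<Rightarrow> 'a \<Rightarrow> 'a) \<Rightarrow> 'a metric \<Rightarrow> bool"
  where "left_invariant_metric A mul g \<longleftrightarrow>
    (\<forall>a p. \<forall>u\<in>tangent_space A p. \<forall>v\<in>tangent_space A p.
       g (mul a p) (pushforward A (mul a) p u) (pushforward A (mul a) p v) = g p u v)"

definition levi_civita ::
  "('a::topological_space, 'e::euclidean_space) chart set \<Rightarrow> 'a metric \<Rightarrow> 'a connection \<Rightarrow> bool"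
  where "levi_civita A g nabla \<longleftrightarrow>
    (\<forall>U V. vector_field A U \<longrightarrow> vector_field A V \<longrightarrow>
       vector_field A (nabla U V) \<and>
       nabla U V - nabla V U = lie_bracket A U V) \<and>
    (\<forall>U V W. vector_field A U \<longrightarrow> vector_field A V \<longrightarrow> vector_field A W \<longrightarrow>
       nabla (U + V) W = nabla U W + nabla V W \<and>
       nabla U (V + W) = nabla U V + nabla U W \<and>
       (\<forall>p. U p (\<lambda>q. g q (V q) (W q)) = g p (nabla U V p) (W p) + g p (V p) (nabla U W p))) \<and>
    (\<forall>f U V. smooth_fun A UNIV f \<longrightarrow> vector_field A U \<longrightarrow> vector_field A V \<longrightarrow>
       nabla (fun_times f U) V = fun_times f (nabla U V) \<and>
       nabla U (fun_times f V) = fun_times (\<lambda>p. U p f) V + fun_times f (nabla U V))"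

definition curvature ::
  "('a::topological_space, 'e::euclidean_space) chart set \<Rightarrow> 'a connection \<Rightarrow>
   'a vfield \<Rightarrow> 'a vfield \<Rightarrow> 'a vfield \<Rightarrow> 'a vfield"
  where "curvature A nabla U V W =
    nabla U (nabla V W) - nabla V (nabla U W) - nabla (lie_bracket A U V) W"

definition sections ::
  "('a::topological_space, 'e::euclidean_space) chart set \<Rightarrow> 'a distr \<Rightarrow> 'a vfield set"
  where "sections A D = {U. vector_field A U \<and> (\<forall>p. U p \<in> D p)}"

text \<open>Sections of a distribution whose values at the given point form an orthonormal basis
  of the fibre.\<close>

definition orthonormal_at ::
  "('a::topological_space, 'e::euclidean_space) chart set \<Rightarrow> 'a metric \<Rightarrow> 'a distr \<Rightarrow> 'a \<Rightarrow>
   (nat \<Rightarrow> 'a vfield) \<Rightarrow> bool"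
  where "orthonormal_at A g D p E \<longleftrightarrow>
    (\<forall>i<dim (D p). E i \<in> sections A D) \<and>
    (\<forall>i<dim (D p). \<forall>j<dim (D p). g p (E i p) (E j p) = (if i = j then 1 else 0)) \<and>
    span ((\<lambda>i. E i p) ` {..<dim (D p)}) = D p"

text \<open>The trace at a point of a tensorial bilinear map on sections of a distribution. For
  tensorial maps the result does not depend on the choice of the frame.\<close>

definition metric_trace ::
  "('a::topological_space, 'e::euclidean_space) chart set \<Rightarrow> 'a metric \<Rightarrow> 'a distr \<Rightarrow>
   ('a vfield \<Rightarrow> 'a vfield \<Rightarrow> 'a \<Rightarrow> 'b::real_vector) \<Rightarrow> 'a \<Rightarrow> 'b"
  where "metric_trace A g D T p =
    (let E = (SOME E. orthonormal_at A g D p E) in \<Sum>i<dim (D p). T (E i) (E i) p)"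

definition ricci ::
  "('a::topological_space, 'e::euclidean_space) chart set \<Rightarrow> 'a metric \<Rightarrow> 'a connection \<Rightarrow>
   'a vfield \<Rightarrow> 'a vfield \<Rightarrow> 'a \<Rightarrow> real"
  where "ricci A g nabla V W =
    metric_trace A g (tangent_space A)
      (\<lambda>E F p. g p (curvature A nabla E V W p) (F p))"

definition einstein ::
  "('a::topological_space, 'e::euclidean_space) chart set \<Rightarrow> 'a metric \<Rightarrow> 'a connection \<Rightarrow> bool"
  where "einstein A g nabla \<longleftrightarrow>
    (\<exists>c. \<forall>V W p. vector_field A V \<longrightarrow> vector_field A W \<longrightarrow>
       ricci A g nabla V W p = c * g p (V p) (W p))"

section \<open>Almost Hermitian structures\<close>

definition endo_app :: "'a endo \<Rightarrow> 'a vfield \<Rightarrow> 'a vfield"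
  where "endo_app J U = (\<lambda>p. J p (U p))"

definition almost_hermitian ::
  "('a::topological_space, 'e::euclidean_space) chart set \<Rightarrow> 'a metric \<Rightarrow> 'a endo \<Rightarrow> bool"
  where "almost_hermitian A g J \<longleftrightarrow>
    (\<forall>p. \<forall>u\<in>tangent_space A p. J p u \<in> tangent_space A p \<and> J p (J p u) = - u) \<and>
    (\<forall>p. \<forall>u\<in>tangent_space A p. \<forall>v\<in>tangent_space A p.
       J p (u + v) = J p u + J p v \<and> g p (J p u) (J p v) = g p u v) \<and>
    (\<forall>p r. \<forall>u\<in>tangent_space A p. J p (r *\<^sub>R u) = r *\<^sub>R J p u) \<and>
    (\<forall>U. vector_field A U \<longrightarrow> vector_field A (endo_app J U))"

definition left_invariant_endo ::
  "('a::topological_space, 'e::euclidean_space) chart set \<Rightarrow> ('a \<Rightarrow> 'a \<Rightarrow> 'a) \<Rightarrow> 'a endo \<Rightarrow> bool"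
  where "left_invariant_endo A mul J \<longleftrightarrow>
    (\<forall>a p. \<forall>u\<in>tangent_space A p.
       J (mul a p) (pushforward A (mul a) p u) = pushforward A (mul a) p (J p u))"

definition nijenhuis ::
  "('a::topological_space, 'e::euclidean_space) chart set \<Rightarrow> 'a endo \<Rightarrow>
   'a vfield \<Rightarrow> 'a vfield \<Rightarrow> 'a vfield"
  where "nijenhuis A J U V =
    lie_bracket A (endo_app J U) (endo_app J V) - endo_app J (lie_bracket A (endo_app J U) V)
    - endo_app J (lie_bracket A U (endo_app J V)) - lie_bracket A U V"

definition hermitian ::
  "('a::topological_space, 'e::euclidean_space) chart set \<Rightarrow> 'a metric \<Rightarrow> 'a endo \<Rightarrow> bool"
  where "hermitian A g J \<longleftrightarrow>
    almost_hermitian A g J \<and>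
    (\<forall>U V. vector_field A U \<longrightarrow> vector_field A V \<longrightarrow> nijenhuis A J U V = 0)"

definition kaehler ::
  "('a::topological_space, 'e::euclidean_space) chart set \<Rightarrow> 'a metric \<Rightarrow> 'a connection \<Rightarrow>
   'a endo \<Rightarrow> bool"
  where "kaehler A g nabla J \<longleftrightarrow>
    hermitian A g J \<and>
    (\<forall>U V. vector_field A U \<longrightarrow> vector_field A V \<longrightarrow>
       nabla U (endo_app J V) - endo_app J (nabla U V) = 0)"

section \<open>Distributions and foliations\<close>

definition involutive ::
  "('a::topological_space, 'e::euclidean_space) chart set \<Rightarrow> 'a distr \<Rightarrow> bool"
  where "involutive A D \<longleftrightarrow>
    (\<forall>U\<in>sections A D. \<forall>V\<in>sections A D. lie_bracket A U V \<in> sections A D)"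

text \<open>Integrability in the sense of defining a foliation: locally the distribution is the
  kernel of the differential of a submersion to some Euclidean space (with component
  functions \<open>\<psi>\<close>); the condition on dimensions says that their differentials are independent.\<close>

definition integrable_distribution ::
  "('a::topological_space, 'e::euclidean_space) chart set \<Rightarrow> 'a distr \<Rightarrow> bool"
  where "integrable_distribution A D \<longleftrightarrow>
    (\<forall>p. \<exists>U q (\<psi> :: nat \<Rightarrow> 'a \<Rightarrow> real). open U \<and> p \<in> U \<and> (\<forall>i<q. smooth_fun A U (\<psi> i)) \<and>
       (\<forall>x\<in>U. D x = {v \<in> tangent_space A x. \<forall>i<q. v (\<psi> i) = 0} \<and>
              dim (tangent_space A x) = dim (D x) + q))"

definition has_codimension ::
  "('a::topological_space, 'e::euclidean_space) chart set \<Rightarrow> 'a distr \<Rightarrow> nat \<Rightarrow> bool"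
  where "has_codimension A D q \<longleftrightarrow> (\<forall>p. dim (tangent_space A p) = dim (D p) + q)"

definition orth_compl ::
  "('a::topological_space, 'e::euclidean_space) chart set \<Rightarrow> 'a metric \<Rightarrow> 'a distr \<Rightarrow> 'a distr"
  where "orth_compl A g D p = {u \<in> tangent_space A p. \<forall>v\<in>D p. g p u v = 0}"

definition orth_proj :: "'a metric \<Rightarrow> 'a distr \<Rightarrow> 'a vfield \<Rightarrow> 'a vfield"
  where "orth_proj g D U = (\<lambda>p. THE w. w \<in> D p \<and> (\<forall>v\<in>D p. g p (U p - w) v = 0))"

definition B_ver ::
  "('a::topological_space, 'e::euclidean_space) chart set \<Rightarrow> 'a metric \<Rightarrow> 'a connection \<Rightarrow>
   'a distr \<Rightarrow> 'a vfield \<Rightarrow> 'a vfield \<Rightarrow> 'a vfield"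
  where "B_ver A g nabla D U V =
    (1/2) *\<^sub>R orth_proj g (orth_compl A g D) (nabla U V + nabla V U)"

definition B_hor ::
  "'a metric \<Rightarrow> 'a connection \<Rightarrow> 'a distr \<Rightarrow> 'a vfield \<Rightarrow> 'a vfield \<Rightarrow> 'a vfield"
  where "B_hor g nabla D E F = (1/2) *\<^sub>R orth_proj g D (nabla E F + nabla F E)"

definition conformal_foliation ::
  "('a::topological_space, 'e::euclidean_space) chart set \<Rightarrow> 'a metric \<Rightarrow> 'a connection \<Rightarrow>
   'a distr \<Rightarrow> bool"
  where "conformal_foliation A g nabla D \<longleftrightarrow>
    involutive A D \<and>
    (\<exists>V\<in>sections A D. \<forall>E\<in>sections A (orth_compl A g D). \<forall>F\<in>sections A (orth_compl A g D).
       B_hor g nabla D E F = fun_times (\<lambda>p. g p (E p) (F p)) V)"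

definition minimal_foliation ::
  "('a::topological_space, 'e::euclidean_space) chart set \<Rightarrow> 'a metric \<Rightarrow> 'a connection \<Rightarrow>
   'a distr \<Rightarrow> bool"
  where "minimal_foliation A g nabla D \<longleftrightarrow>
    involutive A D \<and> (\<forall>p. metric_trace A g D (B_ver A g nabla D) p = 0)"

text \<open>The leaf through \<open>p\<close> of the foliation restricted to an open set \<open>U\<close>: the points that can
  be joined to \<open>p\<close> by a curve in \<open>U\<close> tangent to the distribution (one-sided derivatives at the
  end points). Slowing down at corners makes a piecewise smooth curve differentiable, so
  broken curves need not be mentioned.\<close>

definition leaf ::
  "('a::topological_space, 'e::euclidean_space) chart set \<Rightarrow> 'a distr \<Rightarrow> 'a set \<Rightarrow> 'a \<Rightarrow> 'a set"
  where "leaf A D U p =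
    {q. \<exists>\<gamma> :: real \<Rightarrow> 'a. \<gamma> 0 = p \<and> \<gamma> 1 = q \<and> continuous_on {0..1} \<gamma> \<and> \<gamma> ` {0..1} \<subseteq> U \<and>
       (\<forall>t\<in>{0..1}. \<exists>v\<in>D (\<gamma> t). \<forall>f. smooth_near A (\<gamma> t) f \<longrightarrow>
          ((f \<circ> \<gamma>) has_real_derivative v f) (at t within {0..1}))}"

definition complex_diff :: "('a \<Rightarrow> complex) \<Rightarrow> 'a tvec \<Rightarrow> complex"
  where "complex_diff \<phi> v = Complex (v (Re \<circ> \<phi>)) (v (Im \<circ> \<phi>))"

definition horizontally_conformal_submersion ::
  "('a::topological_space, 'e::euclidean_space) chart set \<Rightarrow> 'a metric \<Rightarrow> 'a set \<Rightarrow>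
   ('a \<Rightarrow> complex) \<Rightarrow> bool"
  where "horizontally_conformal_submersion A g U \<phi> \<longleftrightarrow>
    smooth_fun A U \<phi> \<and>
    (\<forall>p\<in>U. complex_diff \<phi> ` tangent_space A p = UNIV) \<and>
    (\<exists>\<Lambda>. \<forall>p\<in>U. \<Lambda> p > 0 \<and>
       (let H = orth_compl A g (\<lambda>x. {v \<in> tangent_space A x. complex_diff \<phi> v = 0}) p in
        \<forall>u\<in>H. \<forall>v\<in>H. complex_diff \<phi> u \<bullet> complex_diff \<phi> v = (\<Lambda> p)\<^sup>2 * g p u v))"

definition holomorphic_foliation ::
  "('a::topological_space, 'e::euclidean_space) chart set \<Rightarrow> 'a metric \<Rightarrow> 'a connection \<Rightarrow>
   'a distr \<Rightarrow> 'a endo \<Rightarrow> bool"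
  where "holomorphic_foliation A g nabla D J \<longleftrightarrow>
    conformal_foliation A g nabla D \<and> has_codimension A D 2 \<and> hermitian A g J \<and>
    (\<forall>p. \<exists>U \<phi>. open U \<and> p \<in> U \<and> horizontally_conformal_submersion A g U \<phi> \<and>
       (\<forall>q\<in>U. {x \<in> U. \<phi> x = \<phi> q} = leaf A D U q) \<and>
       (\<forall>q\<in>U. \<forall>v\<in>tangent_space A q. complex_diff \<phi> (J q v) = \<i> * complex_diff \<phi> v))"

end

theory Submission
  imports Defs
begin

text \<open>All curvature statements are computed in the left-invariant orthonormal frame, using that the
  tensors involved are determined by their values on a frame.

  For the foliation, let \<open>\<zeta>\<close> be the left-invariant 1-form with \<open>\<zeta>(Z) = 1\<close> vanishing on
  \<open>X, Y, W\<close>, and \<open>\<kappa>\<close> the complex 1-form with \<open>\<kappa>(X) = 1\<close>, \<open>\<kappa>(Y) = i\<close> vanishing on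
  \<open>Z, W\<close>. Then \<open>\<zeta>\<close> is closed, so locally \<open>\<zeta> = dt\<close>, and \<open>exp ((\<alpha> + i\<beta>) t) \<kappa>\<close> is closed,
  so locally it is \<open>d\<phi>\<close>. The function \<open>\<phi>\<close> is a horizontally conformal submersion which cuts out
  the leaves and is holomorphic for both complex structures. Thus the Poincare lemma replaces the
  theorems of Frobenius and Newlander-Nirenberg. On a suitable neighbourhood the fibres of \<open>\<phi>\<close>
  are connected by curves because \<open>\<phi>\<close> becomes linear in suitable coordinates.\<close>

section \<open>Smooth functions on open sets\<close>

text \<open>The factor exp ((\<alpha> + i\<beta>) t) is forced: in the coordinate \<kappa>, ad
  \<open>Z\<close> is multiplication by c = \<alpha> + i\<beta>, so d\<kappa> = - c (\<zeta> wedge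
  \<kappa>), and exp (c t) is the integrating factor that cancels this term. Of \<phi> only the
  relation d\<phi> = m \<kappa> with m nowhere zero is kept, because kernel, conformality and
  holomorphy follow from it. Two obstacles shape the proof. Connection, curvature and Nijenhuis
  tensor take global vector fields as arguments, so pointwise computations need a global frame that
  fills every tangent space; this comes from extending tangent vectors at \<open>e\<close> and
  counting dimensions. The Poincare lemma lives in coordinates, whereas the forms are given by their
  values on a frame; their coordinate coefficients are smooth because the dual of a smooth frame is
  smooth, which is shown by bootstrapping its derivative. Traces use a frame picked by the choice
  operator, so the Ricci tensor is evaluated through Parseval's identity.\<close>

lemma Ck_on_SucD:
  assumes "Ck_on (Suc k) S f" "x \<in> S"
  shows "(f has_derivative frechet_derivative f (at x)) (at x)"
  using assms by (simp add: frechet_derivative_works[symmetric])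

text \<open>Derivatives are taken in the full space, so values on \<open>S\<close> determine them
  because \<open>S\<close> is open.\<close>

lemma Ck_on_cong:
  assumes "open S" "Ck_on k S f" "\<And>x. x \<in> S \<Longrightarrow> f x = g x"
  shows "Ck_on k S g"
  using assms(2,3)
proof (induction k arbitrary: f g)
  case 0
  then show ?case by (simp cong: continuous_on_cong)
next
  case (Suc k)
  have der: "(g has_derivative frechet_derivative f (at x)) (at x)" if "x \<in> S" for x
    by (rule has_derivative_transform_within_open[OF Ck_on_SucD[OF Suc.prems(1) that] \<open>open S\<close> that])
      (use Suc.prems in auto)
  have "Ck_on k S (\<lambda>x. frechet_derivative g (at x) v)" for v
  proof (rule Suc.IH)
    show "Ck_on k S (\<lambda>x. frechet_derivative f (at x) v)" using Suc.prems(1) by simp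
    show "frechet_derivative f (at x) v = frechet_derivative g (at x) v" if "x \<in> S" for x
      using frechet_derivative_at[OF der[OF that]] by simp
  qed
  then show ?case using der by (auto intro: differentiableI)
qed

text \<open>Uniqueness of derivatives lets an explicit family \<open>f'\<close> stand in for the
  operator \<open>frechet_derivative\<close>, so inductions on the order can use concrete
  formulas.\<close>

lemma Ck_on_Suc_derivativeI:
  assumes der: "\<And>x. x \<in> S \<Longrightarrow> (f has_derivative f' x) (at x)"
    and "open S" and Ck: "\<And>v. Ck_on k S (\<lambda>x. f' x v)"
  shows "Ck_on (Suc k) S f"
proof -
  have "Ck_on k S (\<lambda>x. frechet_derivative f (at x) v)" for v
    by (rule Ck_on_cong[OF \<open>open S\<close> Ck]) (simp add: frechet_derivative_at[OF der, symmetric])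
  then show ?thesis using der by (auto intro: differentiableI)
qed

lemma Ck_on_Suc_imp: "Ck_on (Suc k) S f \<Longrightarrow> Ck_on k S f"
proof (induction k arbitrary: f)
  case 0
  then show ?case
    by (simp add: continuous_at_imp_continuous_on differentiable_imp_continuous_within)
next
  case (Suc k)
  then show ?case by (subst (asm) Ck_on.simps(2)) simp
qed

lemma Ck_on_subset: "Ck_on k S f \<Longrightarrow> T \<subseteq> S \<Longrightarrow> Ck_on k T f"
  by (induction k arbitrary: f) (auto intro: continuous_on_subset)

lemma Ck_on_local:
  assumes "\<And>x. x \<in> S \<Longrightarrow> \<exists>T. open T \<and> x \<in> T \<and> Ck_on k T f"
  shows "Ck_on k S f"
  using assms
proof (induction k arbitrary: f)
  case 0
  have "continuous (at x) f" if "x \<in> S" for x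
    using 0[OF that] by (auto simp: continuous_on_eq_continuous_at)
  then show ?case by (simp add: continuous_at_imp_continuous_on)
next
  case (Suc k)
  have "f differentiable at x" if "x \<in> S" for x
    using Suc.prems[OF that] by auto
  moreover have "Ck_on k S (\<lambda>x. frechet_derivative f (at x) v)" for v
    by (rule Suc.IH) (use Suc.prems in fastforce)
  ultimately show ?case by simp
qed

lemma Ck_on_const: "open S \<Longrightarrow> Ck_on k S (\<lambda>x. c)"
proof (induction k arbitrary: c)
  case (Suc k)
  then show ?case
    by (intro Ck_on_Suc_derivativeI[where f' = "\<lambda>x v. 0"]) auto
qed simp

lemma Ck_on_linear:
  assumes "bounded_linear L" "open S" "Ck_on k S f"
  shows "Ck_on k S (\<lambda>x. L (f x))"
  using assms(3)
proof (induction k arbitrary: f)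
  case 0
  then show ?case
    using bounded_linear.continuous_on[OF assms(1)] by auto
next
  case (Suc k)
  show ?case
  proof (rule Ck_on_Suc_derivativeI)
    show "((\<lambda>x. L (f x)) has_derivative (\<lambda>v. L (frechet_derivative f (at x) v))) (at x)"
      if "x \<in> S" for x
      using bounded_linear.has_derivative[OF assms(1) Ck_on_SucD[OF Suc.prems that]] .
  qed (use Suc assms in auto)
qed

lemma Ck_on_add:
  assumes "open S" "Ck_on k S f" "Ck_on k S g"
  shows "Ck_on k S (\<lambda>x. f x + g x)"
  using assms(2,3)
proof (induction k arbitrary: f g)
  case 0
  then show ?case by (simp add: continuous_on_add)
next
  case (Suc k)
  show ?case
  proof (rule Ck_on_Suc_derivativeI[OF _ assms(1)])
    show "((\<lambda>x. f x + g x) has_derivative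
        (\<lambda>v. frechet_derivative f (at x) v + frechet_derivative g (at x) v)) (at x)"
      if "x \<in> S" for x
      using Ck_on_SucD[OF Suc.prems(1) that] Ck_on_SucD[OF Suc.prems(2) that]
      by (rule has_derivative_add)
  qed (use Suc in auto)
qed

lemma Ck_on_bilinear:
  assumes B: "bounded_bilinear B" and "open S" "Ck_on k S f" "Ck_on k S g"
  shows "Ck_on k S (\<lambda>x. B (f x) (g x))"
  using assms(3,4)
proof (induction k arbitrary: f g)
  case 0
  then show ?case by (simp add: bounded_bilinear.continuous_on[OF B])
next
  case (Suc k)
  show ?case
  proof (rule Ck_on_Suc_derivativeI[OF _ \<open>open S\<close>])
    show "((\<lambda>x. B (f x) (g x)) has_derivative
        (\<lambda>v. B (f x) (frechet_derivative g (at x) v) + B (frechet_derivative f (at x) v) (g x))) (at x)"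
      if "x \<in> S" for x
      using bounded_bilinear.FDERIV[OF B Ck_on_SucD[OF Suc.prems(1) that] Ck_on_SucD[OF Suc.prems(2) that]] .
    show "Ck_on k S (\<lambda>x. B (f x) (frechet_derivative g (at x) v) + B (frechet_derivative f (at x) v) (g x))"
      for v
    proof -
      have "Ck_on k S f" "Ck_on k S g"
        using Suc.prems Ck_on_Suc_imp by blast+
      moreover have "Ck_on k S (\<lambda>x. frechet_derivative f (at x) v)" "Ck_on k S (\<lambda>x. frechet_derivative g (at x) v)"
        using Suc.prems by simp_all
      ultimately show ?thesis
        by (intro Ck_on_add \<open>open S\<close> Suc.IH)
    qed
  qed
qed

lemma Ck_on_sum:
  assumes "open S" "\<And>i. i \<in> I \<Longrightarrow> Ck_on k S (f i)"
  shows "Ck_on k S (\<lambda>x. \<Sum>i\<in>I. f i x)"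
  using assms(2)
  by (induction I rule: infinite_finite_induct) (auto intro: Ck_on_const Ck_on_add assms(1))

text \<open>In the chain rule the derivative of \<open>g\<close> is taken in a direction that moves
  with x, but \<open>Ck_on\<close> controls fixed directions only. Expanding that direction in the
  basis of the middle space separates the two dependencies.\<close>

lemma Ck_on_compose:
  fixes f :: "'e::real_normed_vector \<Rightarrow> 'm::euclidean_space" and g :: "'m \<Rightarrow> 'f::real_normed_vector"
  assumes "open S" "open T" "f ` S \<subseteq> T" "Ck_on k S f" "Ck_on k T g"
  shows "Ck_on k S (\<lambda>x. g (f x))"
  using assms(4,5)
proof (induction k arbitrary: g)
  case 0
  then show ?case using assms(3) by (auto intro: continuous_on_compose2)
next
  case (Suc k)
  show ?case
  proof (rule Ck_on_Suc_derivativeI[OF _ \<open>open S\<close>])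
    fix x assume x: "x \<in> S"
    let ?Dg = "frechet_derivative g (at (f x))" and ?Df = "frechet_derivative f (at x)"
    have Dg: "(g has_derivative ?Dg) (at (f x))"
      using Ck_on_SucD[OF Suc.prems(2)] x assms(3) by auto
    have *: "?Dg u = (\<Sum>b\<in>Basis. (u \<bullet> b) *\<^sub>R ?Dg b)" for u
      using linear_sum[OF has_derivative_linear[OF Dg], of "\<lambda>b. (u \<bullet> b) *\<^sub>R b" Basis]
      by (simp add: linear_cmul[OF has_derivative_linear[OF Dg]] euclidean_representation)
    show "((\<lambda>x. g (f x)) has_derivative
        (\<lambda>v. \<Sum>b\<in>Basis. (?Df v \<bullet> b) *\<^sub>R ?Dg b)) (at x)"
      using has_derivative_compose[OF Ck_on_SucD[OF Suc.prems(1) x] Dg]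
      unfolding *[of "?Df _", symmetric] .
  next
    fix v
    have "Ck_on k S (\<lambda>x. frechet_derivative g (at (f x)) b)" for b
      by (rule Suc.IH) (use Suc.prems Ck_on_Suc_imp in auto)
    then show "Ck_on k S (\<lambda>x. \<Sum>b\<in>Basis. (frechet_derivative f (at x) v \<bullet> b) *\<^sub>R frechet_derivative g (at (f x)) b)"
      using Suc.prems(1)
      by (intro Ck_on_sum Ck_on_bilinear[OF bounded_bilinear_scaleR] Ck_on_linear[OF bounded_linear_inner_left] \<open>open S\<close>) auto
  qed
qed

lemma smooth_on_cong:
  "open S \<Longrightarrow> smooth_on S f \<Longrightarrow> (\<And>x. x \<in> S \<Longrightarrow> f x = g x) \<Longrightarrow> smooth_on S g"
  unfolding smooth_on_def using Ck_on_cong by blast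

lemma smooth_on_subset: "smooth_on S f \<Longrightarrow> T \<subseteq> S \<Longrightarrow> smooth_on T f"
  unfolding smooth_on_def using Ck_on_subset by blast

lemma smooth_on_local:
  assumes "\<And>x. x \<in> S \<Longrightarrow> \<exists>T. open T \<and> x \<in> T \<and> smooth_on T f"
  shows "smooth_on S f"
  unfolding smooth_on_def
  by (intro allI Ck_on_local) (use assms in \<open>unfold smooth_on_def, blast\<close>)

lemma smooth_on_has_derivative:
  "smooth_on S f \<Longrightarrow> x \<in> S \<Longrightarrow> (f has_derivative frechet_derivative f (at x)) (at x)"
  unfolding smooth_on_def using Ck_on_SucD by blast

lemma smooth_on_frechet_derivative:
  "smooth_on S f \<Longrightarrow> smooth_on S (\<lambda>x. frechet_derivative f (at x) v)"
  unfolding smooth_on_def by (metis Ck_on.simps(2))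

lemma smooth_on_imp_continuous_on: "smooth_on S f \<Longrightarrow> continuous_on S f"
  unfolding smooth_on_def by (metis Ck_on.simps(1))

lemma smooth_onI_derivative:
  assumes "open S" "\<And>x. x \<in> S \<Longrightarrow> (f has_derivative f' x) (at x)" "\<And>v. smooth_on S (\<lambda>x. f' x v)"
  shows "smooth_on S f"
  unfolding smooth_on_def
proof
  fix k show "Ck_on k S f"
    \<comment> \<open>Proving one order more and dropping it again avoids a separate case for order
      0.\<close>
    by (rule Ck_on_Suc_imp, rule Ck_on_Suc_derivativeI)
      (use assms in \<open>unfold smooth_on_def, auto\<close>)
qed

lemma smooth_on_const: "open S \<Longrightarrow> smooth_on S (\<lambda>x. c)"
  unfolding smooth_on_def by (simp add: Ck_on_const)

lemma smooth_on_linear: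
  "bounded_linear L \<Longrightarrow> open S \<Longrightarrow> smooth_on S f \<Longrightarrow> smooth_on S (\<lambda>x. L (f x))"
  unfolding smooth_on_def by (simp add: Ck_on_linear)

lemma smooth_on_id: "open S \<Longrightarrow> smooth_on S (\<lambda>x. x)"
  by (rule smooth_onI_derivative[where f' = "\<lambda>x v. v"]) (auto intro: smooth_on_const)

lemma smooth_on_add:
  "open S \<Longrightarrow> smooth_on S f \<Longrightarrow> smooth_on S g \<Longrightarrow> smooth_on S (\<lambda>x. f x + g x)"
  unfolding smooth_on_def by (simp add: Ck_on_add)

lemma smooth_on_bilinear:
  "bounded_bilinear B \<Longrightarrow> open S \<Longrightarrow> smooth_on S f \<Longrightarrow> smooth_on S g \<Longrightarrow>
    smooth_on S (\<lambda>x. B (f x) (g x))"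
  unfolding smooth_on_def by (simp add: Ck_on_bilinear)

lemma smooth_on_sum:
  "open S \<Longrightarrow> (\<And>i. i \<in> I \<Longrightarrow> smooth_on S (f i)) \<Longrightarrow> smooth_on S (\<lambda>x. \<Sum>i\<in>I. f i x)"
  unfolding smooth_on_def by (simp add: Ck_on_sum)

lemma smooth_on_compose:
  fixes f :: "'e::real_normed_vector \<Rightarrow> 'm::euclidean_space" and g :: "'m \<Rightarrow> 'f::real_normed_vector"
  assumes "open S" "open T" "f ` S \<subseteq> T" "smooth_on S f" "smooth_on T g"
  shows "smooth_on S (\<lambda>x. g (f x))"
  using assms unfolding smooth_on_def by (blast intro: Ck_on_compose)

lemma smooth_on_Pair:
  assumes "open S" "smooth_on S f" "smooth_on S g"
  shows "smooth_on S (\<lambda>x. (f x, g x))"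
proof -
  have "bounded_linear (\<lambda>x. (x, 0))" "bounded_linear (\<lambda>x. (0, x))"
    by (auto intro!: bounded_linear_Pair bounded_linear_ident bounded_linear_zero)
  from smooth_on_linear[OF this(1) assms(1,2)] smooth_on_linear[OF this(2) assms(1,3)]
  show ?thesis
    using smooth_on_add[OF assms(1)] by fastforce
qed

text \<open>Differentiation only changes the prefactor \<open>c\<close>, so the family is closed
  under derivatives once the induction is general in \<open>c\<close>.\<close>

lemma smooth_on_exp_scaleR:
  fixes c l :: "'b::{real_normed_field,banach}"
  shows "smooth_on UNIV (\<lambda>t. c * exp (t *\<^sub>R l))"
proof -
  have "Ck_on k UNIV (\<lambda>t. c * exp (t *\<^sub>R l))" for k
  proof (induction k arbitrary: c)
    case 0
    then show ?case by (auto intro!: continuous_intros)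
  next
    case (Suc k)
    show ?case
    proof (rule Ck_on_Suc_derivativeI)
      show "((\<lambda>t. c * exp (t *\<^sub>R l)) has_derivative (\<lambda>v. (v *\<^sub>R (c * l)) * exp (t *\<^sub>R l))) (at t)" for t
        using has_derivative_mult_right[OF exp_scaleR_has_vector_derivative_right[of l t UNIV, unfolded has_vector_derivative_def], of c]
        by (simp add: algebra_simps)
      show "Ck_on k UNIV (\<lambda>t. (v *\<^sub>R (c * l)) * exp (t *\<^sub>R l))" for v
        by (rule Suc)
    qed simp
  qed
  then show ?thesis by (simp add: smooth_on_def)
qed

section \<open>Dual frames and primitives of closed forms\<close>

text \<open>Product rule with a factor \<open>q\<close> that is merely continuous: its missing
  derivative would be multiplied by \<open>p y = 0\<close>. It is needed for dual frames, whose
  continuity is known before their differentiability.\<close>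

lemma has_derivative_mult_zero:
  fixes p q :: "'a::real_normed_vector \<Rightarrow> real"
  assumes p: "(p has_derivative p') (at y)" and "p y = 0" and q: "continuous (at y) q"
  shows "((\<lambda>x. p x * q x) has_derivative (\<lambda>v. p' v * q y)) (at y)"
proof -
  have bl: "bounded_linear p'"
    using p by (rule has_derivative_bounded_linear)
  then obtain K where K: "\<And>h. \<bar>p' h\<bar> \<le> norm h * K"
    using bounded_linear.bounded by (metis real_norm_def)
  have q0: "((\<lambda>h. q (y + h)) \<longlongrightarrow> q y) (at 0)"
    using q unfolding continuous_at by (simp add: LIM_offset_zero)
  have p0: "((\<lambda>h. (p (y + h) - p' h) / norm h) \<longlongrightarrow> 0) (at 0)"
  proof (rule tendsto_norm_zero_cancel)
    have "(\<lambda>h. norm (p (y + h) - p y - p' h) / norm h) \<midarrow>0\<rightarrow> 0"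
      using p unfolding has_derivative_at by (rule conjunct2)
    then show "((\<lambda>h. norm ((p (y + h) - p' h) / norm h)) \<longlongrightarrow> 0) (at 0)"
      by (simp add: \<open>p y = 0\<close>)
  qed
  have q1: "((\<lambda>h. p' h / norm h * (q (y + h) - q y)) \<longlongrightarrow> 0) (at 0)"
  proof (rule Lim_null_comparison)
    have "\<bar>p' h / norm h\<bar> \<le> K" if "h \<noteq> 0" for h
      using K[of h] that by (simp add: field_simps)
    then have "norm (p' h / norm h * (q (y + h) - q y)) \<le> K * \<bar>q (y + h) - q y\<bar>" if "h \<noteq> 0" for h
      using that by (simp only: real_norm_def abs_mult) (intro mult_right_mono, auto)
    then show "\<forall>\<^sub>F h in at 0. norm (p' h / norm h * (q (y + h) - q y)) \<le> K * \<bar>q (y + h) - q y\<bar>"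
      by (auto simp: eventually_at_filter)
    have "((\<lambda>h. K * \<bar>q (y + h) - q y\<bar>) \<longlongrightarrow> K * \<bar>q y - q y\<bar>) (at 0)"
      by (intro tendsto_intros q0)
    then show "((\<lambda>h. K * \<bar>q (y + h) - q y\<bar>) \<longlongrightarrow> 0) (at 0)" by simp
  qed
  have "((\<lambda>h. (p (y + h) - p' h) / norm h * q (y + h) + p' h / norm h * (q (y + h) - q y)) \<longlongrightarrow> 0 * q y + 0) (at 0)"
    by (intro tendsto_intros p0 q0 q1)
  then have "((\<lambda>h. (p (y + h) * q (y + h) - p y * q y - p' h * q y) / norm h) \<longlongrightarrow> 0) (at 0)"
    by (simp add: \<open>p y = 0\<close> algebra_simps add_divide_distrib diff_divide_distrib)
  from tendsto_norm_zero[OF this] show ?thesis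
    unfolding has_derivative_at
    by (simp add: bounded_linear_mult_const[OF bl])
qed

section \<open>Smoothness of the coframe dual to a smooth frame\<close>

context
  fixes I :: "'i set" and S :: "'e::euclidean_space set"
    and E :: "'i \<Rightarrow> 'e \<Rightarrow> 'e" and r :: "'i \<Rightarrow> 'e \<Rightarrow> 'e \<Rightarrow> real"
  assumes fin: "finite I" and opn: "open S"
    and sm: "\<And>i. i \<in> I \<Longrightarrow> smooth_on S (E i)"
    and lin: "\<And>i x. i \<in> I \<Longrightarrow> x \<in> S \<Longrightarrow> linear (r i x)"
    and rep: "\<And>x w. x \<in> S \<Longrightarrow> (\<Sum>i\<in>I. r i x w *\<^sub>R E i x) = w"
    and dual: "\<And>x i j. x \<in> S \<Longrightarrow> i \<in> I \<Longrightarrow> j \<in> I \<Longrightarrow> r i x (E j x) = (if i = j then 1 else 0)"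
begin

text \<open>Expand \<open>w\<close> in the frame at \<open>y\<close> and apply the coframe at
  \<open>x\<close>; duality at \<open>x\<close> leaves an error that is linear in the change of the
  frame vectors. This is a finite-difference form of the derivative of an inverse matrix.\<close>

lemma dual_frame_difference:
  assumes "x \<in> S" "y \<in> S" "i \<in> I"
  shows "r i x w = r i y w - (\<Sum>j\<in>I. r j y w * r i x (E j x - E j y))"
proof -
  interpret l: linear "r i x" using lin assms by blast
  have "r i x w = r i x (\<Sum>j\<in>I. r j y w *\<^sub>R E j y)"
    using rep[OF \<open>y \<in> S\<close>] by simp
  also have "\<dots> = (\<Sum>j\<in>I. r j y w * r i x (E j y))"
    by (simp add: l.sum l.scale)
  also have "\<dots> = (\<Sum>j\<in>I. r j y w * r i x (E j x)) - (\<Sum>j\<in>I. r j y w * r i x (E j x - E j y))"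
    by (simp add: l.diff algebra_simps sum_subtractf)
  also have "(\<Sum>j\<in>I. r j y w * r i x (E j x)) = (\<Sum>j\<in>I. if j = i then r i y w else 0)"
    by (intro sum.cong refl) (use dual assms in auto)
  also have "\<dots> = r i y w"
    using assms fin by simp
  finally show ?thesis .
qed

text \<open>The difference identity bounds the operator norm at \<open>x\<close> by K + K
  \<delta>(x) times the same norm, where K bounds the coframe at \<open>y\<close> and \<delta>(x)
  measures the change of the frame. As \<delta> tends to 0 the second term can be absorbed, so the
  norm is at most 2 K near \<open>y\<close>, and the identity then gives continuity.\<close>

lemma dual_frame_continuous:
  assumes y: "y \<in> S" and i: "i \<in> I"
  shows "continuous (at y) (\<lambda>x. r i x w)"
proof -
  have "\<exists>K>0. \<forall>w. \<bar>r j y w\<bar> \<le> norm w * K" if "j \<in> I" for j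
    using bounded_linear.pos_bounded[of "r j y"] lin[OF that y] by (simp add: linear_conv_bounded_linear)
  then obtain k where k: "\<And>j. j \<in> I \<Longrightarrow> k j > 0" "\<And>j w. j \<in> I \<Longrightarrow> \<bar>r j y w\<bar> \<le> norm w * k j"
    by metis
  define K where "K = (\<Sum>j\<in>I. k j)"
  have kK: "k j \<le> K" if "j \<in> I" for j
    unfolding K_def using fin k(1) that by (intro member_le_sum) (auto intro: less_imp_le)
  have Kpos: "K > 0" using k(1)[OF i] kK[OF i] by simp
  have K: "\<bar>r j y w\<bar> \<le> norm w * K" if "j \<in> I" for j w
    using k(2)[OF that, of w] mult_left_mono[OF kK[OF that], of "norm w"] by auto
  define \<delta> where "\<delta> x = (\<Sum>j\<in>I. norm (E j x - E j y))" for x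
  have \<delta>0: "(\<delta> \<longlongrightarrow> 0) (at y)"
  proof -
    have "isCont (E j) y" if "j \<in> I" for j
      using smooth_on_has_derivative[OF sm[OF that] y] by (rule has_derivative_continuous)
    then have "(\<delta> \<longlongrightarrow> (\<Sum>j\<in>I. norm (E j y - E j y))) (at y)"
      unfolding \<delta>_def by (intro tendsto_intros) (auto simp: isCont_def)
    then show ?thesis by simp
  qed
  have \<delta>nn: "\<delta> x \<ge> 0" for x unfolding \<delta>_def by (simp add: sum_nonneg)
  have bl: "bounded_linear (r i x)" if "x \<in> S" for x
    using lin[OF i that] by (simp add: linear_conv_bounded_linear)
  have diff: "\<bar>r i x w - r i y w\<bar> \<le> norm w * K * onorm (r i x) * \<delta> x" if x: "x \<in> S" for x w
  proof -
    have "\<bar>r i x w - r i y w\<bar> \<le> (\<Sum>j\<in>I. \<bar>r j y w * r i x (E j x - E j y)\<bar>)"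
      using dual_frame_difference[OF x y i, of w] sum_abs[of "\<lambda>j. r j y w * r i x (E j x - E j y)" I] by simp
    also have "\<dots> \<le> (\<Sum>j\<in>I. (norm w * K) * (onorm (r i x) * norm (E j x - E j y)))"
      unfolding abs_mult
      using K onorm[OF bl[OF x]] Kpos by (intro sum_mono mult_mono) auto
    finally show ?thesis by (simp add: \<delta>_def sum_distrib_left mult.assoc)
  qed
  have bd: "onorm (r i x) \<le> 2 * K" if x: "x \<in> S" and small: "K * \<delta> x \<le> 1 / 2" for x
  proof -
    let ?o = "onorm (r i x)"
    have "?o \<le> K + K * ?o * \<delta> x"
    proof (rule onorm_le)
      fix w
      have "\<bar>r i x w\<bar> \<le> norm w * K + norm w * K * ?o * \<delta> x"
        using diff[OF x, of w] K[OF i, of w] by linarith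
      then show "norm (r i x w) \<le> (K + K * ?o * \<delta> x) * norm w"
        by (simp add: algebra_simps)
    qed
    moreover have "K * ?o * \<delta> x \<le> ?o * (1 / 2)"
      using mult_left_mono[OF small onorm_pos_le[OF bl[OF x]]] by (simp add: algebra_simps)
    ultimately show ?thesis by simp
  qed
  have "((\<lambda>x. r i x w - r i y w) \<longlongrightarrow> 0) (at y)"
  proof (rule Lim_null_comparison)
    have "((\<lambda>x. K * \<delta> x) \<longlongrightarrow> K * 0) (at y)" by (intro tendsto_intros \<delta>0)
    then have "\<forall>\<^sub>F x in at y. K * \<delta> x < 1/2"
      by (rule order_tendstoD) simp
    moreover have "\<forall>\<^sub>F x in at y. x \<in> S"
      using opn y by (rule eventually_at_in_open')
    ultimately show "\<forall>\<^sub>F x in at y. norm (r i x w - r i y w) \<le> norm w * K * (2 * K) * \<delta> x"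
    proof eventually_elim
      case (elim x)
      have "norm w * K * onorm (r i x) * \<delta> x \<le> norm w * K * (2 * K) * \<delta> x"
        using bd[OF elim(2)] elim(1) Kpos \<delta>nn[of x] by (intro mult_right_mono mult_left_mono) auto
      then show ?case using diff[OF elim(2), of w] by simp
    qed
    have "((\<lambda>x. norm w * K * (2 * K) * \<delta> x) \<longlongrightarrow> norm w * K * (2 * K) * 0) (at y)"
      by (intro tendsto_intros \<delta>0)
    then show "((\<lambda>x. norm w * K * (2 * K) * \<delta> x) \<longlongrightarrow> 0) (at y)" by simp
  qed
  then show ?thesis
    unfolding continuous_at by (rule LIM_zero_cancel)
qed

text \<open>In the difference identity each error term is a factor vanishing at \<open>y\<close>
  times a coframe value that is continuous there, so \<open>has_derivative_mult_zero\<close> applies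
  to it.\<close>

lemma dual_frame_derivative:
  assumes y: "y \<in> S" and i: "i \<in> I"
  shows "((\<lambda>x. r i x w) has_derivative
    (\<lambda>v. \<Sum>j\<in>I. \<Sum>b\<in>Basis. - r j y w * ((frechet_derivative (E j) (at y) v \<bullet> b) * r i y b))) (at y)"
proof (rule has_derivative_transform_within_open[OF _ opn y])
  fix x assume x: "x \<in> S"
  interpret l: linear "r i x" using lin i x by blast
  have "r i x (E j x - E j y) = (\<Sum>b\<in>Basis. ((E j x - E j y) \<bullet> b) * r i x b)" for j
    using l.sum[of "\<lambda>b. ((E j x - E j y) \<bullet> b) *\<^sub>R b" Basis]
    by (simp add: euclidean_representation l.scale)
  then show "r i y w + (\<Sum>j\<in>I. \<Sum>b\<in>Basis. - r j y w * (((E j x - E j y) \<bullet> b) * r i x b)) = r i x w"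
    using dual_frame_difference[OF x y i, of w] by (simp add: sum_distrib_left sum_negf)
next
  have "((\<lambda>x. ((E j x - E j y) \<bullet> b) * r i x b) has_derivative
      (\<lambda>v. (frechet_derivative (E j) (at y) v \<bullet> b) * r i y b)) (at y)" if "j \<in> I" for j b
  proof (rule has_derivative_mult_zero[OF _ _ dual_frame_continuous[OF y i]])
    have "((\<lambda>x. (E j x - E j y) \<bullet> b) has_derivative (\<lambda>v. (frechet_derivative (E j) (at y) v - 0) \<bullet> b)) (at y)"
      by (intro derivative_intros smooth_on_has_derivative[OF sm[OF that] y])
    then show "((\<lambda>x. (E j x - E j y) \<bullet> b) has_derivative (\<lambda>v. frechet_derivative (E j) (at y) v \<bullet> b)) (at y)"
      by simp
  qed simp
  then have "((\<lambda>x. r i y w + (\<Sum>j\<in>I. \<Sum>b\<in>Basis. - r j y w * (((E j x - E j y) \<bullet> b) * r i x b))) has_derivative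
    (\<lambda>v. 0 + (\<Sum>j\<in>I. \<Sum>b\<in>Basis. - r j y w * ((frechet_derivative (E j) (at y) v \<bullet> b) * r i y b)))) (at y)"
    by (intro has_derivative_add has_derivative_const has_derivative_sum has_derivative_mult_right)
  then show "((\<lambda>x. r i y w + (\<Sum>j\<in>I. \<Sum>b\<in>Basis. - r j y w * (((E j x - E j y) \<bullet> b) * r i x b))) has_derivative
    (\<lambda>v. \<Sum>j\<in>I. \<Sum>b\<in>Basis. - r j y w * ((frechet_derivative (E j) (at y) v \<bullet> b) * r i y b))) (at y)"
    by simp
qed

text \<open>Bootstrapping: the derivative is a polynomial in coframe values and derivatives of the
  frame, so order k for the whole coframe yields order k + 1.\<close>

lemma dual_frame_smooth:
  assumes "i \<in> I" shows "smooth_on S (\<lambda>x. r i x w)"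
proof -
  have "Ck_on k S (\<lambda>x. r i x w)" if "i \<in> I" for k i w
    using that
  proof (induction k arbitrary: i w)
    case 0
    then show ?case
      by (auto intro!: continuous_at_imp_continuous_on dual_frame_continuous)
  next
    case (Suc k)
    show ?case
    proof (rule Ck_on_Suc_derivativeI[OF dual_frame_derivative opn])
      fix v
      have "Ck_on k S (\<lambda>x. frechet_derivative (E j) (at x) v)" if "j \<in> I" for j
        using smooth_on_frechet_derivative[OF sm[OF that]] by (simp add: smooth_on_def)
      then show "Ck_on k S (\<lambda>y. \<Sum>j\<in>I. \<Sum>b\<in>Basis. - r j y w * ((frechet_derivative (E j) (at y) v \<bullet> b) * r i y b))"
        by (intro Ck_on_sum Ck_on_bilinear[OF bounded_bilinear_mult] opn Ck_on_linear[OF bounded_linear_inner_left]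
            Ck_on_linear[OF bounded_linear_minus[OF bounded_linear_ident]] Suc) auto
    qed (use Suc in auto)
  qed
  then show ?thesis using assms by (simp add: smooth_on_def)
qed

end

section \<open>Primitives of closed one-forms with values in a Euclidean space\<close>

lemma linear_euclidean_expansion:
  fixes L :: "'e::euclidean_space \<Rightarrow> 'b::real_vector"
  assumes "linear L" shows "(\<Sum>b\<in>Basis. (u \<bullet> b) *\<^sub>R L b) = L u"
  using linear_sum[OF assms, of "\<lambda>b. (u \<bullet> b) *\<^sub>R b" Basis]
  by (simp add: linear_cmul[OF assms] euclidean_representation)

text \<open>The primitive is the integral of the form along the segment from a fixed point
  \<open>c\<close> to \<open>x\<close>. Differentiation under the integral and closedness turn its
  derivative into the integral of a total derivative in the segment parameter.\<close>

lemma primitive_of_closed_form: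
  fixes \<omega> :: "'e::euclidean_space \<Rightarrow> 'e \<Rightarrow> 'b::euclidean_space"
  assumes opn: "open S" and cvx: "convex S"
    and lin: "\<And>x. x \<in> S \<Longrightarrow> linear (\<omega> x)"
    and sm: "\<And>u. smooth_on S (\<lambda>x. \<omega> x u)"
    and closed: "\<And>x u v. x \<in> S \<Longrightarrow>
      frechet_derivative (\<lambda>x. \<omega> x u) (at x) v = frechet_derivative (\<lambda>x. \<omega> x v) (at x) u"
  obtains f where "smooth_on S f" "\<And>x. x \<in> S \<Longrightarrow> (f has_derivative \<omega> x) (at x)"
proof (cases "S = {}")
  case True
  then show ?thesis using that by (auto simp: smooth_on_def intro: Ck_on_subset[OF Ck_on_const[OF open_UNIV]])
next
  case False
  then obtain c where c: "c \<in> S" by blast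
  define y where "y x s = c + s *\<^sub>R (x - c)" for x and s :: real
  have yS: "y x s \<in> S" if "x \<in> S" "s \<in> {0..1}" for x s
    using convexD[OF cvx c that(1), of "1 - s" s] that(2) by (simp add: y_def algebra_simps)
  let ?D = "\<lambda>u x. frechet_derivative (\<lambda>x. \<omega> x u) (at x)"
  have D: "((\<lambda>x. \<omega> x u) has_derivative ?D u x) (at x)" if "x \<in> S" for u x
    using smooth_on_has_derivative[OF sm that] .
  \<comment> \<open>The integrand of the segment integral, expanded in the basis so that only values
    of \<omega> on fixed vectors, which are known to be smooth, have to be differentiated.\<close>
  define F where "F x s = (\<Sum>b\<in>Basis. ((x - c) \<bullet> b) *\<^sub>R \<omega> (y x s) b)" for x s
  define d where "d x s v = (\<Sum>b\<in>Basis. ((x - c) \<bullet> b) *\<^sub>R ?D b (y x s) (s *\<^sub>R v) + (v \<bullet> b) *\<^sub>R \<omega> (y x s) b)"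
    for x s v
  have Fd: "((\<lambda>x. F x s) has_derivative d x s) (at x)" if "x \<in> S" "s \<in> {0..1}" for x s
  proof -
    have y': "((\<lambda>x. y x s) has_derivative (\<lambda>v. s *\<^sub>R v)) (at x)"
      unfolding y_def by (auto intro!: derivative_eq_intros)
    have "((\<lambda>x. \<omega> (y x s) b) has_derivative (\<lambda>v. ?D b (y x s) (s *\<^sub>R v))) (at x)" for b
      using has_derivative_compose[OF y' D[OF yS[OF that]]] by simp
    moreover have "((\<lambda>x. (x - c) \<bullet> b) has_derivative (\<lambda>v. v \<bullet> b)) (at x)" for b
      by (auto intro!: derivative_eq_intros)
    ultimately show ?thesis
      unfolding F_def d_def
      by (intro has_derivative_sum has_derivative_scaleR)
  qed
  have bld: "bounded_linear (d x s)" if "x \<in> S" "s \<in> {0..1}" for x s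
    using Fd[OF that] by (rule has_derivative_bounded_linear)
  \<comment> \<open>The Leibniz rule for integrals asks for derivatives as bounded linear functions
    depending continuously on the parameters; \<open>Blinfun\<close> is meaningful here only on
    \<open>S\<close> and the unit interval.\<close>
  define fx where "fx x s = Blinfun (d x s)" for x s
  have fx: "blinfun_apply (fx x s) = d x s" if "x \<in> S" "s \<in> {0..1}" for x s
    unfolding fx_def using bounded_linear_Blinfun_apply[OF bld[OF that]] .
  have ycont: "continuous_on (S \<times> {0..1}) (\<lambda>z. y (fst z) (snd z))"
    unfolding y_def by (intro continuous_intros)
  have ysub: "(\<lambda>z. y (fst z) (snd z)) ` (S \<times> {0..1}) \<subseteq> S"
    using yS by auto
  have dcont: "continuous_on (S \<times> {0..1}) (\<lambda>z. d (fst z) (snd z) v)" for v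
  proof -
    have 1: "continuous_on (S \<times> {0..1}) (\<lambda>z. \<omega> (y (fst z) (snd z)) b)" for b
      by (rule continuous_on_compose2[OF smooth_on_imp_continuous_on[OF sm] ycont ysub])
    have 2: "continuous_on (S \<times> {0..1}) (\<lambda>z. ?D b (y (fst z) (snd z)) v)" for b
      by (rule continuous_on_compose2[OF smooth_on_imp_continuous_on[OF smooth_on_frechet_derivative[OF sm]] ycont ysub])
    have "?D b (y x s) (s *\<^sub>R v) = s *\<^sub>R ?D b (y x s) v" if "x \<in> S" "s \<in> {0..1}" for x s b
      using has_derivative_linear[OF D[OF yS[OF that]]] by (simp add: linear_cmul)
    then have "continuous_on (S \<times> {0..1}) (\<lambda>z. d (fst z) (snd z) v) \<longleftrightarrow>
       continuous_on (S \<times> {0..1}) (\<lambda>z. \<Sum>b\<in>Basis. ((fst z - c) \<bullet> b) *\<^sub>R (snd z *\<^sub>R ?D b (y (fst z) (snd z)) v)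
          + (v \<bullet> b) *\<^sub>R \<omega> (y (fst z) (snd z)) b)"
      unfolding d_def by (intro continuous_on_cong) auto
    then show ?thesis
      by (auto intro!: continuous_intros 1 2)
  qed
  have fxcont: "continuous_on (S \<times> cbox 0 1) (\<lambda>(x, s). fx x s)"
  proof (rule continuous_on_blinfun_componentwise)
    show "continuous_on (S \<times> cbox 0 1) (\<lambda>z. blinfun_apply (case z of (x, s) \<Rightarrow> fx x s) i)" for i
      unfolding cbox_interval
      by (rule continuous_on_eq[OF dcont[of i]]) (use fx in force)
  qed
  have Fint: "F x integrable_on cbox 0 1" if x: "x \<in> S" for x
  proof (rule integrable_continuous)
    have "continuous_on {0..1} (\<lambda>s. \<omega> (y x s) b)" for b
    proof (rule continuous_on_compose2[OF smooth_on_imp_continuous_on[OF sm]])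
      show "continuous_on {0..1} (y x)" unfolding y_def by (intro continuous_intros)
    qed (use yS x in auto)
    then show "continuous_on (cbox 0 1) (F x)"
      unfolding F_def by (auto intro!: continuous_intros)
  qed
  define f where "f x = integral (cbox 0 1) (F x)" for x
  have f': "(f has_derivative \<omega> x) (at x)" if x: "x \<in> S" for x
  proof -
    have der: "(f has_derivative integral (cbox 0 1) (fx x)) (at x within S)"
      unfolding f_def
    proof (rule leibniz_rule[OF _ Fint fxcont x cvx])
      fix z and s :: real assume "z \<in> S" "s \<in> cbox 0 1"
      then show "((\<lambda>z. F z s) has_derivative blinfun_apply (fx z s)) (at z within S)"
        using has_derivative_at_withinI[OF Fd] fx by simp
    qed
    have "blinfun_apply (integral (cbox 0 1) (fx x)) v = \<omega> x v" for v
    proof -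
      have "continuous_on (cbox 0 1) (fx x)"
        using continuous_on_compose2[OF fxcont, of "cbox 0 1" "\<lambda>s. (x, s)"] x
        by (force intro!: continuous_on_Pair continuous_on_const continuous_on_id)
      then have "blinfun_apply (integral (cbox 0 1) (fx x)) v = integral (cbox 0 1) (\<lambda>s. fx x s v)"
        by (intro blinfun_apply_integral integrable_continuous)
      also have "\<dots> = integral {0..1} (\<lambda>s. s *\<^sub>R ?D v (y x s) (x - c) + \<omega> (y x s) v)"
      proof (unfold interval_cbox, rule integral_cong)
        fix s :: real assume "s \<in> cbox 0 1"
        then have s: "s \<in> {0..1}" by simp
        note l = has_derivative_linear[OF D[OF yS[OF x s]]]
        \<comment> \<open>Closedness exchanges the slot of the form and the direction of
          differentiation; the sum over the basis then reassembles the derivative along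
          \<open>x - c\<close>.\<close>
        have "d x s v = (\<Sum>b\<in>Basis. ((x - c) \<bullet> b) *\<^sub>R (s *\<^sub>R ?D v (y x s) b) + (v \<bullet> b) *\<^sub>R \<omega> (y x s) b)"
          unfolding d_def linear_cmul[OF l]
          by (intro sum.cong refl) (simp add: closed[OF yS[OF x s], of _ v])
        also have "\<dots> = s *\<^sub>R (\<Sum>b\<in>Basis. ((x - c) \<bullet> b) *\<^sub>R ?D v (y x s) b) + (\<Sum>b\<in>Basis. (v \<bullet> b) *\<^sub>R \<omega> (y x s) b)"
          by (simp add: sum.distrib scaleR_sum_right mult.commute)
        also have "\<dots> = s *\<^sub>R ?D v (y x s) (x - c) + \<omega> (y x s) v"
          by (simp add: linear_euclidean_expansion[OF l] linear_euclidean_expansion[OF lin[OF yS[OF x s]]])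
        finally show "fx x s v = s *\<^sub>R ?D v (y x s) (x - c) + \<omega> (y x s) v"
          by (simp add: fx[OF x s])
      qed
      \<comment> \<open>The integrand is the derivative of s times \<omega> at \<open>y x s\<close>,
        applied to \<open>v\<close>; the factor s removes the contribution of the centre.\<close>
      also have "\<dots> = 1 *\<^sub>R \<omega> (y x 1) v - 0 *\<^sub>R \<omega> (y x 0) v"
      proof (intro integral_unique fundamental_theorem_of_calculus)
        fix s :: real assume s: "s \<in> {0..1}"
        have y': "((\<lambda>s. y x s) has_derivative (\<lambda>h. h *\<^sub>R (x - c))) (at s)"
          unfolding y_def by (auto intro!: derivative_eq_intros)
        have "((\<lambda>s. \<omega> (y x s) v) has_derivative (\<lambda>h. ?D v (y x s) (h *\<^sub>R (x - c)))) (at s)"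
          using has_derivative_compose[OF y' D[OF yS[OF x s]]] by simp
        then have "((\<lambda>s. \<omega> (y x s) v) has_vector_derivative ?D v (y x s) (x - c)) (at s)"
          unfolding has_vector_derivative_def
          by (simp add: linear_cmul[OF has_derivative_linear[OF D[OF yS[OF x s]]]])
        from has_vector_derivative_scaleR[OF DERIV_ident this]
        show "((\<lambda>s. s *\<^sub>R \<omega> (y x s) v) has_vector_derivative s *\<^sub>R ?D v (y x s) (x - c) + \<omega> (y x s) v) (at s within {0..1})"
          by (auto intro: has_vector_derivative_at_within)
      qed simp
      finally show ?thesis by (simp add: y_def)
    qed
    then have "blinfun_apply (integral (cbox 0 1) (fx x)) = \<omega> x" by blast
    then show ?thesis
      using der at_within_open[OF x opn] by simp
  qed
  have "smooth_on S f"
    by (rule smooth_onI_derivative[OF opn f' sm])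
  then show ?thesis using that f' by blast
qed

lemma linear_inv_of_bij:
  assumes "linear f" "bij f" shows "linear (inv f)"
proof
  show "inv f (x + y) = inv f x + inv f y" for x y
    by (rule bij_is_inj[OF assms(2), THEN injD])
      (simp add: linear_add[OF assms(1)] surj_f_inv_f[OF bij_is_surj[OF assms(2)]])
  show "inv f (a *\<^sub>R x) = a *\<^sub>R inv f x" for a x
    by (rule bij_is_inj[OF assms(2), THEN injD])
      (simp add: linear_cmul[OF assms(1)] surj_f_inv_f[OF bij_is_surj[OF assms(2)]])
qed

text \<open>Transfer of the Poincare lemma to a form known through its values \<open>a u\<close> on
  a frame with constant structure constants. The hypothesis \<open>closed\<close> is Cartan's
  formula for the exterior derivative, evaluated on frame fields.\<close>

lemma primitive_in_frame:
  fixes E :: "'g::real_vector \<Rightarrow> 'e::euclidean_space \<Rightarrow> 'e" and a :: "'g \<Rightarrow> 'e \<Rightarrow> 'b::euclidean_space"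
    and br :: "'g \<Rightarrow> 'g \<Rightarrow> 'g" and B :: "'g set"
  assumes opn: "open S" and cvx: "convex S"
    and B: "finite B" "independent B" "span B = UNIV"
    and linE: "\<And>x. x \<in> S \<Longrightarrow> linear (\<lambda>u. E u x)" and bij: "\<And>x. x \<in> S \<Longrightarrow> bij (\<lambda>u. E u x)"
    and smE: "\<And>u. smooth_on S (E u)"
    and lina: "\<And>x. x \<in> S \<Longrightarrow> linear (\<lambda>u. a u x)" and sma: "\<And>u. smooth_on S (a u)"
    and bracket: "\<And>x u v. x \<in> S \<Longrightarrow>
      frechet_derivative (E v) (at x) (E u x) - frechet_derivative (E u) (at x) (E v x) = E (br u v) x"
    and closed: "\<And>x u v. x \<in> S \<Longrightarrow>
      frechet_derivative (a v) (at x) (E u x) - frechet_derivative (a u) (at x) (E v x) = a (br u v) x"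
  obtains f where "smooth_on S f" "\<And>x u. x \<in> S \<Longrightarrow> frechet_derivative f (at x) (E u x) = a u x"
proof -
  define N where "N x = inv (\<lambda>u. E u x)" for x
  have NE: "N x (E u x) = u" if "x \<in> S" for x u
    unfolding N_def using inv_f_f[OF bij_is_inj[OF bij[OF that]], of u] .
  have EN: "E (N x w) x = w" if "x \<in> S" for x w
    unfolding N_def using surj_f_inv_f[OF bij_is_surj[OF bij[OF that]], of w] .
  have linN: "linear (N x)" if "x \<in> S" for x
    unfolding N_def by (rule linear_inv_of_bij[OF linE[OF that] bij[OF that]])
  define r where "r b x w = representation B (N x w) b" for b x w
  have rep: "(\<Sum>b\<in>B. r b x w *\<^sub>R b) = N x w" for x w
    unfolding r_def using real_vector.sum_representation_eq[OF B(2)] B by auto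
  define \<omega> where "\<omega> x w = a (N x w) x" for x w
  have lin\<omega>: "linear (\<omega> x)" if "x \<in> S" for x
    unfolding \<omega>_def using linear_compose[OF linN[OF that] lina[OF that]] by (simp add: o_def)
  have \<omega>E: "\<omega> x (E u x) = a u x" if "x \<in> S" for x u
    unfolding \<omega>_def using NE[OF that] by simp
  \<comment> \<open>\<open>N\<close> is only a pointwise inverse; its smoothness in x comes from the
    results on dual frames.\<close>
  have smr: "smooth_on S (\<lambda>x. r b x w)" if "b \<in> B" for b w
  proof (rule dual_frame_smooth[where I = B and E = E, OF B(1) opn smE _ _ _ that])
    show "linear (r b x)" if "x \<in> S" for b x
    proof
      show "r b x (u + v) = r b x u + r b x v" for u v
        unfolding r_def linear_add[OF linN[OF that]]
        by (subst real_vector.representation_add[OF B(2)]) (auto simp: B)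
      show "r b x (t *\<^sub>R u) = t *\<^sub>R r b x u" for t u
        unfolding r_def linear_cmul[OF linN[OF that]]
        by (subst real_vector.representation_scale[OF B(2)]) (auto simp: B)
    qed
    show "(\<Sum>b\<in>B. r b x w *\<^sub>R E b x) = w" if "x \<in> S" for x w
      using EN[OF that, of w] linear_sum[OF linE[OF that], of "\<lambda>b. r b x w *\<^sub>R b" B] rep[of x w]
      by (simp add: linear_cmul[OF linE[OF that]])
    show "r i x (E j x) = (if i = j then 1 else 0)" if "x \<in> S" "i \<in> B" "j \<in> B" for x i j
      unfolding r_def NE[OF that(1)] by (simp add: real_vector.representation_basis[OF B(2) that(3)])
  qed
  have \<omega>_rep: "(\<Sum>b\<in>B. r b x w *\<^sub>R a b x) = \<omega> x w" if "x \<in> S" for x w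
    unfolding \<omega>_def using linear_sum[OF lina[OF that], of "\<lambda>b. r b x w *\<^sub>R b" B] rep[of x w]
    by (simp add: linear_cmul[OF lina[OF that]])
  have sm\<omega>: "smooth_on S (\<lambda>x. \<omega> x w)" for w
    by (rule smooth_on_cong[OF opn _ \<omega>_rep])
      (intro smooth_on_sum smooth_on_bilinear[OF bounded_bilinear_scaleR] opn smr sma)
  let ?D = "\<lambda>u x. frechet_derivative (\<lambda>x. \<omega> x u) (at x)"
  have D: "((\<lambda>x. \<omega> x u) has_derivative ?D u x) (at x)" if "x \<in> S" for u x
    using smooth_on_has_derivative[OF sm\<omega> that] .
  have Da: "frechet_derivative (a u) (at x) h
      = \<omega> x (frechet_derivative (E u) (at x) h) + (\<Sum>c\<in>Basis. (E u x \<bullet> c) *\<^sub>R ?D c x h)"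
    if x: "x \<in> S" for x u h
  proof -
    have "((\<lambda>x. \<Sum>c\<in>Basis. (E u x \<bullet> c) *\<^sub>R \<omega> x c) has_derivative
      (\<lambda>h. \<Sum>c\<in>Basis. (E u x \<bullet> c) *\<^sub>R ?D c x h + (frechet_derivative (E u) (at x) h \<bullet> c) *\<^sub>R \<omega> x c)) (at x)"
      by (intro has_derivative_sum has_derivative_scaleR has_derivative_inner_left
          smooth_on_has_derivative[OF smE x] D[OF x])
    then have "(a u has_derivative
      (\<lambda>h. \<Sum>c\<in>Basis. (E u x \<bullet> c) *\<^sub>R ?D c x h + (frechet_derivative (E u) (at x) h \<bullet> c) *\<^sub>R \<omega> x c)) (at x)"
      by (rule has_derivative_transform_within_open[OF _ opn x])
        (simp add: linear_euclidean_expansion[OF lin\<omega>] \<omega>E)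
    from frechet_derivative_at[OF this, symmetric] show ?thesis
      by (simp add: sum.distrib linear_euclidean_expansion[OF lin\<omega>[OF x]])
  qed
  have K_lin: "(\<Sum>c\<in>Basis. (u \<bullet> c) *\<^sub>R ?D c x h) = ?D u x h" if x: "x \<in> S" for x u h
  proof -
    have "((\<lambda>x. \<Sum>c\<in>Basis. (u \<bullet> c) *\<^sub>R \<omega> x c) has_derivative (\<lambda>h. \<Sum>c\<in>Basis. (u \<bullet> c) *\<^sub>R ?D c x h)) (at x)"
      by (intro has_derivative_sum has_derivative_scaleR_right D[OF x])
    then have "((\<lambda>x. \<omega> x u) has_derivative (\<lambda>h. \<Sum>c\<in>Basis. (u \<bullet> c) *\<^sub>R ?D c x h)) (at x)"
      by (rule has_derivative_transform_within_open[OF _ opn x])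
        (simp add: linear_euclidean_expansion[OF lin\<omega>])
    from frechet_derivative_at[OF this] show ?thesis by metis
  qed
  \<comment> \<open>By the product rule both derivatives in \<open>closed\<close> split into a part
    where the frame is differentiated and a part where the form is. The first parts form the value
    of \<omega> on the bracket, which equals the right side, so the second parts must be
    symmetric.\<close>
  have sym: "?D (E u x) x (E v x) = ?D (E v x) x (E u x)" if x: "x \<in> S" for x u v
  proof -
    have "a (br u v) x = \<omega> x (frechet_derivative (E v) (at x) (E u x) - frechet_derivative (E u) (at x) (E v x))"
      unfolding bracket[OF x] using \<omega>E[OF x] by simp
    moreover have "a (br u v) x = \<omega> x (frechet_derivative (E v) (at x) (E u x)) + ?D (E v x) x (E u x)
       - (\<omega> x (frechet_derivative (E u) (at x) (E v x)) + ?D (E u x) x (E v x))"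
      using closed[OF x, of v u] by (simp add: Da[OF x] K_lin[OF x])
    ultimately show ?thesis
      by (simp add: linear_diff[OF lin\<omega>[OF x]])
  qed
  have closed_\<omega>: "?D u x v = ?D v x u" if "x \<in> S" for x u v
    using sym[OF that, of "N x u" "N x v"] by (simp add: EN[OF that])
  obtain f where "smooth_on S f" and f: "\<And>x. x \<in> S \<Longrightarrow> (f has_derivative \<omega> x) (at x)"
    using primitive_of_closed_form[OF opn cvx lin\<omega> sm\<omega> closed_\<omega>] by metis
  then show ?thesis
    using that frechet_derivative_at[OF f] \<omega>E by metis
qed

text \<open>With \<open>R\<close> a right inverse of \<open>L = Df(x0)\<close>, the local diffeomorphism \<open>\<Phi> = id - R L + R f\<close> satisfies
  \<open>f = L \<circ> \<Phi>\<close>, so it straightens the fibres of \<open>f\<close> to affine subspaces.\<close>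

lemma submersion_fibres_connected_locally:
  fixes f :: "'e::euclidean_space \<Rightarrow> 'b::euclidean_space"
  assumes opn: "open S" and x0: "x0 \<in> S" and sm: "smooth_on S f"
    and surj: "surj (frechet_derivative f (at x0))"
  obtains U where "open U" "x0 \<in> U" "U \<subseteq> S"
    "\<forall>a\<in>U. \<forall>b\<in>U. f a = f b \<longrightarrow>
       (\<exists>\<gamma> \<gamma>'. \<gamma> 0 = a \<and> \<gamma> 1 = b \<and>
         (\<forall>t\<in>{0..1}. \<gamma> t \<in> U \<and> f (\<gamma> t) = f a \<and> (\<gamma> has_vector_derivative \<gamma>' t) (at t)))"
proof -
  let ?D = "\<lambda>x. frechet_derivative f (at x)"
  define L where "L = ?D x0"
  have D: "(f has_derivative ?D x) (at x)" if "x \<in> S" for x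
    using smooth_on_has_derivative[OF sm that] .
  have linL: "linear L" unfolding L_def using has_derivative_linear[OF D[OF x0]] .
  obtain R where linR: "linear R" and LR: "\<And>w. L (R w) = w"
    using linear_surjective_right_inverse[OF linL] surj unfolding L_def o_def id_def by metis
  have blR: "bounded_linear R" and blL: "bounded_linear L"
    using linR linL by (simp_all add: linear_conv_bounded_linear)
  define \<Phi> where "\<Phi> x = x - R (L x) + R (f x)" for x
  have L\<Phi>: "L (\<Phi> x) = f x" for x
    unfolding \<Phi>_def by (simp add: linear_add[OF linL] linear_diff[OF linL] LR)
  define \<Phi>' where "\<Phi>' x v = v - R (L v) + R (?D x v)" for x v
  have \<Phi>': "(\<Phi> has_derivative \<Phi>' x) (at x)" if "x \<in> S" for x
    unfolding \<Phi>_def \<Phi>'_def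
    by (intro has_derivative_add has_derivative_diff has_derivative_ident
        bounded_linear.has_derivative[OF blR] bounded_linear.has_derivative[OF blL] D[OF that])
  define P where "P x = Blinfun (\<Phi>' x)" for x
  have P: "blinfun_apply (P x) = \<Phi>' x" if "x \<in> S" for x
    unfolding P_def using bounded_linear_Blinfun_apply[OF has_derivative_bounded_linear[OF \<Phi>'[OF that]]] .
  have contP: "continuous_on S P"
  proof (rule continuous_on_blinfun_componentwise)
    fix i
    have "continuous_on S (\<lambda>x. \<Phi>' x i)"
      unfolding \<Phi>'_def
      by (intro continuous_intros bounded_linear.continuous_on[OF blR]
         smooth_on_imp_continuous_on[OF smooth_on_frechet_derivative[OF sm]])
    then show "continuous_on S (\<lambda>x. blinfun_apply (P x) i)"
      by (simp add: P cong: continuous_on_cong)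
  qed
  \<comment> \<open>At \<open>x0\<close> the two correction terms in the derivative of \<Phi> cancel
    because \<open>L\<close> is the derivative of \<open>f\<close> there. The identity therefore
    serves as the left inverse that the inverse function theorem asks for.\<close>
  have "id_blinfun o\<^sub>L P x0 = id_blinfun"
    by (rule blinfun_eqI) (simp add: P[OF x0] \<Phi>'_def L_def)
  from inverse_function_theorem[OF opn _ contP x0 this, of \<Phi>]
  obtain U' V g g' where U': "open U'" "U' \<subseteq> S" "x0 \<in> U'" and V: "open V" "\<Phi> x0 \<in> V"
    and hom: "homeomorphism U' V \<Phi> g" and g': "\<And>y. y \<in> V \<Longrightarrow> (g has_derivative g' y) (at y)"
    using P \<Phi>' by metis
  obtain e where e: "e > 0" "ball (\<Phi> x0) e \<subseteq> V"
    using V open_contains_ball by blast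
  \<comment> \<open>A ball is convex: the segment joining the images of two points of one fibre
    stays inside, and \<open>L\<close> is constant along it. Its pullback under \<open>g\<close> is
    the required curve.\<close>
  define B where "B = ball (\<Phi> x0) e"
  define U where "U = U' \<inter> \<Phi> -` B"
  have "continuous_on U' \<Phi>" using hom by (simp add: homeomorphism_def)
  then have "open U"
    unfolding U_def B_def by (intro continuous_open_preimage U' open_ball)
  moreover have "x0 \<in> U" using U' e by (simp add: U_def B_def)
  moreover have "U \<subseteq> S" using U' by (auto simp: U_def)
  moreover have "\<exists>\<gamma> \<gamma>'. \<gamma> 0 = a \<and> \<gamma> 1 = b \<and>
         (\<forall>t\<in>{0..1}. \<gamma> t \<in> U \<and> f (\<gamma> t) = f a \<and> (\<gamma> has_vector_derivative \<gamma>' t) (at t))"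
    if a: "a \<in> U" and b: "b \<in> U" and ab: "f a = f b" for a b
  proof -
    define l where "l t = \<Phi> a + t *\<^sub>R (\<Phi> b - \<Phi> a)" for t :: real
    have lB: "l t \<in> B" if "t \<in> {0..1}" for t
      using convexD[OF convex_ball[of "\<Phi> x0" e], of "\<Phi> a" "\<Phi> b" "1 - t" t] that a b
      by (simp add: U_def B_def l_def algebra_simps)
    have lV: "l t \<in> V" if "t \<in> {0..1}" for t using lB[OF that] e by (auto simp: B_def)
    have gU: "g y \<in> U'" "\<Phi> (g y) = y" if "y \<in> V" for y
      using hom that by (auto simp: homeomorphism_def)
    have "f (g (l t)) = f a" if "t \<in> {0..1}" for t
    proof -
      have "f (g (l t)) = L (l t)" using L\<Phi>[of "g (l t)"] gU(2)[OF lV[OF that]] by simp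
      then show ?thesis
        by (simp add: l_def linear_add[OF linL] linear_cmul[OF linL] linear_diff[OF linL] L\<Phi> ab)
    qed
    moreover have "g (l t) \<in> U" if "t \<in> {0..1}" for t
      using gU[OF lV[OF that]] lB[OF that] by (simp add: U_def)
    moreover have "((\<lambda>t. g (l t)) has_vector_derivative g' (l t) (\<Phi> b - \<Phi> a)) (at t)"
      if t: "t \<in> {0..1}" for t
    proof -
      have "(l has_derivative (\<lambda>h. h *\<^sub>R (\<Phi> b - \<Phi> a))) (at t)"
        unfolding l_def by (auto intro!: derivative_eq_intros)
      from has_derivative_compose[OF this g'[OF lV[OF t]]] show ?thesis
        unfolding has_vector_derivative_def
        by (simp add: linear_cmul[OF has_derivative_linear[OF g'[OF lV[OF t]]]])
    qed
    moreover have "g (l 0) = a" "g (l 1) = b"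
      using hom a b by (auto simp: l_def U_def homeomorphism_def)
    ultimately show ?thesis
      by (intro exI[of _ "\<lambda>t. g (l t)"] exI[of _ "\<lambda>t. g' (l t) (\<Phi> b - \<Phi> a)"]) auto
  qed
  ultimately show ?thesis by (intro that[of U] ballI impI)
qed

section \<open>Smooth functions, tangent vectors and vector fields on a manifold\<close>

text \<open>The condition that \<open>smooth_atlas\<close> imposes on each single chart. It is
  isolated so that it can be used for product charts without showing that \<open>prod_atlas\<close>
  is a smooth atlas.\<close>

definition is_chart :: "('a::topological_space, 'e::euclidean_space) chart \<Rightarrow> bool"
  where "is_chart C \<longleftrightarrow> open (fst C) \<and> open (snd C ` fst C) \<and>
    homeomorphism (fst C) (snd C ` fst C) (snd C) (chart_inv C)"

lemma chart_inv_chart: "is_chart C \<Longrightarrow> p \<in> fst C \<Longrightarrow> chart_inv C (snd C p) = p"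
  by (simp add: is_chart_def homeomorphism_def)

lemma chart_chart_inv: "x \<in> snd C ` fst C \<Longrightarrow> snd C (chart_inv C x) = x"
  by (rule f_inv_into_f)

lemma chart_inv_in: "x \<in> snd C ` fst C \<Longrightarrow> chart_inv C x \<in> fst C"
  by (rule inv_into_into)

lemma chart_image_iff:
  assumes "is_chart C"
  shows "x \<in> snd C ` (U \<inter> fst C) \<longleftrightarrow> x \<in> snd C ` fst C \<and> chart_inv C x \<in> U"
proof
  assume "x \<in> snd C ` (U \<inter> fst C)"
  then obtain p where "x = snd C p" "p \<in> U" "p \<in> fst C" by blast
  then show "x \<in> snd C ` fst C \<and> chart_inv C x \<in> U"
    using chart_inv_chart[OF assms] by auto
next
  assume x: "x \<in> snd C ` fst C \<and> chart_inv C x \<in> U"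
  have "chart_inv C x \<in> U \<inter> fst C"
    using x chart_inv_in[of x C] by simp
  then show "x \<in> snd C ` (U \<inter> fst C)"
    by (rule rev_image_eqI) (use x chart_chart_inv[of x C] in simp)
qed

lemma open_chart_image:
  assumes "is_chart C" "open U" shows "open (snd C ` (U \<inter> fst C))"
proof -
  have "continuous_on (snd C ` fst C) (chart_inv C)" "open (snd C ` fst C)"
    using assms(1) by (simp_all add: is_chart_def homeomorphism_def)
  then have "open (snd C ` fst C \<inter> chart_inv C -` U)"
    using assms(2) by (intro continuous_open_preimage)
  also have "snd C ` fst C \<inter> chart_inv C -` U = snd C ` (U \<inter> fst C)"
    using chart_image_iff[OF assms(1)] by blast
  finally show ?thesis .
qed

lemma open_chart_preimage:
  assumes "is_chart C" "open T" shows "open (fst C \<inter> snd C -` T)"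
  using assms by (intro continuous_open_preimage) (simp_all add: is_chart_def homeomorphism_def)

text \<open>The inverse of a product chart is an \<open>inv_into\<close> on a product set;
  injectivity forces this choice to be the pair of the two inverses, and everything else is
  componentwise.\<close>

lemma is_chart_prod:
  assumes C: "is_chart C" and C': "is_chart C'"
  shows "is_chart (fst C \<times> fst C', map_prod (snd C) (snd C'))"
    and "x \<in> snd C ` fst C \<Longrightarrow> y \<in> snd C' ` fst C' \<Longrightarrow>
      chart_inv (fst C \<times> fst C', map_prod (snd C) (snd C')) (x, y) = (chart_inv C x, chart_inv C' y)"
proof -
  let ?P = "(fst C \<times> fst C', map_prod (snd C) (snd C'))"
  have inj: "inj_on (snd C) (fst C)" "inj_on (snd C') (fst C')"
    using chart_inv_chart[OF C] chart_inv_chart[OF C'] by (metis inj_onI)+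
  then have injP: "inj_on (map_prod (snd C) (snd C')) (fst C \<times> fst C')"
    by (rule map_prod_inj_on)
  have eq: "chart_inv ?P (x, y) = (chart_inv C x, chart_inv C' y)"
    if "x \<in> snd C ` fst C" "y \<in> snd C' ` fst C'" for x y
    unfolding fst_conv snd_conv
    by (rule inv_into_f_eq[OF injP])
      (simp_all add: chart_inv_in[OF that(1)] chart_inv_in[OF that(2)] chart_chart_inv[OF that(1)] chart_chart_inv[OF that(2)])
  then show "x \<in> snd C ` fst C \<Longrightarrow> y \<in> snd C' ` fst C' \<Longrightarrow>
      chart_inv ?P (x, y) = (chart_inv C x, chart_inv C' y)" .
  have img: "snd ?P ` fst ?P = (snd C ` fst C) \<times> (snd C' ` fst C')"
    by (simp add: map_prod_surj_on)
  have "homeomorphism (fst ?P) (snd ?P ` fst ?P) (snd ?P) (chart_inv ?P)"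
  proof (rule homeomorphismI)
    have c: "continuous_on (fst C) (snd C)" "continuous_on (fst C') (snd C')"
      "continuous_on (snd C ` fst C) (chart_inv C)" "continuous_on (snd C' ` fst C') (chart_inv C')"
      using C C' by (auto simp: is_chart_def homeomorphism_def)
    have "continuous_on (fst C \<times> fst C') (\<lambda>z. (snd C (fst z), snd C' (snd z)))"
      by (intro continuous_on_Pair continuous_on_compose2[OF c(1)] continuous_on_compose2[OF c(2)]
          continuous_on_fst continuous_on_snd continuous_on_id) auto
    then show "continuous_on (fst ?P) (snd ?P)"
      by (simp add: map_prod_def case_prod_unfold)
    have "continuous_on ((snd C ` fst C) \<times> (snd C' ` fst C')) (\<lambda>z. (chart_inv C (fst z), chart_inv C' (snd z)))"
      by (intro continuous_on_Pair continuous_on_compose2[OF c(3)] continuous_on_compose2[OF c(4)]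
          continuous_on_fst continuous_on_snd continuous_on_id) auto
    then show "continuous_on (snd ?P ` fst ?P) (chart_inv ?P)"
      unfolding img by (rule continuous_on_eq) (use eq in auto)
    show "chart_inv ?P (snd ?P p) = p" if "p \<in> fst ?P" for p
      using that inv_into_f_f[OF injP] by simp
    show "snd ?P (chart_inv ?P z) = z" if "z \<in> snd ?P ` fst ?P" for z
      using that by (rule chart_chart_inv)
    show "chart_inv ?P ` (snd ?P ` fst ?P) \<subseteq> fst ?P"
      by (rule image_subsetI) (rule chart_inv_in)
  qed simp
  then show "is_chart ?P"
    using C C' by (simp only: is_chart_def img) (simp add: is_chart_def open_Times)
qed

section \<open>Calculus in a smooth atlas\<close>

locale smooth_manifold =
  fixes A :: "('a::topological_space, 'e::euclidean_space) chart set"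
  assumes atlas: "smooth_atlas A"
begin

lemma chart: "C \<in> A \<Longrightarrow> is_chart C"
  using atlas by (simp add: smooth_atlas_def is_chart_def)

lemma chart_at: obtains C where "C \<in> A" "p \<in> fst C"
  using atlas unfolding smooth_atlas_def by blast

lemma open_chart: "C \<in> A \<Longrightarrow> open (fst C)"
  using chart by (simp add: is_chart_def)

lemma transition: "C \<in> A \<Longrightarrow> C' \<in> A \<Longrightarrow> smooth_on (snd C ` (fst C \<inter> fst C')) (snd C' \<circ> chart_inv C)"
  using atlas by (simp add: smooth_atlas_def)

lemma smooth_fun_subset: "smooth_fun A U f \<Longrightarrow> V \<subseteq> U \<Longrightarrow> smooth_fun A V f"
  unfolding smooth_fun_def by (blast intro: smooth_on_subset)

text \<open>Transition maps are smooth, so what holds in the one chart \<open>C\<close> passes to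
  every chart.\<close>

lemma smooth_fun_chartI:
  assumes C: "C \<in> A" and U: "open U" "U \<subseteq> fst C" and f: "smooth_on (snd C ` U) (f \<circ> chart_inv C)"
  shows "smooth_fun A U f"
  unfolding smooth_fun_def
proof
  fix C' assume C': "C' \<in> A"
  let ?S = "snd C' ` (U \<inter> fst C')"
  have oS: "open ?S" using open_chart_image[OF chart[OF C'] U(1)] .
  have oT: "open (snd C ` U)" using open_chart_image[OF chart[OF C] U(1)] U(2) by (simp add: inf_absorb1)
  have inS: "chart_inv C' x \<in> U" "x \<in> snd C' ` fst C'" if "x \<in> ?S" for x
    using that chart_image_iff[OF chart[OF C']] by blast+
  have "smooth_on ?S (\<lambda>x. (f \<circ> chart_inv C) ((snd C \<circ> chart_inv C') x))"
  proof (rule smooth_on_compose[OF oS oT _ _ f])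
    show "smooth_on ?S (snd C \<circ> chart_inv C')"
      by (rule smooth_on_subset[OF transition[OF C' C]]) (use U in auto)
  qed (use inS in auto)
  then show "smooth_on ?S (f \<circ> chart_inv C')"
  proof (rule smooth_on_cong[OF oS])
    fix x assume x: "x \<in> ?S"
    then have "chart_inv C' x \<in> fst C" using inS(1) U(2) by blast
    then show "(f \<circ> chart_inv C) ((snd C \<circ> chart_inv C') x) = (f \<circ> chart_inv C') x"
      using chart_inv_chart[OF chart[OF C]] by simp
  qed
qed

lemma smooth_fun_const: "open U \<Longrightarrow> smooth_fun A U (\<lambda>p. c)"
  by (simp add: smooth_fun_def smooth_on_const open_chart_image chart o_def)

lemma smooth_funD:
  "smooth_fun A U f \<Longrightarrow> C \<in> A \<Longrightarrow> smooth_on (snd C ` (U \<inter> fst C)) (\<lambda>x. f (chart_inv C x))"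
  by (simp add: smooth_fun_def o_def)

lemma smooth_funI:
  "(\<And>C. C \<in> A \<Longrightarrow> smooth_on (snd C ` (U \<inter> fst C)) (\<lambda>x. f (chart_inv C x))) \<Longrightarrow> smooth_fun A U f"
  by (simp add: smooth_fun_def o_def)

lemma smooth_fun_linear:
  assumes "bounded_linear L" "open U" "smooth_fun A U f" shows "smooth_fun A U (\<lambda>p. L (f p))"
  using smooth_on_linear[OF assms(1) open_chart_image[OF chart assms(2)] smooth_funD[OF assms(3)]]
  by (intro smooth_funI)

lemma smooth_fun_add:
  assumes "open U" "smooth_fun A U f" "smooth_fun A U g" shows "smooth_fun A U (\<lambda>p. f p + g p)"
  using smooth_on_add[OF open_chart_image[OF chart assms(1)] smooth_funD[OF assms(2)] smooth_funD[OF assms(3)]]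
  by (intro smooth_funI)

lemma smooth_fun_bilinear:
  assumes "bounded_bilinear B" "open U" "smooth_fun A U f" "smooth_fun A U g"
  shows "smooth_fun A U (\<lambda>p. B (f p) (g p))"
  using smooth_on_bilinear[OF assms(1) open_chart_image[OF chart assms(2)] smooth_funD[OF assms(3)] smooth_funD[OF assms(4)]]
  by (intro smooth_funI)

lemmas smooth_fun_mult = smooth_fun_bilinear[OF bounded_bilinear_mult]

lemma smooth_fun_chart:
  assumes "C \<in> A" shows "smooth_fun A (fst C) (snd C)"
proof (rule smooth_fun_chartI[OF assms open_chart[OF assms] order_refl])
  have o: "open (snd C ` fst C)" using chart[OF assms] by (simp add: is_chart_def)
  show "smooth_on (snd C ` fst C) (snd C \<circ> chart_inv C)"
    by (rule smooth_on_cong[OF o smooth_on_id[OF o]]) (simp only: o_apply chart_chart_inv)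
qed

text \<open>Smoothness is local, and near each point the composition can be factored through one
  target chart. The source \<open>B\<close> is only required to consist of charts, so that it may be
  a product atlas.\<close>

lemma smooth_fun_compose_map:
  assumes B: "\<And>C. C \<in> B \<Longrightarrow> is_chart C" and F: "smooth_map B A F" and S: "open S" and f: "smooth_fun A S f"
  shows "smooth_fun B (F -` S) (f \<circ> F)"
  unfolding smooth_fun_def
proof (intro ballI smooth_on_local)
  fix C x assume C: "C \<in> B" and "x \<in> snd C ` (F -` S \<inter> fst C)"
  then obtain q where q: "q \<in> fst C" "F q \<in> S" "x = snd C q" by blast
  obtain C' where C': "C' \<in> A" "F q \<in> fst C'" using chart_at .
  have cont: "continuous_on UNIV F" using F by (simp add: smooth_map_def)
  let ?V = "F -` (S \<inter> fst C')" and ?S' = "snd C' ` (S \<inter> fst C')"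
  let ?T = "snd C ` (?V \<inter> fst C)"
  have "open ?V" using cont S open_chart[OF C'(1)] by (simp add: open_vimage open_Int)
  then have oT: "open ?T" using open_chart_image[OF B[OF C]] by blast
  have inT: "F (chart_inv C y) \<in> S" "F (chart_inv C y) \<in> fst C'" if "y \<in> ?T" for y
    using that chart_image_iff[OF B[OF C], of y ?V] by simp_all
  have "smooth_on ?T (\<lambda>y. (f \<circ> chart_inv C') ((snd C' \<circ> F \<circ> chart_inv C) y))"
  proof (rule smooth_on_compose[OF oT open_chart_image[OF chart[OF C'(1)] S]])
    have "smooth_on (snd C ` (fst C \<inter> F -` fst C')) (snd C' \<circ> F \<circ> chart_inv C)"
      using F C C' by (simp add: smooth_map_def)
    then show "smooth_on ?T (snd C' \<circ> F \<circ> chart_inv C)"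
      by (rule smooth_on_subset) auto
    show "smooth_on ?S' (f \<circ> chart_inv C')"
      using f C' by (simp add: smooth_fun_def)
  qed (use inT in auto)
  then have "smooth_on ?T (f \<circ> F \<circ> chart_inv C)"
  proof (rule smooth_on_cong[OF oT])
    fix y assume "y \<in> ?T"
    then show "(f \<circ> chart_inv C') ((snd C' \<circ> F \<circ> chart_inv C) y) = (f \<circ> F \<circ> chart_inv C) y"
      using inT(2) chart_inv_chart[OF chart[OF C'(1)]] by simp
  qed
  then show "\<exists>T. open T \<and> x \<in> T \<and> smooth_on T (f \<circ> F \<circ> chart_inv C)"
    using oT q C' by (intro exI[of _ ?T]) auto
qed

lemma smooth_nearI: "open U \<Longrightarrow> p \<in> U \<Longrightarrow> smooth_fun A U f \<Longrightarrow> smooth_near A p f"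
  unfolding smooth_near_def by blast

lemma smooth_near_const: "smooth_near A p (\<lambda>q. c)"
  by (rule smooth_nearI[OF open_UNIV]) (auto intro: smooth_fun_const)

lemma smooth_near_has_derivative:
  assumes "smooth_near A p f" "C \<in> A" "p \<in> fst C"
  shows "(f \<circ> chart_inv C has_derivative frechet_derivative (f \<circ> chart_inv C) (at (snd C p))) (at (snd C p))"
proof -
  obtain U where U: "open U" "p \<in> U" "smooth_fun A U f" using assms(1) by (auto simp: smooth_near_def)
  then have "smooth_on (snd C ` (U \<inter> fst C)) (f \<circ> chart_inv C)" "snd C p \<in> snd C ` (U \<inter> fst C)"
    using assms by (auto simp: smooth_fun_def)
  then show ?thesis by (rule smooth_on_has_derivative)
qed

lemma smooth_near_chart: "C \<in> A \<Longrightarrow> p \<in> fst C \<Longrightarrow> smooth_near A p (snd C)"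
  by (rule smooth_nearI[OF open_chart _ smooth_fun_chart])

lemma smooth_near_linear:
  assumes "bounded_linear L" "smooth_near A p f" shows "smooth_near A p (\<lambda>q. L (f q))"
  using assms smooth_fun_linear unfolding smooth_near_def by blast

lemma smooth_near_coordinate: "C \<in> A \<Longrightarrow> p \<in> fst C \<Longrightarrow> smooth_near A p (\<lambda>q. snd C q \<bullet> b)"
  by (rule smooth_near_linear[OF bounded_linear_inner_left smooth_near_chart])

text \<open>The components of a tangent vector, obtained by letting it act on the coordinate
  functions; on tangent spaces over the chart this inverts \<open>chart_tvec\<close>, and it does
  not mention the base point.\<close>

definition coords :: "('a, 'e) chart \<Rightarrow> 'a tvec \<Rightarrow> 'e"
  where "coords C v = (\<Sum>b\<in>Basis. v (\<lambda>q. snd C q \<bullet> b) *\<^sub>R b)"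

lemma linear_coords: "linear (coords C)"
  by (rule linearI) (simp_all add: coords_def scaleR_add_left sum.distrib scaleR_sum_right)

lemma linear_chart_tvec:
  assumes "C \<in> A" "p \<in> fst C" shows "linear (chart_tvec A C p)"
proof -
  have l: "linear (frechet_derivative (f \<circ> chart_inv C) (at (snd C p)))" if "smooth_near A p f" for f :: "'a \<Rightarrow> real"
    using has_derivative_linear[OF smooth_near_has_derivative[OF that assms]] .
  show ?thesis
    by (rule linearI) (auto simp: chart_tvec_def fun_eq_iff linear_add[OF l] linear_cmul[OF l])
qed

lemma chart_inv_has_derivative_id:
  assumes "C \<in> A" "p \<in> fst C" shows "(snd C \<circ> chart_inv C has_derivative (\<lambda>u. u)) (at (snd C p))"
  by (rule has_derivative_transform_within_open[OF has_derivative_ident, of "snd C ` fst C"])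
    (use assms chart[OF assms(1)] in \<open>auto simp: is_chart_def chart_chart_inv\<close>)

lemma coords_chart_tvec:
  assumes "C \<in> A" "p \<in> fst C" shows "coords C (chart_tvec A C p u) = u"
proof -
  have "chart_tvec A C p u (\<lambda>q. snd C q \<bullet> b) = u \<bullet> b" for b
  proof -
    have "((\<lambda>q. snd C q \<bullet> b) \<circ> chart_inv C has_derivative (\<lambda>u. u \<bullet> b)) (at (snd C p))"
      using has_derivative_inner_left[OF chart_inv_has_derivative_id[OF assms], of b] by (simp add: o_def)
    from frechet_derivative_at[OF this] show ?thesis
      using smooth_near_coordinate[OF assms] by (metis chart_tvec_def)
  qed
  then show ?thesis by (simp add: coords_def euclidean_representation)
qed

text \<open>The chain rule for transition maps. It reduces \<open>tangent_space\<close>, a union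
  over all charts, to the image of one linear map, and so makes it a subspace.\<close>

lemma chart_tvec_change:
  assumes "C \<in> A" "p \<in> fst C" "C' \<in> A" "p \<in> fst C'"
  shows "chart_tvec A C' p u = chart_tvec A C p (frechet_derivative (snd C \<circ> chart_inv C') (at (snd C' p)) u)"
proof
  fix f :: "'a \<Rightarrow> real"
  show "chart_tvec A C' p u f = chart_tvec A C p (frechet_derivative (snd C \<circ> chart_inv C') (at (snd C' p)) u) f"
  proof (cases "smooth_near A p f")
    case True
    have p: "chart_inv C' (snd C' p) = p" using chart_inv_chart[OF chart] assms by blast
    have "((\<lambda>x. (f \<circ> chart_inv C) ((snd C \<circ> chart_inv C') x)) has_derivative
        (\<lambda>u. frechet_derivative (f \<circ> chart_inv C) (at (snd C p)) (frechet_derivative (snd C \<circ> chart_inv C') (at (snd C' p)) u)))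
        (at (snd C' p))"
    proof (rule has_derivative_compose[OF smooth_near_has_derivative[OF smooth_near_chart]])
      have "(snd C \<circ> chart_inv C') (snd C' p) = snd C p" using p by simp
      then show "(f \<circ> chart_inv C has_derivative frechet_derivative (f \<circ> chart_inv C) (at (snd C p)))
          (at ((snd C \<circ> chart_inv C') (snd C' p)))"
        using smooth_near_has_derivative[OF True assms(1,2)] by (simp only:)
    qed (use assms in auto)
    then have "(f \<circ> chart_inv C' has_derivative
        (\<lambda>u. frechet_derivative (f \<circ> chart_inv C) (at (snd C p)) (frechet_derivative (snd C \<circ> chart_inv C') (at (snd C' p)) u)))
        (at (snd C' p))"
    proof (rule has_derivative_transform_within_open)
      show "open (snd C' ` (fst C \<inter> fst C'))"
        using open_chart_image[OF chart open_chart] assms by blast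
      show "snd C' p \<in> snd C' ` (fst C \<inter> fst C')" using assms by blast
      fix x assume "x \<in> snd C' ` (fst C \<inter> fst C')"
      then have "chart_inv C' x \<in> fst C" using chart_image_iff[OF chart[OF assms(3)]] by blast
      then show "(f \<circ> chart_inv C) ((snd C \<circ> chart_inv C') x) = (f \<circ> chart_inv C') x"
        using chart_inv_chart[OF chart[OF assms(1)]] by simp
    qed
    from fun_cong[OF frechet_derivative_at[OF this], of u] True show ?thesis
      by (simp add: chart_tvec_def)
  qed (simp add: chart_tvec_def)
qed

lemma tangent_space_chart:
  assumes "C \<in> A" "p \<in> fst C" shows "tangent_space A p = range (chart_tvec A C p)"
  unfolding tangent_space_def using assms chart_tvec_change[OF assms] by blast

lemma chart_tvec_coords:
  assumes "C \<in> A" "p \<in> fst C" "v \<in> tangent_space A p" shows "chart_tvec A C p (coords C v) = v"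
  using assms(3) coords_chart_tvec[OF assms(1,2)] unfolding tangent_space_chart[OF assms(1,2)] by auto

lemma subspace_tangent_space: "subspace (tangent_space A p)"
proof -
  obtain C where "C \<in> A" "p \<in> fst C" using chart_at .
  then show ?thesis
    using tangent_space_chart linear_subspace_image[OF linear_chart_tvec subspace_UNIV] by simp
qed

lemma tangent_apply:
  assumes "C \<in> A" "p \<in> fst C" "v \<in> tangent_space A p" "smooth_near A p f"
  shows "v f = frechet_derivative (f \<circ> chart_inv C) (at (snd C p)) (coords C v)"
proof -
  have "chart_tvec A C p (coords C v) f = frechet_derivative (f \<circ> chart_inv C) (at (snd C p)) (coords C v)"
    using assms(4) by (simp add: chart_tvec_def)
  then show ?thesis by (simp only: chart_tvec_coords[OF assms(1-3)])
qed

lemma tangent_not_smooth: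
  assumes "v \<in> tangent_space A p" "\<not> smooth_near A p f" shows "v f = 0"
  using assms by (auto simp: tangent_space_def chart_tvec_def)

lemma tangent_const:
  assumes "v \<in> tangent_space A p" shows "v (\<lambda>q. c) = 0"
proof -
  obtain C where C: "C \<in> A" "p \<in> fst C" using chart_at .
  show ?thesis
    using tangent_apply[OF C assms smooth_near_const] by (simp add: o_def)
qed

lemma vector_field_tangent: "vector_field A U \<Longrightarrow> U p \<in> tangent_space A p"
  by (simp add: vector_field_def)

lemma vector_field_smooth: "vector_field A U \<Longrightarrow> open S \<Longrightarrow> smooth_fun A S f \<Longrightarrow> smooth_fun A S (\<lambda>p. U p f)"
  by (simp add: vector_field_def)

lemma vector_field_fun_times:
  assumes "smooth_fun A UNIV f" "vector_field A U" shows "vector_field A (fun_times f U)"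
  unfolding vector_field_def
proof (intro conjI allI impI)
  show "fun_times f U p \<in> tangent_space A p" for p
    unfolding fun_times_def by (rule subspace_scale[OF subspace_tangent_space vector_field_tangent[OF assms(2)]])
  show "smooth_fun A S (\<lambda>p. fun_times f U p h)" if "open S" "smooth_fun A S h" for S h
    using smooth_fun_mult[OF that(1) smooth_fun_subset[OF assms(1) subset_UNIV] vector_field_smooth[OF assms(2) that]]
    by (simp add: fun_times_def)
qed

lemma vector_field_add:
  assumes "vector_field A U" "vector_field A V" shows "vector_field A (U + V)"
  unfolding vector_field_def
proof (intro conjI allI impI)
  show "(U + V) p \<in> tangent_space A p" for p
    using subspace_add[OF subspace_tangent_space vector_field_tangent[OF assms(1)] vector_field_tangent[OF assms(2)]]
    by simp
  show "smooth_fun A S (\<lambda>p. (U + V) p h)" if "open S" "smooth_fun A S h" for S h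
    using smooth_fun_add[OF that(1) vector_field_smooth[OF assms(1) that] vector_field_smooth[OF assms(2) that]]
    by simp
qed

lemma vector_field_scaleR: assumes "vector_field A U" shows "vector_field A (c *\<^sub>R U)"
  using vector_field_fun_times[OF smooth_fun_const[OF open_UNIV] assms, of c]
  by (simp add: fun_times_def scaleR_fun_def)

lemma vector_field_uminus: assumes "vector_field A U" shows "vector_field A (- U)"
  using vector_field_scaleR[OF assms, of "-1"] by simp

lemma vector_field_diff:
  assumes "vector_field A U" "vector_field A V" shows "vector_field A (U - V)"
  using vector_field_add[OF assms(1) vector_field_uminus[OF assms(2)]] by simp

lemma coords_vector_field_smooth:
  assumes C: "C \<in> A" and U: "vector_field A U"
  shows "smooth_on (snd C ` fst C) (\<lambda>x. coords C (U (chart_inv C x)))"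
proof -
  have "smooth_fun A (fst C) (\<lambda>p. U p (\<lambda>q. snd C q \<bullet> b))" for b
    using C by (intro vector_field_smooth[OF U open_chart] smooth_fun_linear[OF bounded_linear_inner_left] open_chart smooth_fun_chart)
  then have "smooth_on (snd C ` fst C) (\<lambda>x. U (chart_inv C x) (\<lambda>q. snd C q \<bullet> b))" for b
    using C unfolding smooth_fun_def o_def by (metis Int_absorb)
  then show ?thesis
    unfolding coords_def using chart[OF C]
    by (intro smooth_on_sum smooth_on_linear[OF bounded_linear_scaleR_left]) (auto simp: is_chart_def)
qed

end

section \<open>Left-invariant vector fields on a Lie group\<close>

locale lie_group_manifold = smooth_manifold A
  for A :: "('a::{second_countable_topology, t2_space}, 'e::euclidean_space) chart set" +
  fixes mul :: "'a \<Rightarrow> 'a \<Rightarrow> 'a" and e :: 'a and ginv :: "'a \<Rightarrow> 'a"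
  assumes lie_group: "lie_group A mul e ginv"
begin

lemma mul_assoc: "mul (mul a b) c = mul a (mul b c)"
  and mul_left_one: "mul e a = a"
  and mul_right_one: "mul a e = a"
proof -
  interpret group mul e ginv using lie_group by (simp add: lie_group_def)
  show "mul (mul a b) c = mul a (mul b c)" "mul e a = a" "mul a e = a"
    by (simp_all add: assoc)
qed

lemma smooth_mul: "smooth_map (prod_atlas A A) A (\<lambda>(a, b). mul a b)"
  using lie_group by (simp add: lie_group_def)

lemma continuous_mul: "continuous_on UNIV (\<lambda>z. mul (fst z) (snd z))"
  using smooth_mul by (simp add: smooth_map_def case_prod_unfold)

lemma open_left_translation_preimage:
  assumes "open S" shows "open (mul a -` S)"
proof -
  have "continuous_on UNIV (\<lambda>q. mul (fst (a, q)) (snd (a, q)))"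
    by (rule continuous_on_compose2[OF continuous_mul]) (auto intro!: continuous_intros)
  then show ?thesis using assms by (simp add: open_vimage)
qed

definition mul_domain :: "('a, 'e) chart \<Rightarrow> ('a, 'e) chart \<Rightarrow> 'a set \<Rightarrow> ('e \<times> 'e) set"
  where "mul_domain C C' S = {(x, y). x \<in> snd C ` fst C \<and> y \<in> snd C' ` fst C' \<and>
    mul (chart_inv C x) (chart_inv C' y) \<in> S}"

text \<open>Joint smoothness of the multiplication, unpacked from product charts. Freezing the first
  slot gives left translations; differentiating in the second slot gives left-invariant
  fields.\<close>

lemma smooth_mul_in_charts:
  assumes C: "C \<in> A" "C' \<in> A" and S: "open S" and f: "smooth_fun A S f"
  shows "open (mul_domain C C' S)"
    and "smooth_on (mul_domain C C' S) (\<lambda>z. f (mul (chart_inv C (fst z)) (chart_inv C' (snd z))))"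
proof -
  let ?P = "(fst C \<times> fst C', map_prod (snd C) (snd C'))" and ?m = "\<lambda>(a, b). mul a b"
  note P = is_chart_prod[OF chart[OF C(1)] chart[OF C(2)]]
  have PA: "?P \<in> prod_atlas A A" using C unfolding prod_atlas_def by blast
  have img: "snd ?P ` fst ?P = (snd C ` fst C) \<times> (snd C' ` fst C')"
    by (simp add: map_prod_surj_on)
  have dom: "snd ?P ` (?m -` S \<inter> fst ?P) = mul_domain C C' S"
  proof (intro set_eqI)
    fix z :: "'e \<times> 'e"
    obtain x y where z: "z = (x, y)" by (cases z)
    show "z \<in> snd ?P ` (?m -` S \<inter> fst ?P) \<longleftrightarrow> z \<in> mul_domain C C' S"
      unfolding chart_image_iff[OF P(1)] img z mul_domain_def
      using P(2)[of x y] by auto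
  qed
  have "open (?m -` S)"
    using continuous_mul S by (simp add: open_vimage case_prod_unfold)
  then show op: "open (mul_domain C C' S)"
    using open_chart_image[OF P(1)] dom by metis
  have "smooth_fun (prod_atlas A A) (?m -` S) (f \<circ> ?m)"
    by (rule smooth_fun_compose_map[OF _ smooth_mul S f])
      (unfold prod_atlas_def, blast intro: is_chart_prod(1) chart)
  then have "smooth_on (mul_domain C C' S) (f \<circ> ?m \<circ> chart_inv ?P)"
    using PA dom unfolding smooth_fun_def by metis
  then show "smooth_on (mul_domain C C' S) (\<lambda>z. f (mul (chart_inv C (fst z)) (chart_inv C' (snd z))))"
  proof (rule smooth_on_cong[OF op])
    fix z assume "z \<in> mul_domain C C' S"
    then show "(f \<circ> ?m \<circ> chart_inv ?P) z = f (mul (chart_inv C (fst z)) (chart_inv C' (snd z)))"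
      using P(2)[of "fst z" "snd z"] by (auto simp: mul_domain_def)
  qed
qed

lemma smooth_fun_left_translation:
  assumes S: "open S" and f: "smooth_fun A S f"
  shows "smooth_fun A (mul a -` S) (f \<circ> mul a)"
proof (rule smooth_funI)
  fix C assume C: "C \<in> A"
  obtain Ca where Ca: "Ca \<in> A" "a \<in> fst Ca" using chart_at .
  note a = chart_inv_chart[OF chart[OF Ca(1)] Ca(2)]
  note sm = smooth_mul_in_charts[OF Ca(1) C S f]
  let ?T = "snd C ` (mul a -` S \<inter> fst C)"
  have oT: "open ?T"
    using open_chart_image[OF chart[OF C] open_left_translation_preimage[OF S]] .
  have "smooth_on ?T (\<lambda>y. (\<lambda>z. f (mul (chart_inv Ca (fst z)) (chart_inv C (snd z)))) (snd Ca a, y))"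
  proof (rule smooth_on_compose[OF oT sm(1) _ _ sm(2)])
    show "smooth_on ?T (\<lambda>y. (snd Ca a, y))"
      by (intro smooth_on_Pair oT smooth_on_const smooth_on_id)
    show "Pair (snd Ca a) ` ?T \<subseteq> mul_domain Ca C S"
    proof (rule image_subsetI)
      fix y assume "y \<in> ?T"
      then have "y \<in> snd C ` fst C" "chart_inv C y \<in> mul a -` S"
        using chart_image_iff[OF chart[OF C], of y "mul a -` S"] by simp_all
      then show "(snd Ca a, y) \<in> mul_domain Ca C S"
        unfolding mul_domain_def using Ca a by simp
    qed
  qed
  then show "smooth_on ?T (\<lambda>x. (f \<circ> mul a) (chart_inv C x))"
    by (simp add: a)
qed

lemma smooth_near_left_translation:
  assumes "smooth_near A (mul a p) f" shows "smooth_near A p (f \<circ> mul a)"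
proof -
  obtain U where U: "open U" "mul a p \<in> U" "smooth_fun A U f"
    using assms by (auto simp: smooth_near_def)
  show ?thesis
    by (rule smooth_nearI[OF open_left_translation_preimage[OF U(1)] _ smooth_fun_left_translation[OF U(1,3)]])
      (use U in simp)
qed

text \<open>The chain rule in a chart around p and one around \<open>mul a p\<close>. On functions
  that are not smooth near the image point both functionals are 0 by convention, so they agree
  everywhere.\<close>

lemma pushforward_tangent:
  assumes v: "v \<in> tangent_space A p"
  shows "pushforward A (mul a) p v \<in> tangent_space A (mul a p)"
proof -
  obtain C where C: "C \<in> A" "p \<in> fst C" using chart_at .
  obtain C' where C': "C' \<in> A" "mul a p \<in> fst C'" using chart_at .
  let ?G = "snd C' \<circ> mul a \<circ> chart_inv C"
  have p: "chart_inv C (snd C p) = p" using chart_inv_chart[OF chart] C by blast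
  have G: "(?G has_derivative frechet_derivative ?G (at (snd C p))) (at (snd C p))"
    using smooth_near_has_derivative[OF smooth_near_left_translation[OF smooth_near_chart[OF C']] C] .
  have "pushforward A (mul a) p v h
      = chart_tvec A C' (mul a p) (frechet_derivative ?G (at (snd C p)) (coords C v)) h" for h
  proof (cases "smooth_near A (mul a p) h")
    case True
    let ?H = "frechet_derivative (h \<circ> chart_inv C') (at (snd C' (mul a p)))"
    have H: "(h \<circ> chart_inv C' has_derivative ?H) (at (?G (snd C p)))"
      using smooth_near_has_derivative[OF True C'] p by simp
    have "(h \<circ> mul a \<circ> chart_inv C has_derivative (\<lambda>u. ?H (frechet_derivative ?G (at (snd C p)) u))) (at (snd C p))"
    proof (rule has_derivative_transform_within_open[OF has_derivative_compose[OF G H]])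
      show "open (snd C ` (mul a -` fst C' \<inter> fst C))"
        using open_chart_image[OF chart[OF C(1)] open_left_translation_preimage[OF open_chart[OF C'(1)]]] .
      show "snd C p \<in> snd C ` (mul a -` fst C' \<inter> fst C)" using C C' by auto
      fix x assume "x \<in> snd C ` (mul a -` fst C' \<inter> fst C)"
      then have "mul a (chart_inv C x) \<in> fst C'" using chart_image_iff[OF chart[OF C(1)], of x "mul a -` fst C'"] by simp
      then show "(h \<circ> chart_inv C') (?G x) = (h \<circ> mul a \<circ> chart_inv C) x"
        using chart_inv_chart[OF chart[OF C'(1)]] by simp
    qed
    note fun_cong[OF frechet_derivative_at[OF this], of "coords C v", symmetric]
    moreover have "pushforward A (mul a) p v h = v (h \<circ> mul a)"
      using True by (simp only: pushforward_def if_True)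
    ultimately show ?thesis
      using True by (simp only: tangent_apply[OF C v smooth_near_left_translation[OF True]] chart_tvec_def if_True)
  qed (simp add: pushforward_def chart_tvec_def)
  then have "pushforward A (mul a) p v = chart_tvec A C' (mul a p) (frechet_derivative ?G (at (snd C p)) (coords C v))"
    by blast
  then show ?thesis using tangent_space_chart[OF C'] by simp
qed

text \<open>The field is the translate of \<open>v\<close> to every point. Its smoothness is the
  real content: applied to a function f it is the partial derivative of f(pq) in q at
  \<open>e\<close>, which depends smoothly on p.\<close>

lemma left_invariant_field_exists:
  assumes v: "v \<in> tangent_space A e"
  shows "\<exists>U\<in>left_invariant_fields A mul. U e = v"
proof -
  define U where "U p = pushforward A (mul p) e v" for p
  have "U e = v"
  proof
    \<comment> \<open>For h not smooth near \<open>e\<close> the pushforward is 0 by definition, and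
      so is \<open>v h\<close> because tangent vectors carry the same default value.\<close>
    fix h show "U e h = v h"
      using tangent_not_smooth[OF v, of h] by (simp add: U_def pushforward_def mul_left_one o_def)
  qed
  obtain C0 where C0: "C0 \<in> A" "e \<in> fst C0" using chart_at .
  let ?y = "snd C0 e" and ?u = "coords C0 v"
  have y: "chart_inv C0 ?y = e" using chart_inv_chart[OF chart] C0 by blast
  have inv: "pushforward A (mul a) p (U p) = U (mul a p)" for a p
  proof
    fix h :: "'a \<Rightarrow> real"
    have "h \<circ> mul a \<circ> mul p = h \<circ> mul (mul a p)" by (auto simp: mul_assoc)
    then show "pushforward A (mul a) p (U p) h = U (mul a p) h"
      using smooth_near_left_translation[of a p h]
      by (simp add: U_def pushforward_def mul_right_one)
  qed
  have "vector_field A U"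
    unfolding vector_field_def
  proof (intro conjI allI impI)
    show "U p \<in> tangent_space A p" for p
      using pushforward_tangent[OF v, of p] by (simp add: U_def mul_right_one)
    fix S :: "'a set" and f :: "'a \<Rightarrow> real" assume S: "open S" and f: "smooth_fun A S f"
    show "smooth_fun A S (\<lambda>p. U p f)"
    proof (rule smooth_funI)
      fix C assume C: "C \<in> A"
      let ?T = "snd C ` (S \<inter> fst C)"
      let ?F = "\<lambda>z. f (mul (chart_inv C (fst z)) (chart_inv C0 (snd z)))"
      have oT: "open ?T" using open_chart_image[OF chart[OF C] S] .
      note sm = smooth_mul_in_charts[OF C C0(1) S f]
      have inT: "x \<in> snd C ` fst C" "chart_inv C x \<in> S" if "x \<in> ?T" for x
        using that chart_image_iff[OF chart[OF C]] by blast+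
      have dom: "(x, ?y) \<in> mul_domain C C0 S" if "x \<in> ?T" for x
        unfolding mul_domain_def using inT[OF that] y C0 by (simp add: mul_right_one)
      \<comment> \<open>A directional derivative of the jointly smooth function in direction (0, u),
        restricted to the slice where the second coordinate is that of \<open>e\<close>.\<close>
      have "smooth_on ?T (\<lambda>x. (\<lambda>z. frechet_derivative ?F (at z) (0, ?u)) (x, ?y))"
        by (rule smooth_on_compose[OF oT sm(1) _ _ smooth_on_frechet_derivative[OF sm(2)]])
          (use dom in \<open>auto intro!: smooth_on_Pair oT smooth_on_const smooth_on_id\<close>)
      then show "smooth_on ?T (\<lambda>x. U (chart_inv C x) f)"
      proof (rule smooth_on_cong[OF oT])
        fix x assume x: "x \<in> ?T"
        let ?p = "chart_inv C x"
        have near: "smooth_near A (mul ?p e) f"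
          using smooth_nearI[OF S inT(2)[OF x] f] by (simp add: mul_right_one)
        have "U ?p f = frechet_derivative (f \<circ> mul ?p \<circ> chart_inv C0) (at ?y) ?u"
          using near tangent_apply[OF C0 v smooth_near_left_translation[OF near]]
          by (simp add: U_def pushforward_def)
        moreover have "((\<lambda>y. ?F (x, y)) has_derivative (\<lambda>u. frechet_derivative ?F (at (x, ?y)) (0, u))) (at ?y)"
          by (rule has_derivative_compose[where f = "Pair x", OF _ smooth_on_has_derivative[OF sm(2) dom[OF x]]])
            (auto intro!: derivative_eq_intros)
        from frechet_derivative_at[OF this]
        have "frechet_derivative (f \<circ> mul ?p \<circ> chart_inv C0) (at ?y) = (\<lambda>u. frechet_derivative ?F (at (x, ?y)) (0, u))"
          by (simp add: o_def)
        ultimately show "frechet_derivative ?F (at (x, ?y)) (0, ?u) = U ?p f"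
          by simp
      qed
    qed
  qed
  with inv have "U \<in> left_invariant_fields A mul" by (simp add: left_invariant_fields_def)
  with \<open>U e = v\<close> show ?thesis by blast
qed

text \<open>At \<open>e\<close> the left-invariant fields exhaust the tangent space, which bounds
  the dimension of the manifold by the number of frame fields. At any other point pointwise
  independence together with this bound forces the frame to span.\<close>

lemma tangent_space_frame:
  fixes \<iota> :: "'g::real_vector \<Rightarrow> 'a vfield"
  assumes lin: "linear \<iota>" and range: "range \<iota> = left_invariant_fields A mul"
    and B: "finite B" "span B = UNIV"
    and ind: "\<And>p. inj_on (\<lambda>b. \<iota> b p) B" "\<And>p. independent ((\<lambda>b. \<iota> b p) ` B)"
  shows "tangent_space A p = range (\<lambda>u. \<iota> u p)"
proof -
  have lp: "linear (\<lambda>u. \<iota> u p)" for p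
    by (rule linearI) (simp_all add: linear_add[OF lin] linear_cmul[OF lin])
  have rng: "span ((\<lambda>b. \<iota> b p) ` B) = range (\<lambda>u. \<iota> u p)" for p
    using linear_span_image[OF lp, of p B] B(2) by simp
  have sub: "\<iota> u p \<in> tangent_space A p" for u p
  proof -
    have "\<iota> u \<in> left_invariant_fields A mul" using range by (metis rangeI)
    then show ?thesis by (simp add: left_invariant_fields_def vector_field_tangent)
  qed
  have e: "tangent_space A e \<subseteq> span ((\<lambda>b. \<iota> b e) ` B)"
    unfolding rng
  proof
    fix v assume "v \<in> tangent_space A e"
    then obtain U where U: "U \<in> left_invariant_fields A mul" "U e = v"
      using left_invariant_field_exists by blast
    then obtain u where "U = \<iota> u" using range by blast
    with U(2) show "v \<in> range (\<lambda>u. \<iota> u e)" by blast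
  qed
  obtain C0 where C0: "C0 \<in> A" "e \<in> fst C0" using chart_at .
  have inj: "inj (chart_tvec A C0 e)"
    using coords_chart_tvec[OF C0] by (metis injI)
  have "independent (chart_tvec A C0 e ` Basis)"
    by (rule linear_independent_injective_image[OF linear_chart_tvec[OF C0] independent_Basis])
      (use inj in \<open>blast intro: inj_on_subset\<close>)
  moreover have "chart_tvec A C0 e ` Basis \<subseteq> span ((\<lambda>b. \<iota> b e) ` B)"
    using e tangent_space_chart[OF C0] by blast
  \<comment> \<open>Coordinate vectors at \<open>e\<close> are independent and lie in the span of
    the frame, so there are at most as many of them as frame vectors.\<close>
  ultimately have "card (chart_tvec A C0 e ` Basis) \<le> card ((\<lambda>b. \<iota> b e) ` B)"
    using independent_span_bound[of "(\<lambda>b. \<iota> b e) ` B"] B(1) by blast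
  then have dim: "DIM('e) \<le> card B"
    using card_image[OF inj_on_subset[OF inj subset_UNIV]] card_image[OF ind(1)] by metis
  obtain C where C: "C \<in> A" "p \<in> fst C" using chart_at .
  have injC: "inj_on (coords C) (tangent_space A p)"
    using chart_tvec_coords[OF C] by (metis inj_onI)
  let ?F = "(\<lambda>b. \<iota> b p) ` B"
  have FT: "span ?F \<subseteq> tangent_space A p"
    unfolding rng using sub by blast
  have "independent (coords C ` ?F)"
    by (rule linear_independent_injective_image[OF linear_coords ind(2)]) (rule inj_on_subset[OF injC FT])
  moreover have "card (coords C ` ?F) = card B"
    using card_image[OF inj_on_subset[OF injC], of ?F] card_image[OF ind(1)] FT span_superset by (metis order_trans)
  \<comment> \<open>In coordinates the frame at p is an independent set with at least as many
    elements as the dimension, so it spans.\<close>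
  ultimately have "UNIV \<subseteq> span (coords C ` ?F)"
    using dim by (intro card_ge_dim_independent) auto
  then have U: "coords C ` span ?F = UNIV"
    using linear_span_image[OF linear_coords, of C ?F] by auto
  have "v \<in> span ?F" if v: "v \<in> tangent_space A p" for v
  proof -
    obtain w where w: "w \<in> span ?F" "coords C v = coords C w" using U by (metis UNIV_I imageE)
    then show ?thesis using injC v FT by (metis inj_onD subsetD)
  qed
  then show ?thesis using FT rng by blast
qed

end

section \<open>Riemannian geometry in an orthonormal frame with constant structure constants\<close>

lemma sum_fun_apply: "(\<Sum>i\<in>I. f i) x = (\<Sum>i\<in>I. f i x)"
  by (induction I rule: infinite_finite_induct) auto

lemma independent_imageI:
  fixes f :: "'i \<Rightarrow> 'v::real_vector"
  assumes fin: "finite S" and inj: "inj_on f S"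
    and zero: "\<And>c b. (\<Sum>a\<in>S. c a *\<^sub>R f a) = 0 \<Longrightarrow> b \<in> S \<Longrightarrow> c b = 0"
  shows "independent (f ` S)"
proof (rule independent_if_scalars_zero)
  fix c x assume s: "(\<Sum>x\<in>f ` S. c x *\<^sub>R x) = 0" and "x \<in> f ` S"
  then obtain b where b: "b \<in> S" "x = f b" by blast
  have "(\<Sum>a\<in>S. c (f a) *\<^sub>R f a) = 0"
    using s by (simp add: sum.reindex[OF inj])
  from zero[OF this b(1)] show "c x = 0" by (simp add: b(2))
qed (use fin in simp)

lemma fun_times_const: "fun_times (\<lambda>p. c) U = c *\<^sub>R U"
  by (simp add: fun_times_def scaleR_fun_def)

lemma fun_times_apply: "fun_times f U p = f p *\<^sub>R U p"
  by (simp add: fun_times_def)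

locale riemannian_manifold = smooth_manifold A
  for A :: "('a::topological_space, 'e::euclidean_space) chart set" +
  fixes g :: "'a metric"
  assumes metric: "riemannian_metric A g"
begin

lemma tangent_0: "0 \<in> tangent_space A p"
  and tangent_add: "u \<in> tangent_space A p \<Longrightarrow> v \<in> tangent_space A p \<Longrightarrow> u + v \<in> tangent_space A p"
  and tangent_diff: "u \<in> tangent_space A p \<Longrightarrow> v \<in> tangent_space A p \<Longrightarrow> u - v \<in> tangent_space A p"
  and tangent_scaleR: "u \<in> tangent_space A p \<Longrightarrow> r *\<^sub>R u \<in> tangent_space A p"
  and tangent_sum: "(\<And>i. i \<in> I \<Longrightarrow> f i \<in> tangent_space A p) \<Longrightarrow> sum f I \<in> tangent_space A p"
  by (simp_all add: subspace_tangent_space subspace_0 subspace_add subspace_diff subspace_scale subspace_sum)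

lemma g_sym: "u \<in> tangent_space A p \<Longrightarrow> v \<in> tangent_space A p \<Longrightarrow> g p u v = g p v u"
  using metric by (simp add: riemannian_metric_def)

lemma g_add: "u \<in> tangent_space A p \<Longrightarrow> v \<in> tangent_space A p \<Longrightarrow> w \<in> tangent_space A p \<Longrightarrow>
    g p (u + v) w = g p u w + g p v w"
  using metric by (simp add: riemannian_metric_def)

lemma g_scaleR: "u \<in> tangent_space A p \<Longrightarrow> v \<in> tangent_space A p \<Longrightarrow> g p (r *\<^sub>R u) v = r * g p u v"
  using metric by (simp add: riemannian_metric_def)

lemma g_add_right: "u \<in> tangent_space A p \<Longrightarrow> v \<in> tangent_space A p \<Longrightarrow> w \<in> tangent_space A p \<Longrightarrow>
    g p w (u + v) = g p w u + g p w v"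
  using g_sym g_add tangent_add by metis

lemma g_scaleR_right: "u \<in> tangent_space A p \<Longrightarrow> v \<in> tangent_space A p \<Longrightarrow> g p v (r *\<^sub>R u) = r * g p v u"
  using g_sym g_scaleR tangent_scaleR by metis

lemma g_diff: "u \<in> tangent_space A p \<Longrightarrow> v \<in> tangent_space A p \<Longrightarrow> w \<in> tangent_space A p \<Longrightarrow>
    g p (u - v) w = g p u w - g p v w"
  using g_add[of u p "(-1) *\<^sub>R v" w] g_scaleR[of v p w "-1"] tangent_scaleR[of v p "-1"] by simp

lemma g_zero: "u \<in> tangent_space A p \<Longrightarrow> g p 0 u = 0"
  using g_scaleR[of u p u 0] by simp

lemma g_sum: "finite I \<Longrightarrow> (\<And>i. i \<in> I \<Longrightarrow> f i \<in> tangent_space A p) \<Longrightarrow> v \<in> tangent_space A p \<Longrightarrow>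
    g p (sum f I) v = (\<Sum>i\<in>I. g p (f i) v)"
  by (induction I rule: finite_induct) (auto simp: g_zero g_add tangent_sum)

lemma g_smooth: "vector_field A U \<Longrightarrow> vector_field A V \<Longrightarrow> smooth_fun A UNIV (\<lambda>p. g p (U p) (V p))"
  using metric by (simp add: riemannian_metric_def)

lemma orthonormal_independent:
  fixes f :: "'i \<Rightarrow> 'a tvec"
  assumes fin: "finite S" and t: "\<And>b. b \<in> S \<Longrightarrow> f b \<in> tangent_space A p"
    and o: "\<And>b c. b \<in> S \<Longrightarrow> c \<in> S \<Longrightarrow> g p (f b) (f c) = (if b = c then 1 else 0)"
  shows "inj_on f S" "independent (f ` S)"
proof -
  show inj: "inj_on f S"
  proof (rule inj_onI)
    fix b c assume "b \<in> S" "c \<in> S" "f b = f c"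
    then show "b = c" using o[of b b] o[of b c] by (auto split: if_splits)
  qed
  show "independent (f ` S)"
  proof (rule independent_imageI[OF fin inj])
    fix c b assume s: "(\<Sum>a\<in>S. c a *\<^sub>R f a) = 0" and b: "b \<in> S"
    have "c b = (\<Sum>a\<in>S. if a = b then c a else 0)"
      using fin b by simp
    also have "\<dots> = (\<Sum>a\<in>S. c a * g p (f a) (f b))"
      using b by (intro sum.cong refl) (simp add: o)
    also have "\<dots> = (\<Sum>a\<in>S. g p (c a *\<^sub>R f a) (f b))"
      using b by (intro sum.cong refl g_scaleR[symmetric] t)
    also have "\<dots> = g p (\<Sum>a\<in>S. c a *\<^sub>R f a) (f b)"
      using b by (intro g_sum[symmetric] fin tangent_scaleR t)
    also have "\<dots> = 0" unfolding s by (rule g_zero[OF t[OF b]])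
    finally show "c b = 0" .
  qed
qed

end

text \<open>What the group contributes to the local geometry: a linear space of global fields,
  closed under the bracket, that contains an orthonormal frame. The computations in this locale
  refer to structure constants and no longer to the group.\<close>

locale riemannian_frame = riemannian_manifold A g
  for A :: "('a::topological_space, 'e::euclidean_space) chart set" and g :: "'a metric" +
  fixes nabla :: "'a connection" and \<iota> :: "'g::real_vector \<Rightarrow> 'a vfield"
    and br :: "'g \<Rightarrow> 'g \<Rightarrow> 'g" and B :: "'g set"
  assumes lc: "levi_civita A g nabla"
    and linear_frame: "linear \<iota>" and vf_frame: "vector_field A (\<iota> u)"
    and finite_B: "finite B" and independent_B: "independent B" and span_B: "span B = UNIV"
    and orthonormal: "u \<in> B \<Longrightarrow> v \<in> B \<Longrightarrow> g p (\<iota> u p) (\<iota> v p) = (if u = v then 1 else 0)"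
    and tangent_frame: "tangent_space A p = range (\<lambda>u. \<iota> u p)"
    and bracket_frame: "lie_bracket A (\<iota> u) (\<iota> v) = \<iota> (br u v)"
begin

lemma frame_tangent: "\<iota> u p \<in> tangent_space A p"
  by (rule vector_field_tangent[OF vf_frame])

lemma frame_add: "\<iota> (u + v) = \<iota> u + \<iota> v" and frame_scaleR: "\<iota> (r *\<^sub>R u) = r *\<^sub>R \<iota> u"
  and frame_0: "\<iota> 0 = 0" and frame_minus: "\<iota> (- u) = - \<iota> u" and frame_diff: "\<iota> (u - v) = \<iota> u - \<iota> v"
  using linear_frame by (simp_all add: linear_add linear_cmul linear_0 linear_neg linear_diff)

lemma frame_representation:
  "(\<Sum>b\<in>B. representation B u b *\<^sub>R b) = u" "(\<Sum>b\<in>B. representation B u b *\<^sub>R \<iota> b p) = \<iota> u p"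
proof -
  show u: "(\<Sum>b\<in>B. representation B u b *\<^sub>R b) = u"
    using real_vector.sum_representation_eq[OF independent_B _ finite_B] span_B by blast
  show "(\<Sum>b\<in>B. representation B u b *\<^sub>R \<iota> b p) = \<iota> u p"
    using arg_cong[OF u, of "\<lambda>u. \<iota> u p"]
    by (simp add: linear_sum[OF linear_frame] sum_fun_apply linear_cmul[OF linear_frame])
qed

lemma g_frame_representation:
  assumes "c \<in> B" shows "g p (\<iota> u p) (\<iota> c p) = representation B u c"
proof -
  have "g p (\<Sum>b\<in>B. representation B u b *\<^sub>R \<iota> b p) (\<iota> c p)
      = (\<Sum>b\<in>B. representation B u b * g p (\<iota> b p) (\<iota> c p))"
    by (simp add: g_sum finite_B tangent_scaleR frame_tangent g_scaleR)
  also have "\<dots> = (\<Sum>b\<in>B. if b = c then representation B u b else 0)"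
    by (intro sum.cong refl) (simp add: orthonormal assms)
  also have "\<dots> = representation B u c" using assms finite_B by simp
  finally show ?thesis by (simp only: frame_representation(2))
qed

lemma inj_frame: "inj (\<lambda>u. \<iota> u p)"
proof (rule injI)
  fix u v assume "\<iota> u p = \<iota> v p"
  then have "representation B u b = representation B v b" if "b \<in> B" for b
    using g_frame_representation[OF that] by metis
  then have "(\<Sum>b\<in>B. representation B u b *\<^sub>R b) = (\<Sum>b\<in>B. representation B v b *\<^sub>R b)"
    by simp
  then show "u = v" by (simp only: frame_representation(1))
qed

lemma frame_expand:
  assumes "v \<in> tangent_space A p" shows "(\<Sum>b\<in>B. g p v (\<iota> b p) *\<^sub>R \<iota> b p) = v"
proof -
  obtain u where v: "v = \<iota> u p" using assms tangent_frame by blast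
  then show ?thesis
    using frame_representation(2)[of u p] by (simp add: g_frame_representation)
qed

lemma tangent_eqI:
  assumes "v \<in> tangent_space A p" "w \<in> tangent_space A p" "\<And>b. b \<in> B \<Longrightarrow> g p v (\<iota> b p) = g p w (\<iota> b p)"
  shows "v = w"
proof -
  have "(\<Sum>b\<in>B. g p v (\<iota> b p) *\<^sub>R \<iota> b p) = (\<Sum>b\<in>B. g p w (\<iota> b p) *\<^sub>R \<iota> b p)"
    using assms(3) by (intro sum.cong refl) simp
  then show ?thesis by (simp only: frame_expand[OF assms(1)] frame_expand[OF assms(2)])
qed

lemma g_frame_expand:
  assumes "v \<in> tangent_space A p" "w \<in> tangent_space A p"
  shows "g p v w = (\<Sum>b\<in>B. g p v (\<iota> b p) * g p w (\<iota> b p))"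
proof -
  have "g p v w = g p (\<Sum>b\<in>B. g p v (\<iota> b p) *\<^sub>R \<iota> b p) w"
    using frame_expand[OF assms(1)] by simp
  then show ?thesis
    using assms by (simp add: g_sum finite_B tangent_scaleR frame_tangent g_scaleR g_sym[of w p])
qed

subsection \<open>The Levi-Civita connection\<close>

lemma vf_nabla: "vector_field A U \<Longrightarrow> vector_field A V \<Longrightarrow> vector_field A (nabla U V)"
  and torsion_free: "vector_field A U \<Longrightarrow> vector_field A V \<Longrightarrow> nabla U V - nabla V U = lie_bracket A U V"
  using lc by (simp_all add: levi_civita_def)

lemma nabla_add_left: "vector_field A U \<Longrightarrow> vector_field A V \<Longrightarrow> vector_field A W \<Longrightarrow>
      nabla (U + V) W = nabla U W + nabla V W"
  and nabla_add_right: "vector_field A U \<Longrightarrow> vector_field A V \<Longrightarrow> vector_field A W \<Longrightarrow>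
      nabla U (V + W) = nabla U V + nabla U W"
  using lc by (simp_all add: levi_civita_def)

lemma metric_compatible: "vector_field A U \<Longrightarrow> vector_field A V \<Longrightarrow> vector_field A W \<Longrightarrow>
      U p (\<lambda>q. g q (V q) (W q)) = g p (nabla U V p) (W p) + g p (V p) (nabla U W p)"
  using lc unfolding levi_civita_def by blast

lemma nabla_fun_left: "smooth_fun A UNIV f \<Longrightarrow> vector_field A U \<Longrightarrow> vector_field A V \<Longrightarrow>
      nabla (fun_times f U) V = fun_times f (nabla U V)"
  and nabla_fun_right: "smooth_fun A UNIV f \<Longrightarrow> vector_field A U \<Longrightarrow> vector_field A V \<Longrightarrow>
      nabla U (fun_times f V) = fun_times (\<lambda>p. U p f) V + fun_times f (nabla U V)"
  using lc by (simp_all add: levi_civita_def)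

lemma nabla_scaleR_left: "vector_field A U \<Longrightarrow> vector_field A V \<Longrightarrow> nabla (c *\<^sub>R U) V = c *\<^sub>R nabla U V"
  using nabla_fun_left[OF smooth_fun_const[OF open_UNIV], of U V c] by (simp add: fun_times_const)

lemma nabla_scaleR_right:
  assumes "vector_field A U" "vector_field A V" shows "nabla U (c *\<^sub>R V) = c *\<^sub>R nabla U V"
proof -
  have "(\<lambda>p. U p (\<lambda>q. c)) = (\<lambda>p. 0)"
    using tangent_const[OF vector_field_tangent[OF assms(1)]] by auto
  then show ?thesis
    using nabla_fun_right[OF smooth_fun_const[OF open_UNIV] assms, of c] by (simp add: fun_times_const)
qed

lemma nabla_minus_left: "vector_field A U \<Longrightarrow> vector_field A V \<Longrightarrow> nabla (- U) V = - nabla U V"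
  using nabla_scaleR_left[of U V "-1"] by simp

lemma nabla_minus_right: "vector_field A U \<Longrightarrow> vector_field A V \<Longrightarrow> nabla U (- V) = - nabla U V"
  using nabla_scaleR_right[of U V "-1"] by simp

lemma nabla_diff_left: "vector_field A U \<Longrightarrow> vector_field A V \<Longrightarrow> vector_field A W \<Longrightarrow>
      nabla (U - V) W = nabla U W - nabla V W"
  using nabla_add_left[of U "- V" W] vector_field_uminus[of V] nabla_minus_left by simp

lemma nabla_0_left: "vector_field A V \<Longrightarrow> nabla 0 V = 0"
  using nabla_scaleR_left[of V V 0] by simp

lemma nabla_0_right: "vector_field A V \<Longrightarrow> nabla V 0 = 0"
  using nabla_scaleR_right[of V V 0] by simp

lemmas vector_field_intros = vf_frame vf_nabla vector_field_add vector_field_diff vector_field_uminus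
  vector_field_scaleR vector_field_fun_times

lemmas nabla_simps = nabla_add_left nabla_add_right nabla_scaleR_left nabla_scaleR_right
  nabla_minus_left nabla_minus_right nabla_0_left nabla_0_right vector_field_intros

text \<open>Since the connection is torsion free, the bracket is a difference of covariant
  derivatives; its algebraic rules are read off from those of \<open>nabla\<close> instead of from
  second derivatives.\<close>

lemma vf_lie_bracket: "vector_field A U \<Longrightarrow> vector_field A V \<Longrightarrow> vector_field A (lie_bracket A U V)"
  using torsion_free[of U V] vector_field_diff[OF vf_nabla vf_nabla, of U V V U] by simp

lemma lie_bracket_skew: "vector_field A U \<Longrightarrow> vector_field A V \<Longrightarrow> lie_bracket A V U = - lie_bracket A U V"
  using torsion_free[of U V] torsion_free[of V U] by (metis minus_diff_eq)

lemma lie_bracket_add_left: "vector_field A U \<Longrightarrow> vector_field A V \<Longrightarrow> vector_field A W \<Longrightarrow>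
    lie_bracket A (U + V) W = lie_bracket A U W + lie_bracket A V W"
  by (simp add: torsion_free[symmetric] nabla_simps algebra_simps)

lemma lie_bracket_fun_left: 
  assumes "smooth_fun A UNIV f" "vector_field A U" "vector_field A V"
  shows "lie_bracket A (fun_times f U) V = fun_times f (lie_bracket A U V) - fun_times (\<lambda>p. V p f) U"
proof -
  have "lie_bracket A (fun_times f U) V = nabla (fun_times f U) V - nabla V (fun_times f U)"
    using torsion_free[OF vector_field_fun_times[OF assms(1,2)] assms(3)] by simp
  also have "\<dots> = fun_times f (nabla U V) - (fun_times (\<lambda>p. V p f) U + fun_times f (nabla V U))"
    using assms by (simp add: nabla_fun_left nabla_fun_right)
  also have "\<dots> = fun_times f (nabla U V - nabla V U) - fun_times (\<lambda>p. V p f) U"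
    by (simp add: fun_eq_iff fun_times_def algebra_simps)
  finally show ?thesis using torsion_free[OF assms(2,3)] by simp
qed

lemma lie_bracket_scaleR_left: "vector_field A U \<Longrightarrow> vector_field A V \<Longrightarrow>
    lie_bracket A (c *\<^sub>R U) V = c *\<^sub>R lie_bracket A U V"
  by (simp add: torsion_free[symmetric] nabla_simps scaleR_diff_right)

lemma lie_bracket_scaleR_right: "vector_field A U \<Longrightarrow> vector_field A V \<Longrightarrow>
    lie_bracket A U (c *\<^sub>R V) = c *\<^sub>R lie_bracket A U V"
  by (simp add: torsion_free[symmetric] nabla_simps scaleR_diff_right)

lemma lie_bracket_minus_left: "vector_field A U \<Longrightarrow> vector_field A V \<Longrightarrow>
    lie_bracket A (- U) V = - lie_bracket A U V"
  using lie_bracket_scaleR_left[of U V "-1"] by simp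

lemma lie_bracket_minus_right: "vector_field A U \<Longrightarrow> vector_field A V \<Longrightarrow>
    lie_bracket A U (- V) = - lie_bracket A U V"
  using lie_bracket_scaleR_right[of U V "-1"] by simp

lemmas lie_bracket_simps = bracket_frame lie_bracket_scaleR_left lie_bracket_scaleR_right
  lie_bracket_minus_left lie_bracket_minus_right

text \<open>Koszul's formula. Inner products of frame fields are constant, so metric compatibility
  makes the connection coefficients skew in the last two slots; with three torsion identities this
  determines them. The caller proposes \<open>n\<close>, and the components are compared.\<close>

lemma nabla_frame:
  assumes "u \<in> B" "v \<in> B"
    and N: "\<forall>w\<in>B. 2 * g p (\<iota> n p) (\<iota> w p)
      = g p (\<iota> (br u v) p) (\<iota> w p) - g p (\<iota> (br v w) p) (\<iota> u p) + g p (\<iota> (br w u) p) (\<iota> v p)"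
  shows "nabla (\<iota> u) (\<iota> v) p = \<iota> n p"
proof (rule tangent_eqI)
  show "nabla (\<iota> u) (\<iota> v) p \<in> tangent_space A p" "\<iota> n p \<in> tangent_space A p"
    by (intro vector_field_tangent vector_field_intros)+
  fix w assume w: "w \<in> B"
  let ?G = "\<lambda>u v w. g p (nabla (\<iota> u) (\<iota> v) p) (\<iota> w p)"
  have skew: "?G u v w = - ?G u w v" if "v \<in> B" "w \<in> B" for u v w
  proof -
    have "\<iota> u p (\<lambda>q. g q (\<iota> v q) (\<iota> w q)) = 0"
      using orthonormal[OF that] tangent_const[OF frame_tangent, of u p] by simp
    moreover have "g p (\<iota> v p) (nabla (\<iota> u) (\<iota> w) p) = ?G u w v"
      by (intro g_sym vector_field_tangent vector_field_intros)
    ultimately show ?thesis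
      using metric_compatible[of "\<iota> u" "\<iota> v" "\<iota> w" p] vf_frame by simp
  qed
  have tors: "?G u v w - ?G v u w = g p (\<iota> (br u v) p) (\<iota> w p)" for u v w
  proof -
    have "nabla (\<iota> u) (\<iota> v) p - nabla (\<iota> v) (\<iota> u) p = \<iota> (br u v) p"
      using fun_cong[OF torsion_free[OF vf_frame vf_frame], of u v p] by (simp add: bracket_frame)
    moreover have "g p (nabla (\<iota> u) (\<iota> v) p - nabla (\<iota> v) (\<iota> u) p) (\<iota> w p) = ?G u v w - ?G v u w"
      by (intro g_diff vector_field_tangent vector_field_intros)
    ultimately show ?thesis by simp
  qed
  show "?G u v w = g p (\<iota> n p) (\<iota> w p)"
    using bspec[OF N w] tors[of u v w] tors[of v w u] tors[of w u v] skew[OF assms(2) w, of u]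
      skew[OF w assms(1), of v] skew[OF assms(1,2), of w] by linarith
qed

subsection \<open>Tensoriality\<close>

lemma field_expand:
  assumes "vector_field A U" shows "(\<Sum>b\<in>B. fun_times (\<lambda>p. g p (U p) (\<iota> b p)) (\<iota> b)) = U"
proof
  fix p show "(\<Sum>b\<in>B. fun_times (\<lambda>p. g p (U p) (\<iota> b p)) (\<iota> b)) p = U p"
    using frame_expand[OF vector_field_tangent[OF assms], of p] by (simp add: sum_fun_apply fun_times_apply)
qed

text \<open>The frame is global with smooth coefficients, so linearity over smooth functions gives
  the expansion at once, without cut-off functions.\<close>

lemma tensor_expand:
  fixes T :: "'a vfield \<Rightarrow> 'a vfield"
  assumes add: "\<And>U V. vector_field A U \<Longrightarrow> vector_field A V \<Longrightarrow> T (U + V) = T U + T V"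
    and scale: "\<And>f U. smooth_fun A UNIV f \<Longrightarrow> vector_field A U \<Longrightarrow> T (fun_times f U) = fun_times f (T U)"
    and U: "vector_field A U"
  shows "T U = (\<Sum>b\<in>B. fun_times (\<lambda>p. g p (U p) (\<iota> b p)) (T (\<iota> b)))"
proof -
  define F where "F b = fun_times (\<lambda>p. g p (U p) (\<iota> b p)) (\<iota> b)" for b
  have vF: "vector_field A (F b)" for b
    unfolding F_def by (intro vector_field_intros g_smooth U)
  have vsum: "vector_field A (sum F I)" if "finite I" for I
    using that
  proof (induction I rule: finite_induct)
    case empty
    show ?case using vector_field_scaleR[OF U, of 0] by (simp only: sum.empty scaleR_zero_left)
  next
    case (insert b I)
    then show ?case by (simp only: sum.insert vector_field_add vF not_False_eq_True)
  qed
  have T0: "T 0 = 0"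
    using scale[OF smooth_fun_const[OF open_UNIV, of 0] U] by (simp add: fun_times_const)
  have "T (sum F I) = (\<Sum>b\<in>I. T (F b))" if "finite I" for I
    using that
  proof (induction I rule: finite_induct)
    case (insert b I)
    then show ?case by (simp only: sum.insert add vF vsum not_False_eq_True)
  qed (simp only: sum.empty T0)
  from this[OF finite_B] have "T U = (\<Sum>b\<in>B. T (F b))"
    using field_expand[OF U] by (simp add: F_def)
  also have "\<dots> = (\<Sum>b\<in>B. fun_times (\<lambda>p. g p (U p) (\<iota> b p)) (T (\<iota> b)))"
    unfolding F_def by (intro sum.cong refl scale g_smooth vf_frame U)
  finally show ?thesis .
qed

lemma tensor_eq_0:
  fixes T :: "'a vfield \<Rightarrow> 'a vfield"
  assumes "\<And>U V. vector_field A U \<Longrightarrow> vector_field A V \<Longrightarrow> T (U + V) = T U + T V"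
    and "\<And>f U. smooth_fun A UNIV f \<Longrightarrow> vector_field A U \<Longrightarrow> T (fun_times f U) = fun_times f (T U)"
    and "vector_field A U" and "\<And>b. b \<in> B \<Longrightarrow> T (\<iota> b) = 0"
  shows "T U = 0"
proof -
  have "T U = (\<Sum>b\<in>B. fun_times (\<lambda>p. g p (U p) (\<iota> b p)) (T (\<iota> b)))"
    by (rule tensor_expand[of T, OF assms(1-3)])
  also have "\<dots> = 0"
    by (rule sum.neutral) (simp add: assms(4) fun_times_def fun_eq_iff)
  finally show ?thesis .
qed

lemma nabla_expand:
  assumes "vector_field A U" "vector_field A V"
  shows "nabla U V = (\<Sum>b\<in>B. fun_times (\<lambda>p. g p (U p) (\<iota> b p)) (nabla (\<iota> b) V))"
  using assms by (intro tensor_expand[of "\<lambda>U. nabla U V"]) (auto simp: nabla_add_left nabla_fun_left)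

section \<open>Tensoriality of the Nijenhuis tensor and of the covariant derivative of J\<close>

context
  fixes J assumes J: "almost_hermitian A g J"
begin

lemma J_J: "u \<in> tangent_space A p \<Longrightarrow> J p (J p u) = - u"
  and J_add: "u \<in> tangent_space A p \<Longrightarrow> v \<in> tangent_space A p \<Longrightarrow> J p (u + v) = J p u + J p v"
  and J_scaleR: "u \<in> tangent_space A p \<Longrightarrow> J p (r *\<^sub>R u) = r *\<^sub>R J p u"
  using J by (simp_all add: almost_hermitian_def)

lemma vf_endo_app: "vector_field A U \<Longrightarrow> vector_field A (endo_app J U)"
  using J by (simp add: almost_hermitian_def)

lemma endo_app_add: "vector_field A U \<Longrightarrow> vector_field A V \<Longrightarrow> endo_app J (U + V) = endo_app J U + endo_app J V"
  by (simp add: endo_app_def fun_eq_iff J_add vector_field_tangent)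

lemma endo_app_fun_times: "vector_field A U \<Longrightarrow> endo_app J (fun_times f U) = fun_times f (endo_app J U)"
  by (simp add: endo_app_def fun_eq_iff J_scaleR fun_times_def vector_field_tangent)

lemma endo_app_scaleR: "vector_field A U \<Longrightarrow> endo_app J (c *\<^sub>R U) = c *\<^sub>R endo_app J U"
  using endo_app_fun_times[of U "\<lambda>p. c"] by (simp add: fun_times_const)

lemma endo_app_minus: "vector_field A U \<Longrightarrow> endo_app J (- U) = - endo_app J U"
  using endo_app_scaleR[of U "-1"] by simp

lemma endo_app_diff: "vector_field A U \<Longrightarrow> vector_field A V \<Longrightarrow> endo_app J (U - V) = endo_app J U - endo_app J V"
  using endo_app_add[of U "- V"] vector_field_uminus[of V] endo_app_minus[of V] by simp

lemma endo_app_0: "endo_app J 0 = 0"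
  using endo_app_scaleR[OF vf_frame, of 0 undefined] by simp

lemma endo_app_endo_app: "vector_field A U \<Longrightarrow> endo_app J (endo_app J U) = - U"
  by (simp add: endo_app_def fun_eq_iff J_J vector_field_tangent)

lemmas endo_app_simps = endo_app_add endo_app_diff endo_app_fun_times endo_app_scaleR endo_app_minus
  endo_app_0 endo_app_endo_app vf_endo_app

lemma nijenhuis_add_left: "vector_field A U \<Longrightarrow> vector_field A U' \<Longrightarrow> vector_field A V \<Longrightarrow>
    nijenhuis A J (U + U') V = nijenhuis A J U V + nijenhuis A J U' V"
  by (simp add: nijenhuis_def endo_app_simps lie_bracket_add_left vf_lie_bracket)

text \<open>The Leibniz rule creates the terms ((JV) f) JU and (V f) U; each occurs twice, and the
  signs are opposite because J squares to -1.\<close>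

lemma nijenhuis_fun_left:
  assumes "smooth_fun A UNIV f" "vector_field A U" "vector_field A V"
  shows "nijenhuis A J (fun_times f U) V = fun_times f (nijenhuis A J U V)"
proof -
  have 1: "vector_field A (fun_times (\<lambda>p. V p f) U)" if "vector_field A V" "vector_field A U" for U V
    by (intro vector_field_fun_times that vector_field_smooth[OF that(1) open_UNIV assms(1)])
  show ?thesis
    using assms
    by (simp add: nijenhuis_def endo_app_simps lie_bracket_fun_left vf_lie_bracket vector_field_fun_times 1)
      (simp add: fun_eq_iff fun_times_def algebra_simps)
qed

lemma nijenhuis_skew: "vector_field A U \<Longrightarrow> vector_field A V \<Longrightarrow> nijenhuis A J V U = - nijenhuis A J U V"
  unfolding nijenhuis_def
  by (simp add: lie_bracket_skew[of "endo_app J U" "endo_app J V"] lie_bracket_skew[of "endo_app J U" V]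
      lie_bracket_skew[of U "endo_app J V"] lie_bracket_skew[of U V] endo_app_simps vf_lie_bracket)

text \<open>Tensoriality is available in the left slot only; skew-symmetry carries the argument over
  to the right slot.\<close>

lemma nijenhuis_eq_0:
  assumes "\<And>b c. b \<in> B \<Longrightarrow> c \<in> B \<Longrightarrow> nijenhuis A J (\<iota> b) (\<iota> c) = 0"
    and "vector_field A U" "vector_field A V"
  shows "nijenhuis A J U V = 0"
proof -
  have 1: "nijenhuis A J U (\<iota> c) = 0" if "c \<in> B" "vector_field A U" for c U
    by (rule tensor_eq_0[of "\<lambda>U. nijenhuis A J U (\<iota> c)"])
      (use that assms(1) in \<open>simp_all add: nijenhuis_add_left nijenhuis_fun_left vf_frame\<close>)
  have "nijenhuis A J V U = 0"
    by (rule tensor_eq_0[of "\<lambda>V. nijenhuis A J V U"])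
      (use assms 1 nijenhuis_skew[OF assms(2) vf_frame] in \<open>simp_all add: nijenhuis_add_left nijenhuis_fun_left vf_frame\<close>)
  then show ?thesis using nijenhuis_skew[OF assms(3,2)] by simp
qed

definition nabla_J :: "'a vfield \<Rightarrow> 'a vfield \<Rightarrow> 'a vfield"
  where "nabla_J U V = nabla U (endo_app J V) - endo_app J (nabla U V)"

text \<open>In the right slot the derivative term (U f) JV appears in both summands of
  \<open>nabla_J\<close> and cancels, so it is tensorial in each slot.\<close>

lemma nabla_J_eq_0:
  assumes 0: "\<And>b c. b \<in> B \<Longrightarrow> c \<in> B \<Longrightarrow> nabla_J (\<iota> b) (\<iota> c) = 0"
    and "vector_field A U" "vector_field A V"
  shows "nabla_J U V = 0"
proof -
  have 1: "nabla_J (\<iota> b) V = 0" if b: "b \<in> B" for b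
  proof (rule tensor_eq_0[of "nabla_J (\<iota> b)"])
    show "nabla_J (\<iota> b) (U + V) = nabla_J (\<iota> b) U + nabla_J (\<iota> b) V"
      if "vector_field A U" "vector_field A V" for U V
      using that by (simp add: nabla_J_def endo_app_simps nabla_simps)
    show "nabla_J (\<iota> b) (fun_times f V) = fun_times f (nabla_J (\<iota> b) V)"
      if "smooth_fun A UNIV f" "vector_field A V" for f V
    proof -
      have "vector_field A (fun_times (\<lambda>p. \<iota> b p f) V)"
        by (intro vector_field_fun_times that vector_field_smooth[OF vf_frame open_UNIV])
      then show ?thesis
        using that
        by (simp add: nabla_J_def endo_app_simps nabla_simps nabla_fun_right)
          (simp add: fun_eq_iff fun_times_def algebra_simps)
    qed
  qed (use assms b in auto)
  show ?thesis
  proof (rule tensor_eq_0[of "\<lambda>U. nabla_J U V"])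
    show "nabla_J (U + U') V = nabla_J U V + nabla_J U' V" if "vector_field A U" "vector_field A U'" for U U'
      using that assms(3) by (simp add: nabla_J_def endo_app_simps nabla_simps)
    show "nabla_J (fun_times f U) V = fun_times f (nabla_J U V)"
      if "smooth_fun A UNIV f" "vector_field A U" for f U
      using that assms(3)
      by (simp add: nabla_J_def endo_app_simps nabla_fun_left vf_nabla)
        (simp add: fun_eq_iff fun_times_def algebra_simps)
  qed (use assms 1 in auto)
qed

end

lemma curvature_add_left:
  assumes "vector_field A U" "vector_field A U'" "vector_field A V" "vector_field A W"
  shows "curvature A nabla (U + U') V W = curvature A nabla U V W + curvature A nabla U' V W"
  using assms by (simp add: curvature_def nabla_simps lie_bracket_add_left vf_lie_bracket)

text \<open>The term (V f) times the derivative of W along U arises once from \<open>nabla V\<close>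
  and once, with opposite sign, from the bracket. The first slot is the one over which the Ricci
  trace runs.\<close>

lemma curvature_fun_left:
  assumes "smooth_fun A UNIV f" "vector_field A U" "vector_field A V" "vector_field A W"
  shows "curvature A nabla (fun_times f U) V W = fun_times f (curvature A nabla U V W)"
proof -
  have s: "smooth_fun A UNIV (\<lambda>p. V p f)"
    using vector_field_smooth[OF assms(3) open_UNIV assms(1)] .
  have 1: "vector_field A (fun_times (\<lambda>p. V p f) U)"
    by (rule vector_field_fun_times[OF s assms(2)])
  show ?thesis
    using assms
    by (simp add: curvature_def lie_bracket_fun_left nabla_diff_left vf_lie_bracket 1 nabla_fun_left[OF s]
        vector_field_intros nabla_fun_left nabla_fun_right)
      (simp add: fun_eq_iff fun_times_def algebra_simps)
qed

subsection \<open>Subbundles spanned by part of the frame\<close>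

text \<open>The span of the frame vectors in \<open>S\<close>, encoded by vanishing components.
  Membership becomes a set of equations, and the orthogonal complement is the subframe of
  \<open>B - S\<close>.\<close>

definition subframe :: "'g set \<Rightarrow> 'a distr"
  where "subframe S p = {v \<in> tangent_space A p. \<forall>b\<in>B - S. g p v (\<iota> b p) = 0}"

lemma frame_in_subframe: "S \<subseteq> B \<Longrightarrow> b \<in> S \<Longrightarrow> \<iota> b p \<in> subframe S p"
  by (auto simp: subframe_def frame_tangent orthonormal subset_iff)

lemma subframe_expand:
  assumes "S \<subseteq> B" "v \<in> subframe S p" shows "(\<Sum>b\<in>S. g p v (\<iota> b p) *\<^sub>R \<iota> b p) = v"
proof -
  have "(\<Sum>b\<in>S. g p v (\<iota> b p) *\<^sub>R \<iota> b p) = (\<Sum>b\<in>B. g p v (\<iota> b p) *\<^sub>R \<iota> b p)"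
    using assms finite_B by (intro sum.mono_neutral_left) (auto simp: subframe_def)
  then show ?thesis using frame_expand assms(2) by (simp add: subframe_def)
qed

lemma span_subframe:
  assumes "S \<subseteq> B" shows "span ((\<lambda>b. \<iota> b p) ` S) = subframe S p"
proof
  have "subspace (subframe S p)"
    by (rule subspaceI) (auto simp: subframe_def tangent_0 tangent_add tangent_scaleR g_zero g_add g_scaleR frame_tangent)
  then show "span ((\<lambda>b. \<iota> b p) ` S) \<subseteq> subframe S p"
    by (intro span_minimal image_subsetI frame_in_subframe[OF assms])
  show "subframe S p \<subseteq> span ((\<lambda>b. \<iota> b p) ` S)"
  proof
    fix v assume "v \<in> subframe S p"
    then have "v = (\<Sum>b\<in>S. g p v (\<iota> b p) *\<^sub>R \<iota> b p)" using subframe_expand[OF assms] by simp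
    also have "\<dots> \<in> span ((\<lambda>b. \<iota> b p) ` S)"
      by (intro span_sum span_scale span_base) auto
    finally show "v \<in> span ((\<lambda>b. \<iota> b p) ` S)" .
  qed
qed

lemma subframe_B: "subframe B = tangent_space A"
  by (auto simp: subframe_def fun_eq_iff)

lemma g_subframe:
  assumes "v \<in> subframe S p" "w \<in> tangent_space A p" "S \<subseteq> B"
  shows "g p v w = (\<Sum>b\<in>S. g p v (\<iota> b p) * g p w (\<iota> b p))"
proof -
  have v: "v \<in> tangent_space A p" using assms by (simp add: subframe_def)
  have "(\<Sum>b\<in>B. g p v (\<iota> b p) * g p w (\<iota> b p)) = (\<Sum>b\<in>S. g p v (\<iota> b p) * g p w (\<iota> b p))"
    using assms finite_B by (intro sum.mono_neutral_right) (auto simp: subframe_def)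
  then show ?thesis using g_frame_expand[OF v assms(2)] by simp
qed

lemma orthonormal_subset:
  "S \<subseteq> B \<Longrightarrow> b \<in> S \<Longrightarrow> c \<in> S \<Longrightarrow> g p (\<iota> b p) (\<iota> c p) = (if b = c then 1 else 0)"
  using orthonormal by (meson subsetD)

lemma inj_on_frame: "S \<subseteq> B \<Longrightarrow> inj_on (\<lambda>b. \<iota> b p) S"
  and independent_frame: "S \<subseteq> B \<Longrightarrow> independent ((\<lambda>b. \<iota> b p) ` S)"
  using orthonormal_independent[of S "\<lambda>b. \<iota> b p" p] finite_subset[OF _ finite_B]
  by (simp_all add: frame_tangent orthonormal_subset)

lemma dim_subframe:
  assumes S: "S \<subseteq> B" shows "dim (subframe S p) = card S"
  using dim_span_eq_card_independent[OF independent_frame[OF S, of p]]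
    card_image[OF inj_on_frame[OF S], of p] span_subframe[OF S, of p] by simp

lemma orth_compl_subframe:
  assumes S: "S \<subseteq> B" shows "orth_compl A g (subframe S) = subframe (B - S)"
proof (intro ext set_eqI)
  fix p u
  show "u \<in> orth_compl A g (subframe S) p \<longleftrightarrow> u \<in> subframe (B - S) p"
  proof
    assume "u \<in> orth_compl A g (subframe S) p"
    then show "u \<in> subframe (B - S) p"
      using frame_in_subframe[OF S] by (auto simp: orth_compl_def subframe_def)
  next
    assume u: "u \<in> subframe (B - S) p"
    then have t: "u \<in> tangent_space A p" by (simp add: subframe_def)
    have "g p u v = 0" if "v \<in> subframe S p" for v
    proof -
      have "g p u v = g p v u" using that t by (intro g_sym) (auto simp: subframe_def)
      also have "\<dots> = (\<Sum>b\<in>S. g p v (\<iota> b p) * g p u (\<iota> b p))"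
        by (rule g_subframe[OF that t S])
      finally show ?thesis using u S by (simp add: subframe_def subset_iff)
    qed
    then show "u \<in> orth_compl A g (subframe S) p"
      using t by (simp add: orth_compl_def)
  qed
qed

text \<open>\<open>orth_proj\<close> is a definite description, so the explicit sum must also be
  shown to be the only candidate; this is done by comparing frame components.\<close>

lemma orth_proj_subframe:
  assumes S: "S \<subseteq> B" and U: "U p \<in> tangent_space A p"
  shows "orth_proj g (subframe S) U p = (\<Sum>b\<in>S. g p (U p) (\<iota> b p) *\<^sub>R \<iota> b p)"
  unfolding orth_proj_def
proof (rule the_equality)
  let ?w = "\<Sum>b\<in>S. g p (U p) (\<iota> b p) *\<^sub>R \<iota> b p"
  have fin: "finite S" using S finite_B finite_subset by blast
  have wS: "?w \<in> subframe S p"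
    unfolding span_subframe[OF S, symmetric] by (intro span_sum span_scale span_base) auto
  then have wt: "?w \<in> tangent_space A p" by (simp add: subframe_def)
  have gw: "g p ?w (\<iota> b p) = g p (U p) (\<iota> b p)" if "b \<in> S" for b
  proof -
    have "g p ?w (\<iota> b p) = (\<Sum>a\<in>S. g p (U p) (\<iota> a p) * g p (\<iota> a p) (\<iota> b p))"
      by (simp add: g_sum fin tangent_scaleR frame_tangent g_scaleR)
    also have "\<dots> = (\<Sum>a\<in>S. if a = b then g p (U p) (\<iota> a p) else 0)"
      using that by (intro sum.cong refl) (simp add: orthonormal_subset[OF S])
    finally show ?thesis using fin that by simp
  qed
  show "?w \<in> subframe S p \<and> (\<forall>v\<in>subframe S p. g p (U p - ?w) v = 0)"
  proof (intro conjI ballI wS)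
    fix v assume v: "v \<in> subframe S p"
    then have vt: "v \<in> tangent_space A p" by (simp add: subframe_def)
    have "g p (U p - ?w) v = g p v (U p - ?w)" by (intro g_sym tangent_diff U wt vt)
    also have "\<dots> = (\<Sum>b\<in>S. g p v (\<iota> b p) * g p (U p - ?w) (\<iota> b p))"
      by (intro g_subframe v tangent_diff U wt S)
    also have "\<dots> = 0"
      using gw by (intro sum.neutral) (simp add: g_diff U wt frame_tangent)
    finally show "g p (U p - ?w) v = 0" .
  qed
  fix w assume w: "w \<in> subframe S p \<and> (\<forall>v\<in>subframe S p. g p (U p - w) v = 0)"
  then have t: "w \<in> tangent_space A p" by (simp add: subframe_def)
  show "w = ?w"
  proof (rule tangent_eqI[OF t wt])
    fix b assume b: "b \<in> B"
    show "g p w (\<iota> b p) = g p ?w (\<iota> b p)"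
    proof (cases "b \<in> S")
      case True
      then have "g p (U p - w) (\<iota> b p) = 0" using w frame_in_subframe[OF S] by blast
      then show ?thesis using gw[OF True] by (simp add: g_diff U t frame_tangent)
    next
      case False
      then show ?thesis using b w wS by (auto simp: subframe_def)
    qed
  qed
qed

lemma orthonormal_at_exists:
  assumes S: "S \<subseteq> B" shows "\<exists>E. orthonormal_at A g (subframe S) p E"
proof -
  have "finite S" using S finite_B finite_subset by blast
  then obtain h where h: "bij_betw h {..<card S} S"
    using ex_bij_betw_nat_finite[of S] by (auto simp: atLeast0LessThan)
  have "orthonormal_at A g (subframe S) p (\<lambda>i. \<iota> (h i))"
    unfolding orthonormal_at_def dim_subframe[OF S]
  proof (intro conjI allI impI)
    fix i assume "i < card S"
    then have i: "h i \<in> S" using h by (auto dest: bij_betwE)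
    show "\<iota> (h i) \<in> sections A (subframe S)"
      using frame_in_subframe[OF S i] by (simp add: sections_def vf_frame)
    fix j assume "j < card S"
    then have "h j \<in> S" "h i = h j \<longleftrightarrow> i = j"
      using h \<open>i < card S\<close> by (auto dest: bij_betwE simp: bij_betw_def inj_on_eq_iff)
    then show "g p (\<iota> (h i) p) (\<iota> (h j) p) = (if i = j then 1 else 0)"
      using i orthonormal_subset[OF S] by simp
  next
    have "(\<lambda>i. \<iota> (h i) p) ` {..<card S} = (\<lambda>b. \<iota> b p) ` S"
      using image_image[of "\<lambda>b. \<iota> b p" h "{..<card S}"] bij_betw_imp_surj_on[OF h] by simp
    then show "span ((\<lambda>i. \<iota> (h i) p) ` {..<card S}) = subframe S p"
      using span_subframe[OF S] by simp
  qed
  then show ?thesis by blast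
qed

text \<open>The frame in \<open>metric_trace\<close> is an arbitrary choice. All that is known of it
  is what \<open>orthonormal_at\<close> says at the point p, and traces have to be evaluated from
  that alone.\<close>

lemma metric_trace_subframe:
  assumes S: "S \<subseteq> B"
  obtains E where "orthonormal_at A g (subframe S) p E"
    "metric_trace A g (subframe S) T p = (\<Sum>i<card S. T (E i) (E i) p)"
  using that someI_ex[OF orthonormal_at_exists[OF S]]
  by (auto simp: metric_trace_def Let_def dim_subframe[OF S])

text \<open>Used with \<open>v\<close> a vector of the known frame: it sums the squared components
  of \<open>v\<close> over the unknown chosen frame, and thereby removes the choice from the
  trace.\<close>

lemma parseval:
  assumes E: "orthonormal_at A g (subframe B) p E" and v: "v \<in> tangent_space A p"
  shows "(\<Sum>i<card B. (g p (E i p) v)\<^sup>2) = g p v v"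
proof -
  have Et: "E i p \<in> tangent_space A p" if "i < card B" for i
    using E that dim_subframe[OF order_refl] by (simp add: orthonormal_at_def sections_def subframe_B)
  have Eo: "g p (E i p) (E j p) = (if i = j then 1 else 0)" if "i < card B" "j < card B" for i j
    using E that dim_subframe[OF order_refl] by (simp add: orthonormal_at_def)
  have "v \<in> span ((\<lambda>i. E i p) ` {..<card B})"
    using E v dim_subframe[OF order_refl] by (simp add: orthonormal_at_def subframe_B)
  then obtain u where u: "v = (\<Sum>w\<in>(\<lambda>i. E i p) ` {..<card B}. u w *\<^sub>R w)"
    by (auto simp: span_finite)
  have inj: "inj_on (\<lambda>i. E i p) {..<card B}"
  proof (rule inj_onI)
    fix i j assume "i \<in> {..<card B}" "j \<in> {..<card B}" "E i p = E j p"
    then show "i = j" using Eo[of i j] Eo[of i i] by (auto split: if_splits)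
  qed
  define c where "c i = u (E i p)" for i
  have c: "v = (\<Sum>i<card B. c i *\<^sub>R E i p)"
    unfolding u sum.reindex[OF inj] by (simp add: c_def)
  have "g p (E i p) v = c i" if "i < card B" for i
  proof -
    have "g p v (E i p) = (\<Sum>j<card B. g p (c j *\<^sub>R E j p) (E i p))"
      unfolding c by (rule g_sum) (auto intro: tangent_scaleR Et that)
    also have "\<dots> = (\<Sum>j<card B. c j * g p (E j p) (E i p))"
      by (intro sum.cong refl g_scaleR Et that) simp
    also have "\<dots> = (\<Sum>j<card B. if j = i then c j else 0)"
      using Eo that by (intro sum.cong refl) auto
    finally show ?thesis using that g_sym[OF v Et] by simp
  qed
  moreover have "g p v v = (\<Sum>j<card B. c j * g p (E j p) v)"
  proof -
    have "g p v v = (\<Sum>j<card B. g p (c j *\<^sub>R E j p) v)"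
      by (subst (1) c) (rule g_sum, auto intro: tangent_scaleR Et v)
    also have "\<dots> = (\<Sum>j<card B. c j * g p (E j p) v)"
      by (intro sum.cong refl g_scaleR Et v) simp
    finally show ?thesis .
  qed
  ultimately show ?thesis by (simp add: power2_eq_square)
qed

text \<open>For an operator that is diagonal in the known frame, the trace over the chosen frame is
  a double sum of eigenvalues times squared components. Summing over the chosen frame first leaves
  the sum of the eigenvalues.\<close>

lemma ricci_diagonal:
  assumes V: "vector_field A V" "vector_field A W"
    and R: "\<And>b. b \<in> B \<Longrightarrow> curvature A nabla (\<iota> b) V W = \<rho> b *\<^sub>R \<iota> b"
  shows "ricci A g nabla V W p = (\<Sum>b\<in>B. \<rho> b)"
proof -
  obtain E where E: "orthonormal_at A g (subframe B) p E"
    and r: "ricci A g nabla V W p = (\<Sum>i<card B. g p (curvature A nabla (E i) V W p) (E i p))"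
    unfolding ricci_def subframe_B[symmetric]
    by (rule metric_trace_subframe[OF order_refl, of p "\<lambda>E F p. g p (curvature A nabla E V W p) (F p)"])
  have "g p (curvature A nabla (E i) V W p) (E i p) = (\<Sum>b\<in>B. \<rho> b * (g p (E i p) (\<iota> b p))\<^sup>2)"
    if "i < card B" for i
  proof -
    have Ei: "vector_field A (E i)"
      using E that dim_subframe[OF order_refl] by (simp add: orthonormal_at_def sections_def)
    have "curvature A nabla (E i) V W = (\<Sum>b\<in>B. fun_times (\<lambda>p. g p (E i p) (\<iota> b p)) (curvature A nabla (\<iota> b) V W))"
      by (rule tensor_expand[of "\<lambda>U. curvature A nabla U V W"])
        (simp_all add: curvature_add_left curvature_fun_left V Ei)
    then have "curvature A nabla (E i) V W p = (\<Sum>b\<in>B. (g p (E i p) (\<iota> b p) * \<rho> b) *\<^sub>R \<iota> b p)"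
      by (simp add: sum_fun_apply fun_times_apply R cong: sum.cong)
    moreover have "g p (\<Sum>b\<in>B. (g p (E i p) (\<iota> b p) * \<rho> b) *\<^sub>R \<iota> b p) (E i p)
        = (\<Sum>b\<in>B. g p (E i p) (\<iota> b p) * \<rho> b * g p (\<iota> b p) (E i p))"
      using vector_field_tangent[OF Ei]
      by (simp add: g_sum finite_B tangent_scaleR frame_tangent g_scaleR)
    moreover have "g p (\<iota> b p) (E i p) = g p (E i p) (\<iota> b p)" for b
      by (intro g_sym frame_tangent vector_field_tangent Ei)
    ultimately show ?thesis by (simp add: power2_eq_square algebra_simps)
  qed
  then have "ricci A g nabla V W p = (\<Sum>i<card B. \<Sum>b\<in>B. \<rho> b * (g p (E i p) (\<iota> b p))\<^sup>2)"
    unfolding r by (intro sum.cong refl) simp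
  also have "\<dots> = (\<Sum>b\<in>B. \<rho> b * (\<Sum>i<card B. (g p (E i p) (\<iota> b p))\<^sup>2))"
    by (subst sum.swap) (simp add: sum_distrib_left)
  also have "\<dots> = (\<Sum>b\<in>B. \<rho> b)"
    using parseval[OF E frame_tangent] orthonormal by (intro sum.cong refl) simp
  finally show ?thesis .
qed

subsection \<open>Local submersions defined by closed forms\<close>

definition coord_frame :: "('a, 'e) chart \<Rightarrow> 'g \<Rightarrow> 'e \<Rightarrow> 'e"
  where "coord_frame C u x = coords C (\<iota> u (chart_inv C x))"

lemma linear_coord_frame: "linear (\<lambda>u. coord_frame C u x)"
  by (rule linearI) (simp_all add: coord_frame_def frame_add frame_scaleR linear_add[OF linear_coords] linear_cmul[OF linear_coords])

lemma bij_coord_frame: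
  assumes C: "C \<in> A" and x: "x \<in> snd C ` fst C" shows "bij (\<lambda>u. coord_frame C u x)"
proof (rule bijI)
  let ?p = "chart_inv C x"
  have p: "?p \<in> fst C" using chart_inv_in[OF x] .
  show "inj (\<lambda>u. coord_frame C u x)"
  proof (rule injI)
    fix u v assume "coord_frame C u x = coord_frame C v x"
    then have "\<iota> u ?p = \<iota> v ?p"
      using chart_tvec_coords[OF C p frame_tangent] unfolding coord_frame_def by metis
    then show "u = v" using inj_frame[of ?p] by (simp add: inj_on_def)
  qed
  show "surj (\<lambda>u. coord_frame C u x)"
  proof (rule surjI)
    fix w
    have "chart_tvec A C ?p w \<in> tangent_space A ?p" using tangent_space_chart[OF C p] by blast
    then have "\<exists>u. \<iota> u ?p = chart_tvec A C ?p w" using tangent_frame[of ?p] by (metis rangeE)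
    then show "coord_frame C (SOME u. \<iota> u ?p = chart_tvec A C ?p w) x = w"
      unfolding coord_frame_def by (rule someI2_ex) (simp add: coords_chart_tvec[OF C p])
  qed
qed

lemma smooth_coord_frame: "C \<in> A \<Longrightarrow> smooth_on (snd C ` fst C) (coord_frame C u)"
  using coords_vector_field_smooth[OF _ vf_frame] by (simp add: coord_frame_def[abs_def])

lemma coords_inner: "b \<in> Basis \<Longrightarrow> coords C v \<bullet> b = v (\<lambda>q. snd C q \<bullet> b)"
  by (simp add: coords_def)

text \<open>Both sides are tested on coordinate functions. A field applied to a coordinate function
  is its own component, so applying a second field just differentiates that component and the
  commutator takes its usual coordinate form.\<close>

lemma coord_frame_bracket:
  assumes C: "C \<in> A" and x: "x \<in> snd C ` fst C"
  shows "frechet_derivative (coord_frame C v) (at x) (coord_frame C u x)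
    - frechet_derivative (coord_frame C u) (at x) (coord_frame C v x) = coord_frame C (br u v) x"
proof (rule euclidean_eqI)
  fix b :: 'e assume b: "b \<in> Basis"
  let ?p = "chart_inv C x" and ?x = "\<lambda>q. snd C q \<bullet> b"
  have p: "?p \<in> fst C" and px: "snd C ?p = x" using chart_inv_in[OF x] chart_chart_inv[OF x] .
  have oS: "open (snd C ` fst C)" using chart[OF C] by (simp add: is_chart_def)
  have sx: "smooth_fun A (fst C) ?x"
    by (rule smooth_fun_linear[OF bounded_linear_inner_left open_chart[OF C] smooth_fun_chart[OF C]])
  have second: "\<iota> u ?p (\<lambda>q. \<iota> v q ?x) = frechet_derivative (coord_frame C v) (at x) (coord_frame C u x) \<bullet> b"
    for u v
  proof -
    have near: "smooth_near A ?p (\<lambda>q. \<iota> v q ?x)"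
      by (rule smooth_nearI[OF open_chart[OF C] p vector_field_smooth[OF vf_frame open_chart[OF C] sx]])
    have "((\<lambda>x. coord_frame C v x \<bullet> b) has_derivative (\<lambda>w. frechet_derivative (coord_frame C v) (at x) w \<bullet> b)) (at x)"
      by (rule has_derivative_inner_left[OF smooth_on_has_derivative[OF smooth_coord_frame[OF C] x]])
    moreover have "(\<lambda>x. coord_frame C v x \<bullet> b) = (\<lambda>q. \<iota> v q ?x) \<circ> chart_inv C"
      by (simp add: fun_eq_iff coord_frame_def coords_inner[OF b])
    ultimately have "((\<lambda>q. \<iota> v q ?x) \<circ> chart_inv C has_derivative (\<lambda>w. frechet_derivative (coord_frame C v) (at x) w \<bullet> b)) (at x)"
      by (simp only:)
    from fun_cong[OF frechet_derivative_at[OF this], of "coord_frame C u x"]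
    show ?thesis
      using tangent_apply[OF C p frame_tangent near, of u] by (simp add: px coord_frame_def)
  qed
  have "\<iota> (br u v) ?p ?x = \<iota> u ?p (\<lambda>q. \<iota> v q ?x) - \<iota> v ?p (\<lambda>q. \<iota> u q ?x)"
    unfolding bracket_frame[symmetric] lie_bracket_def
    using smooth_near_coordinate[OF C p] by simp
  then show "(frechet_derivative (coord_frame C v) (at x) (coord_frame C u x)
    - frechet_derivative (coord_frame C u) (at x) (coord_frame C v x)) \<bullet> b = coord_frame C (br u v) x \<bullet> b"
    unfolding second inner_diff_left by (simp add: coord_frame_def coords_inner[OF b])
qed

text \<open>Two uses of the Poincare lemma: the first gives \<open>t\<close> with differential
  \<zeta>, and \<open>t\<close> supplies the integrating factor for the second. That factor is
  recorded only as an unspecified nonzero \<open>m\<close>.\<close>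

lemma local_complex_function:
  fixes \<zeta> :: "'g \<Rightarrow> real" and \<kappa> :: "'g \<Rightarrow> complex"
  assumes C: "C \<in> A" and S: "open S" "convex S" "S \<subseteq> snd C ` fst C"
    and lin: "linear \<zeta>" "linear \<kappa>"
    and \<zeta>: "\<And>u v. \<zeta> (br u v) = 0"
    and \<kappa>: "\<And>u v. \<kappa> (br u v) = c * (of_real (\<zeta> u) * \<kappa> v - of_real (\<zeta> v) * \<kappa> u)"
  obtains \<phi> where "smooth_on S \<phi>"
    "\<And>x. x \<in> S \<Longrightarrow> \<exists>m. m \<noteq> 0 \<and> (\<forall>u. frechet_derivative \<phi> (at x) (coord_frame C u x) = m * \<kappa> u)"
proof -
  have inS: "x \<in> snd C ` fst C" if "x \<in> S" for x using S(3) that by blast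
  note prim = primitive_in_frame[OF S(1,2) finite_B independent_B span_B linear_coord_frame
      bij_coord_frame[OF C inS] smooth_on_subset[OF smooth_coord_frame[OF C] S(3)] _ _ coord_frame_bracket[OF C inS]]
  obtain t where t: "smooth_on S t" and Dt: "\<And>x u. x \<in> S \<Longrightarrow> frechet_derivative t (at x) (coord_frame C u x) = \<zeta> u"
    using prim[of "\<lambda>u x. \<zeta> u"] lin(1) S(1) \<zeta> by (auto simp: smooth_on_const)
  define a where "a u x = \<kappa> u * exp (t x *\<^sub>R c)" for u x
  have lina: "linear (\<lambda>u. a u x)" for x
    unfolding a_def by (rule linearI) (simp_all add: linear_add[OF lin(2)] linear_cmul[OF lin(2)] algebra_simps)
  have sma: "smooth_on S (a u)" for u
    unfolding a_def by (rule smooth_on_compose[OF S(1) open_UNIV _ t smooth_on_exp_scaleR]) simp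
  have Da: "frechet_derivative (a u) (at x) w = (frechet_derivative t (at x) w *\<^sub>R c) * a u x" if x: "x \<in> S" for x u w
  proof -
    have "((\<lambda>x. exp (t x *\<^sub>R c)) has_derivative (\<lambda>w. frechet_derivative t (at x) w *\<^sub>R (exp (t x *\<^sub>R c) * c))) (at x)"
      using has_derivative_compose[OF smooth_on_has_derivative[OF t x],
          OF exp_scaleR_has_vector_derivative_right[of c "t x" UNIV, unfolded has_vector_derivative_def]] by simp
    from has_derivative_mult_right[OF this, of "\<kappa> u"]
    have "(a u has_derivative (\<lambda>w. \<kappa> u * (frechet_derivative t (at x) w *\<^sub>R (exp (t x *\<^sub>R c) * c)))) (at x)"
      by (simp add: a_def[abs_def])
    from fun_cong[OF frechet_derivative_at[OF this, symmetric], of w] show ?thesis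
      by (simp add: a_def mult_ac)
  qed
  \<comment> \<open>The product rule gives exp (t c) times c (\<zeta>(u) \<kappa>(v) - \<zeta>(v)
    \<kappa>(u)), and the hypothesis on \<kappa> recognises this as the value on the
    bracket.\<close>
  have closed: "frechet_derivative (a v) (at x) (coord_frame C u x) - frechet_derivative (a u) (at x) (coord_frame C v x)
      = a (br u v) x" if "x \<in> S" for x u v
    unfolding Da[OF that] Dt[OF that] by (simp add: a_def \<kappa> scaleR_conv_of_real algebra_simps)
  obtain \<phi> where "smooth_on S \<phi>"
    and D: "\<And>x u. x \<in> S \<Longrightarrow> frechet_derivative \<phi> (at x) (coord_frame C u x) = a u x"
    using prim[OF _ lina sma _ closed] by blast
  moreover have "\<exists>m. m \<noteq> 0 \<and> (\<forall>u. frechet_derivative \<phi> (at x) (coord_frame C u x) = m * \<kappa> u)" if "x \<in> S" for x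
    by (rule exI[of _ "exp (t x *\<^sub>R c)"]) (simp add: D[OF that] a_def)
  ultimately show ?thesis using that by blast
qed

lemma smooth_fun_compose_chart:
  assumes C: "C \<in> A" and V: "open V" and f: "smooth_on V f"
  shows "smooth_fun A (fst C \<inter> snd C -` V) (f \<circ> snd C)"
proof (rule smooth_fun_chartI[OF C])
  let ?U = "fst C \<inter> snd C -` V"
  show U: "open ?U" using open_chart_preimage[OF chart[OF C] V] .
  have oU: "open (snd C ` ?U)" using open_chart_image[OF chart[OF C] U] by (simp add: Int_absorb2 Int_ac)
  have UV: "snd C ` ?U \<subseteq> V" by auto
  have inv: "snd C (chart_inv C x) = x" if "x \<in> snd C ` ?U" for x
    using chart_chart_inv[of x C] that by blast
  show "smooth_on (snd C ` ?U) (f \<circ> snd C \<circ> chart_inv C)"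
    by (rule smooth_on_cong[OF oU smooth_on_subset[OF f UV]]) (simp only: o_apply inv)
qed simp

text \<open>Tangent vectors act on real functions, so the derivative is computed through an
  arbitrary bounded real functional, which is then taken to be \<open>Re\<close> and
  \<open>Im\<close>.\<close>

lemma complex_diff_in_chart:
  fixes f :: "'e \<Rightarrow> complex"
  assumes C: "C \<in> A" and V: "open V" "V \<subseteq> snd C ` fst C" and f: "smooth_on V f"
    and q: "q \<in> fst C" "snd C q \<in> V" and v: "v \<in> tangent_space A q"
  shows "smooth_near A q (Re \<circ> (f \<circ> snd C))" "smooth_near A q (Im \<circ> (f \<circ> snd C))"
    and "complex_diff (f \<circ> snd C) v = frechet_derivative f (at (snd C q)) (coords C v)"
proof -
  let ?U = "fst C \<inter> snd C -` V"
  have U: "open ?U" using open_chart_preimage[OF chart[OF C] V(1)] .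
  have oU: "open (snd C ` ?U)" using open_chart_image[OF chart[OF C] U] by (simp add: Int_absorb2 Int_ac)
  have inv: "snd C (chart_inv C x) = x" if "x \<in> snd C ` ?U" for x
    using chart_chart_inv[of x C] that by blast
  have sm: "smooth_fun A ?U (f \<circ> snd C)"
    by (rule smooth_fun_compose_chart[OF C V(1) f])
  have L: "smooth_near A q (\<lambda>q. L ((f \<circ> snd C) q))
      \<and> v (\<lambda>q. L ((f \<circ> snd C) q)) = L (frechet_derivative f (at (snd C q)) (coords C v))"
    if L: "bounded_linear L" for L :: "complex \<Rightarrow> real"
  proof
    show near: "smooth_near A q (\<lambda>q. L ((f \<circ> snd C) q))"
      by (rule smooth_nearI[OF U _ smooth_fun_linear[OF L U sm]]) (use q in simp)
    have "((\<lambda>x. L (f x)) has_derivative (\<lambda>w. L (frechet_derivative f (at (snd C q)) w))) (at (snd C q))"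
      by (rule bounded_linear.has_derivative[OF L smooth_on_has_derivative[OF f q(2)]])
    then have "((\<lambda>q. L ((f \<circ> snd C) q)) \<circ> chart_inv C has_derivative (\<lambda>w. L (frechet_derivative f (at (snd C q)) w))) (at (snd C q))"
    proof (rule has_derivative_transform_within_open[OF _ oU])
      show "snd C q \<in> snd C ` ?U" using q by blast
      show "L (f x) = ((\<lambda>q. L ((f \<circ> snd C) q)) \<circ> chart_inv C) x" if "x \<in> snd C ` ?U" for x
        by (simp only: o_apply inv[OF that])
    qed
    from fun_cong[OF frechet_derivative_at[OF this], of "coords C v"]
    show "v (\<lambda>q. L ((f \<circ> snd C) q)) = L (frechet_derivative f (at (snd C q)) (coords C v))"
      using tangent_apply[OF C q(1) v near] by simp
  qed
  from L[OF bounded_linear_Re] L[OF bounded_linear_Im]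
  show "smooth_near A q (Re \<circ> (f \<circ> snd C))" "smooth_near A q (Im \<circ> (f \<circ> snd C))"
    "complex_diff (f \<circ> snd C) v = frechet_derivative f (at (snd C q)) (coords C v)"
    by (simp_all add: complex_diff_def comp_def)
qed

text \<open>A point of the fibre is reached by pulling \<open>path\<close> back to the manifold: the
  function is constant along the curve, so its velocity lies in the kernel. Conversely the
  derivative of the function along a curve tangent to \<open>D\<close> vanishes, so the function is
  constant.\<close>

lemma fibres_eq_leaves:
  fixes f :: "'e \<Rightarrow> complex"
  assumes C: "C \<in> A" and V: "open V" "V \<subseteq> snd C ` fst C" and f: "smooth_on V f"
    and D: "\<And>q. q \<in> fst C \<Longrightarrow> snd C q \<in> V \<Longrightarrow> D q = {v \<in> tangent_space A q. complex_diff (f \<circ> snd C) v = 0}"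
    and path: "\<forall>a\<in>V. \<forall>b\<in>V. f a = f b \<longrightarrow>
       (\<exists>\<gamma> \<gamma>'. \<gamma> 0 = a \<and> \<gamma> 1 = b \<and>
         (\<forall>t\<in>{0..1}. \<gamma> t \<in> V \<and> f (\<gamma> t) = f a \<and> (\<gamma> has_vector_derivative \<gamma>' t) (at t)))"
    and U: "U = fst C \<inter> snd C -` V" and q: "q \<in> U"
  shows "{x \<in> U. (f \<circ> snd C) x = (f \<circ> snd C) q} = leaf A D U q"
proof (intro equalityI subsetI)
  fix x assume "x \<in> {x \<in> U. (f \<circ> snd C) x = (f \<circ> snd C) q}"
  then have x: "x \<in> fst C" "snd C x \<in> V" "f (snd C q) = f (snd C x)" by (auto simp: U)
  have q': "q \<in> fst C" "snd C q \<in> V" using q by (auto simp: U)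
  from path[rule_format, OF q'(2) x(2,3)] obtain \<gamma> \<gamma>' where \<gamma>: "\<gamma> 0 = snd C q" "\<gamma> 1 = snd C x"
    and \<gamma>t: "\<And>t::real. t \<in> {0..1} \<Longrightarrow> \<gamma> t \<in> V" "\<And>t::real. t \<in> {0..1} \<Longrightarrow> f (\<gamma> t) = f (snd C q)"
      "\<And>t::real. t \<in> {0..1} \<Longrightarrow> (\<gamma> has_vector_derivative \<gamma>' t) (at t)" by metis
  define c where "c t = chart_inv C (\<gamma> t)" for t
  have cC: "c t \<in> fst C" "snd C (c t) = \<gamma> t" if "t \<in> {0..1}" for t
    unfolding c_def using \<gamma>t(1)[OF that] V(2) chart_inv_in[of "\<gamma> t" C] chart_chart_inv[of "\<gamma> t" C] by blast+
  have "\<exists>v\<in>D (c t). \<forall>h. smooth_near A (c t) h \<longrightarrow> ((h \<circ> c) has_real_derivative v h) (at t within {0..1})"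
    if t: "t \<in> {0..1}" for t
  proof
    let ?v = "chart_tvec A C (c t) (\<gamma>' t)"
    have vt: "?v \<in> tangent_space A (c t)" using tangent_space_chart[OF C cC(1)[OF t]] by blast
    have "(f \<circ> \<gamma> has_vector_derivative frechet_derivative f (at (\<gamma> t)) (\<gamma>' t)) (at t)"
      using vector_derivative_diff_chain_within[of \<gamma> "\<gamma>' t" t UNIV f "frechet_derivative f (at (\<gamma> t))"]
        \<gamma>t(3)[OF t] has_derivative_at_withinI[OF smooth_on_has_derivative[OF f \<gamma>t(1)[OF t]]] by simp
    then have "(f \<circ> \<gamma> has_vector_derivative frechet_derivative f (at (\<gamma> t)) (\<gamma>' t)) (at t within {0..1})"
      by (rule has_vector_derivative_at_within)
    moreover have "(f \<circ> \<gamma> has_vector_derivative 0) (at t within {0..1})"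
      by (rule has_vector_derivative_transform[OF t _ has_vector_derivative_const[of "f (snd C q)"]])
        (use \<gamma>t(2) in simp)
    \<comment> \<open>Constancy of \<open>f\<close> on the curve is known only inside the unit
      interval, hence derivatives are compared within it; they are unique there even at the end
      points.\<close>
    ultimately have "frechet_derivative f (at (\<gamma> t)) (\<gamma>' t) = 0"
      using t by (intro vector_derivative_unique_within_closed_interval[of 0 1 t "f \<circ> \<gamma>"]) auto
    then have "complex_diff (f \<circ> snd C) ?v = 0"
      using complex_diff_in_chart(3)[OF C V f cC(1)[OF t] _ vt] cC[OF t] \<gamma>t(1)[OF t]
      by (simp add: coords_chart_tvec[OF C])
    then show "?v \<in> D (c t)"
      using D[OF cC(1)[OF t]] cC(2)[OF t] \<gamma>t(1)[OF t] vt by simp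
    show "\<forall>h. smooth_near A (c t) h \<longrightarrow> ((h \<circ> c) has_real_derivative ?v h) (at t within {0..1})"
    proof (intro allI impI)
      fix h :: "'a \<Rightarrow> real" assume h: "smooth_near A (c t) h"
      have "(h \<circ> chart_inv C has_derivative frechet_derivative (h \<circ> chart_inv C) (at (\<gamma> t))) (at (\<gamma> t))"
        using smooth_near_has_derivative[OF h C cC(1)[OF t]] cC(2)[OF t] by simp
      from vector_derivative_diff_chain_within[of \<gamma> "\<gamma>' t" t UNIV, OF _ has_derivative_at_withinI[OF this]]
      have "(h \<circ> chart_inv C \<circ> \<gamma> has_vector_derivative frechet_derivative (h \<circ> chart_inv C) (at (\<gamma> t)) (\<gamma>' t)) (at t)"
        using \<gamma>t(3)[OF t] by simp
      moreover have "frechet_derivative (h \<circ> chart_inv C) (at (\<gamma> t)) (\<gamma>' t) = ?v h"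
        using h cC(2)[OF t] by (simp add: chart_tvec_def)
      moreover have "h \<circ> chart_inv C \<circ> \<gamma> = h \<circ> c" by (simp add: fun_eq_iff c_def)
      ultimately show "((h \<circ> c) has_real_derivative ?v h) (at t within {0..1})"
        by (simp add: has_real_derivative_iff_has_vector_derivative has_vector_derivative_at_within)
    qed
  qed
  moreover have "continuous_on {0..1} c"
    unfolding c_def
  proof (rule continuous_on_compose2[where g = "chart_inv C" and f = \<gamma>])
    show "continuous_on (snd C ` fst C) (chart_inv C)"
      using chart[OF C] by (simp add: is_chart_def homeomorphism_def)
    show "continuous_on {0..1} \<gamma>"
      using \<gamma>t(3) has_vector_derivative_continuous by (intro continuous_at_imp_continuous_on ballI) blast
    show "\<gamma> ` {0..1} \<subseteq> snd C ` fst C" using \<gamma>t(1) V(2) by blast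
  qed
  moreover have "c ` {0..1} \<subseteq> U"
    using cC \<gamma>t(1) by (auto simp: U)
  moreover have "c 0 = q" "c 1 = x"
    using chart_inv_chart[OF chart[OF C]] q' x \<gamma> by (simp_all add: c_def)
  ultimately show "x \<in> leaf A D U q"
    unfolding leaf_def by blast
next
  fix x assume "x \<in> leaf A D U q"
  then obtain c :: "real \<Rightarrow> 'a" where c: "c 0 = q" "c 1 = x" "c ` {0..1} \<subseteq> U"
    and ct: "\<And>t. t \<in> {0..1} \<Longrightarrow> \<exists>v\<in>D (c t). \<forall>h. smooth_near A (c t) h \<longrightarrow>
          ((h \<circ> c) has_real_derivative v h) (at t within {0..1})"
    unfolding leaf_def by blast
  have cU: "c t \<in> fst C" "snd C (c t) \<in> V" if "t \<in> {0..1}" for t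
    using subsetD[OF c(3) imageI[OF that]] by (simp_all add: U)
  \<comment> \<open>\<open>leaf\<close> gives derivatives of real functions only, so real and
    imaginary parts are treated separately.\<close>
  have zero: "((Re \<circ> (f \<circ> snd C) \<circ> c) has_derivative (\<lambda>h. 0)) (at t within {0..1})
    \<and> ((Im \<circ> (f \<circ> snd C) \<circ> c) has_derivative (\<lambda>h. 0)) (at t within {0..1})" if t: "t \<in> {0..1}" for t
  proof -
    obtain v where "v \<in> D (c t)" and v': "\<And>h. smooth_near A (c t) h \<Longrightarrow>
          ((h \<circ> c) has_real_derivative v h) (at t within {0..1})"
      using ct[OF t] by blast
    then have v: "v \<in> tangent_space A (c t)" "complex_diff (f \<circ> snd C) v = 0"
      using D[OF cU[OF t]] by auto
    then have "v (Re \<circ> (f \<circ> snd C)) = 0" "v (Im \<circ> (f \<circ> snd C)) = 0"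
      by (simp_all add: complex_diff_def complex_eq_iff)
    with v'[OF complex_diff_in_chart(1)[OF C V f cU[OF t] v(1)]] v'[OF complex_diff_in_chart(2)[OF C V f cU[OF t] v(1)]]
    show ?thesis by (simp add: has_field_derivative_def lambda_zero)
  qed
  have "\<exists>k. \<forall>t\<in>{0..1}. (Re \<circ> (f \<circ> snd C) \<circ> c) t = k" "\<exists>k. \<forall>t\<in>{0..1}. (Im \<circ> (f \<circ> snd C) \<circ> c) t = k"
    by (rule has_derivative_zero_constant[OF convex_real_interval(5)], use zero in blast)+
  then have "Re (f (snd C (c 1))) = Re (f (snd C (c 0)))" "Im (f (snd C (c 1))) = Im (f (snd C (c 0)))"
    by fastforce+
  then have "f (snd C x) = f (snd C q)" by (simp add: c complex_eq_iff)
  moreover have "c 1 \<in> c ` {0..1}" by simp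
  ultimately show "x \<in> {x \<in> U. (f \<circ> snd C) x = (f \<circ> snd C) q}"
    using c by auto
qed

lemma local_complex_submersion:
  fixes \<zeta> :: "'g \<Rightarrow> real" and \<kappa> :: "'g \<Rightarrow> complex"
  assumes lin: "linear \<zeta>" "linear \<kappa>" and surj: "surj \<kappa>"
    and \<zeta>: "\<And>u v. \<zeta> (br u v) = 0"
    and \<kappa>: "\<And>u v. \<kappa> (br u v) = c * (of_real (\<zeta> u) * \<kappa> v - of_real (\<zeta> v) * \<kappa> u)"
    and D: "\<And>q. D q = {\<iota> u q | u. \<kappa> u = 0}"
  obtains U \<phi> where "open U" "p \<in> U" "smooth_fun A U \<phi>"
    "\<And>q. q \<in> U \<Longrightarrow> \<exists>m. m \<noteq> 0 \<and> (\<forall>u. complex_diff \<phi> (\<iota> u q) = m * \<kappa> u)"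
    "\<And>q. q \<in> U \<Longrightarrow> {x \<in> U. \<phi> x = \<phi> q} = leaf A D U q"
proof -
  obtain C where C: "C \<in> A" "p \<in> fst C" using chart_at .
  have "open (snd C ` fst C)" using chart[OF C(1)] by (simp add: is_chart_def)
  then obtain r where r: "r > 0" "ball (snd C p) r \<subseteq> snd C ` fst C"
    using C(2) open_contains_ball by blast
  let ?S = "ball (snd C p) r"
  obtain f where f: "smooth_on ?S f" and Df: "\<And>x. x \<in> ?S \<Longrightarrow>
      \<exists>m. m \<noteq> 0 \<and> (\<forall>u. frechet_derivative f (at x) (coord_frame C u x) = m * \<kappa> u)"
    using local_complex_function[OF C(1) open_ball convex_ball r(2) lin \<zeta> \<kappa>] by blast
  obtain m where m: "m \<noteq> 0" "\<And>u. frechet_derivative f (at (snd C p)) (coord_frame C u (snd C p)) = m * \<kappa> u"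
    using Df[of "snd C p"] r by auto
  have "surj (frechet_derivative f (at (snd C p)))"
  proof (rule surjI)
    fix z
    show "frechet_derivative f (at (snd C p)) (coord_frame C (inv \<kappa> (z / m)) (snd C p)) = z"
      unfolding m(2) using m(1) by (simp add: surj_f_inv_f[OF surj])
  qed
  \<comment> \<open>Points of a leaf are joined by curves inside the neighbourhood, so fibres can
    equal leaves only where fibres are connected; this is why the ball is replaced by the smaller
    \<open>V\<close>.\<close>
  from submersion_fibres_connected_locally[OF open_ball centre_in_ball[THEN iffD2, OF r(1)] f this]
  obtain V where V: "open V" "snd C p \<in> V" "V \<subseteq> ?S"
    and path: "\<forall>a\<in>V. \<forall>b\<in>V. f a = f b \<longrightarrow>
       (\<exists>\<gamma> \<gamma>'. \<gamma> 0 = a \<and> \<gamma> 1 = b \<and>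
         (\<forall>t\<in>{0..1}. \<gamma> t \<in> V \<and> f (\<gamma> t) = f a \<and> (\<gamma> has_vector_derivative \<gamma>' t) (at t)))"
    by blast
  have VC: "V \<subseteq> snd C ` fst C" using V r by blast
  have fV: "smooth_on V f" using smooth_on_subset[OF f V(3)] .
  define U where "U = fst C \<inter> snd C -` V"
  have oU: "open U" unfolding U_def by (rule open_chart_preimage[OF chart[OF C(1)] V(1)])
  have diff: "\<exists>m. m \<noteq> 0 \<and> (\<forall>u. complex_diff (f \<circ> snd C) (\<iota> u q) = m * \<kappa> u)" if "q \<in> U" for q
  proof -
    have q: "q \<in> fst C" "snd C q \<in> V" using that by (auto simp: U_def)
    have "chart_inv C (snd C q) = q" using chart_inv_chart[OF chart[OF C(1)] q(1)] .
    then have "complex_diff (f \<circ> snd C) (\<iota> u q) = frechet_derivative f (at (snd C q)) (coord_frame C u (snd C q))" for u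
      using complex_diff_in_chart(3)[OF C(1) V(1) VC fV q frame_tangent] by (simp add: coord_frame_def)
    then show ?thesis using Df[of "snd C q"] V(3) q by auto
  qed
  show ?thesis
  proof (rule that[OF oU _ _ diff])
    show "p \<in> U" using C V by (simp add: U_def)
    show "smooth_fun A U (f \<circ> snd C)"
      unfolding U_def by (rule smooth_fun_compose_chart[OF C(1) V(1) fV])
    have "D q = {v \<in> tangent_space A q. complex_diff (f \<circ> snd C) v = 0}" if "q \<in> fst C" "snd C q \<in> V" for q
      using diff[of q] that frame_tangent tangent_frame[of q] by (fastforce simp: D U_def)
    then show "{x \<in> U. (f \<circ> snd C) x = (f \<circ> snd C) q} = leaf A D U q" if "q \<in> U" for q
      by (rule fibres_eq_leaves[OF C(1) V(1) VC fV _ path U_def that])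
  qed
qed

end

section \<open>The four-dimensional Lie algebra\<close>

locale solvable_algebra =
  fixes br :: "'g::real_vector \<Rightarrow> 'g \<Rightarrow> 'g" and X Y Z W :: 'g and \<alpha> \<beta> \<theta> :: real
  assumes distinct_basis: "distinct [X, Y, Z, W]" and independent_basis: "independent {X, Y, Z, W}"
    and span_basis: "span {X, Y, Z, W} = UNIV"
    and bilinear: "bilinear br" and skew: "br u v = - br v u"
    and WZ: "br W Z = (- 2 * \<alpha>) *\<^sub>R W"
    and ZX: "br Z X = \<alpha> *\<^sub>R X + \<beta> *\<^sub>R Y"
    and ZY: "br Z Y = (- \<beta>) *\<^sub>R X + \<alpha> *\<^sub>R Y"
    and YX: "br Y X = \<theta> *\<^sub>R W"
    and WX: "br W X = 0" and WY: "br W Y = 0"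
begin

lemma br_self: "br u u = 0"
proof -
  have "2 *\<^sub>R br u u = 0"
    using skew[of u u] by (simp add: scaleR_2 eq_neg_iff_add_eq_0)
  then show ?thesis by simp
qed

lemma br_swapped:
  "br Z W = (2 * \<alpha>) *\<^sub>R W" "br X Z = (- \<alpha>) *\<^sub>R X + (- \<beta>) *\<^sub>R Y" "br Y Z = \<beta> *\<^sub>R X + (- \<alpha>) *\<^sub>R Y"
  "br X Y = (- \<theta>) *\<^sub>R W" "br X W = 0" "br Y W = 0"
  using skew[of Z W] skew[of X Z] skew[of Y Z] skew[of X Y] skew[of X W] skew[of Y W]
  by (simp_all add: WZ ZX ZY YX WX WY)

lemmas brs = br_self WZ ZX ZY YX WX WY br_swapped

lemmas br_simps = bilinear_ladd[OF bilinear] bilinear_radd[OF bilinear] bilinear_lmul[OF bilinear]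
  bilinear_rmul[OF bilinear] bilinear_lneg[OF bilinear] bilinear_rneg[OF bilinear]
  bilinear_lzero[OF bilinear] bilinear_rzero[OF bilinear] bilinear_lsub[OF bilinear] bilinear_rsub[OF bilinear]

definition jacobiator :: "'g \<Rightarrow> 'g \<Rightarrow> 'g \<Rightarrow> 'g"
  where "jacobiator u v w = br u (br v w) + br v (br w u) + br w (br u v)"

lemma jacobiator_linear:
  "linear (\<lambda>u. jacobiator u v w)" "linear (\<lambda>v. jacobiator u v w)" "linear (\<lambda>w. jacobiator u v w)"
  by (rule linearI; simp add: jacobiator_def br_simps scaleR_add_right)+

text \<open>The one identity with nonzero terms is that of \<open>X\<close>, \<open>Y\<close>,
  \<open>Z\<close>: ad \<open>Z\<close> has trace 2\<alpha> on the span of \<open>X\<close> and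
  \<open>Y\<close> and eigenvalue 2\<alpha> on \<open>W\<close>, so it is a derivation of the
  Heisenberg bracket of \<open>X\<close> and \<open>Y\<close>.\<close>

lemma jacobiator_basis:
  "\<forall>u\<in>{X, Y, Z, W}. \<forall>v\<in>{X, Y, Z, W}. \<forall>w\<in>{X, Y, Z, W}. jacobiator u v w = 0"
proof -
  have "(\<theta> * (2 * \<alpha>)) *\<^sub>R W = (\<alpha> * \<theta>) *\<^sub>R W + (\<alpha> * \<theta>) *\<^sub>R W"
    using scaleR_add_left[of "\<alpha> * \<theta>" "\<alpha> * \<theta>" W] by (simp add: mult_ac)
  then show ?thesis
    by (simp add: jacobiator_def brs br_simps)
qed

lemma lie_algebra: "lie_algebra br"
proof -
  have "jacobiator u v w = 0" for u v w
  proof -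
    have *: "w \<in> span {X, Y, Z, W}" for w using span_basis by simp
    have 1: "jacobiator u v w = 0" if "u \<in> {X, Y, Z, W}" "v \<in> {X, Y, Z, W}" for u v w
      by (rule linear_eq_0_on_span[OF jacobiator_linear(3) jacobiator_basis[rule_format, OF that] *])
    have 2: "jacobiator u v w = 0" if "u \<in> {X, Y, Z, W}" for u v w
      by (rule linear_eq_0_on_span[OF jacobiator_linear(2) 1[OF that] *])
    show ?thesis
      by (rule linear_eq_0_on_span[OF jacobiator_linear(1) 2 *])
  qed
  then show ?thesis
    by (simp add: lie_algebra_def bilinear br_self jacobiator_def)
qed

definition \<zeta> :: "'g \<Rightarrow> real"
  where "\<zeta> u = representation {X, Y, Z, W} u Z"

definition \<kappa> :: "'g \<Rightarrow> complex"
  where "\<kappa> u = Complex (representation {X, Y, Z, W} u X) (representation {X, Y, Z, W} u Y)"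

lemma linear_\<zeta>: "linear \<zeta>"
  by (rule linearI)
    (simp_all add: \<zeta>_def real_vector.representation_add[OF independent_basis]
      real_vector.representation_scale[OF independent_basis] span_basis)

lemma linear_\<kappa>: "linear \<kappa>"
  by (rule linearI)
    (simp_all add: \<kappa>_def real_vector.representation_add[OF independent_basis]
      real_vector.representation_scale[OF independent_basis] span_basis complex_eq_iff)

lemma \<zeta>_basis: "\<zeta> X = 0" "\<zeta> Y = 0" "\<zeta> Z = 1" "\<zeta> W = 0"
  using distinct_basis by (auto simp: \<zeta>_def real_vector.representation_basis[OF independent_basis])

lemma \<kappa>_basis: "\<kappa> X = 1" "\<kappa> Y = \<i>" "\<kappa> Z = 0" "\<kappa> W = 0"
  using distinct_basis by (auto simp: \<kappa>_def real_vector.representation_basis[OF independent_basis] complex_eq_iff)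

lemmas \<zeta>_simps = \<zeta>_basis linear_add[OF linear_\<zeta>] linear_cmul[OF linear_\<zeta>] linear_neg[OF linear_\<zeta>] linear_diff[OF linear_\<zeta>] linear_0[OF linear_\<zeta>]
lemmas \<kappa>_simps = \<kappa>_basis linear_add[OF linear_\<kappa>] linear_cmul[OF linear_\<kappa>] linear_neg[OF linear_\<kappa>] linear_diff[OF linear_\<kappa>] linear_0[OF linear_\<kappa>]

lemma \<zeta>_closed: "\<zeta> (br u v) = 0"
proof (rule bilinear_eq[of "\<lambda>u v. \<zeta> (br u v)" "\<lambda>u v. 0" UNIV "{X, Y, Z, W}" UNIV "{X, Y, Z, W}"])
  show "bilinear (\<lambda>u v. \<zeta> (br u v))"
    unfolding bilinear_def by (intro conjI allI linearI) (simp_all add: br_simps \<zeta>_simps)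
  show "bilinear (\<lambda>u v. 0)"
    unfolding bilinear_def by (intro conjI allI linearI) simp_all
  have "\<forall>u\<in>{X, Y, Z, W}. \<forall>v\<in>{X, Y, Z, W}. \<zeta> (br u v) = 0"
    by (simp add: brs \<zeta>_simps)
  then show "\<zeta> (br u v) = 0" if "u \<in> {X, Y, Z, W}" "v \<in> {X, Y, Z, W}" for u v
    using that by blast
qed (simp_all add: span_basis)

text \<open>Both sides are bilinear, so basis vectors suffice. Brackets with values in multiples of
  \<open>W\<close> are invisible to \<kappa>, and only the action of \<open>Z\<close> on
  \<open>X\<close> and \<open>Y\<close> remains.\<close>

lemma \<kappa>_bracket: "\<kappa> (br u v) = Complex \<alpha> \<beta> * (of_real (\<zeta> u) * \<kappa> v - of_real (\<zeta> v) * \<kappa> u)"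
proof (rule bilinear_eq[of "\<lambda>u v. \<kappa> (br u v)" "\<lambda>u v. Complex \<alpha> \<beta> * (of_real (\<zeta> u) * \<kappa> v - of_real (\<zeta> v) * \<kappa> u)"
      UNIV "{X, Y, Z, W}" UNIV "{X, Y, Z, W}"])
  show "bilinear (\<lambda>u v. \<kappa> (br u v))"
    unfolding bilinear_def by (intro conjI allI linearI) (simp_all add: br_simps \<kappa>_simps)
  show "bilinear (\<lambda>u v. Complex \<alpha> \<beta> * (of_real (\<zeta> u) * \<kappa> v - of_real (\<zeta> v) * \<kappa> u))"
    unfolding bilinear_def
    by (intro conjI allI linearI) (simp_all add: \<zeta>_simps \<kappa>_simps scaleR_conv_of_real algebra_simps)
  have "\<forall>u\<in>{X, Y, Z, W}. \<forall>v\<in>{X, Y, Z, W}.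
      \<kappa> (br u v) = Complex \<alpha> \<beta> * (of_real (\<zeta> u) * \<kappa> v - of_real (\<zeta> v) * \<kappa> u)"
    by (simp add: brs \<zeta>_simps \<kappa>_simps complex_eq_iff)
  then show "\<kappa> (br u v) = Complex \<alpha> \<beta> * (of_real (\<zeta> u) * \<kappa> v - of_real (\<zeta> v) * \<kappa> u)"
    if "u \<in> {X, Y, Z, W}" "v \<in> {X, Y, Z, W}" for u v
    using that by blast
qed (simp_all add: span_basis)

lemma surj_\<kappa>: "surj \<kappa>"
  by (rule surjI[of _ "\<lambda>z. Re z *\<^sub>R X + Im z *\<^sub>R Y"]) (simp add: \<kappa>_simps complex_eq_iff)

end

section \<open>Connection, second fundamental forms and curvature in the orthonormal frame\<close>

locale foliated_lie_group = riemannian_frame A g nabla \<iota> br "{X, Y, Z, W}" + solvable_algebra br X Y Z W \<alpha> \<beta> \<theta>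
  for A :: "('a::topological_space, 'e::euclidean_space) chart set" and g nabla
    and \<iota> :: "'g::real_vector \<Rightarrow> 'a vfield" and br X Y Z W \<alpha> \<beta> \<theta>
begin

lemma neqs: "X \<noteq> Y" "X \<noteq> Z" "X \<noteq> W" "Y \<noteq> Z" "Y \<noteq> W" "Z \<noteq> W"
  "Y \<noteq> X" "Z \<noteq> X" "W \<noteq> X" "Z \<noteq> Y" "W \<noteq> Y" "W \<noteq> Z"
  using distinct_basis by auto

lemma orths:
  "g p (\<iota> X p) (\<iota> X p) = 1" "g p (\<iota> X p) (\<iota> Y p) = 0" "g p (\<iota> X p) (\<iota> Z p) = 0" "g p (\<iota> X p) (\<iota> W p) = 0"
  "g p (\<iota> Y p) (\<iota> X p) = 0" "g p (\<iota> Y p) (\<iota> Y p) = 1" "g p (\<iota> Y p) (\<iota> Z p) = 0" "g p (\<iota> Y p) (\<iota> W p) = 0"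
  "g p (\<iota> Z p) (\<iota> X p) = 0" "g p (\<iota> Z p) (\<iota> Y p) = 0" "g p (\<iota> Z p) (\<iota> Z p) = 1" "g p (\<iota> Z p) (\<iota> W p) = 0"
  "g p (\<iota> W p) (\<iota> X p) = 0" "g p (\<iota> W p) (\<iota> Y p) = 0" "g p (\<iota> W p) (\<iota> Z p) = 0" "g p (\<iota> W p) (\<iota> W p) = 1"
  by (simp_all add: orthonormal neqs)

lemmas frame_simps = frame_add frame_scaleR frame_0 frame_minus frame_diff

lemma g_minus: "u \<in> tangent_space A p \<Longrightarrow> w \<in> tangent_space A p \<Longrightarrow> g p (- u) w = - g p u w"
  using g_scaleR[of u p w "-1"] by simp

lemma tangent_minus: "u \<in> tangent_space A p \<Longrightarrow> - u \<in> tangent_space A p"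
  using tangent_scaleR[of u p "-1"] by simp

lemmas g_simps = orths g_add g_scaleR g_zero g_diff g_minus frame_tangent tangent_scaleR tangent_add
  tangent_diff tangent_minus tangent_0

lemmas tangent_nabla = vector_field_tangent[OF vf_nabla]

text \<open>The right sides are the solutions of Koszul's formula for the given structure constants.
  The table already shows the geometry: derivatives of \<open>Z\<close> and \<open>W\<close> along
  \<open>Z\<close> and \<open>W\<close> stay in their span, and \<open>X\<close> and
  \<open>Y\<close> have the same self-derivative \<alpha> \<open>Z\<close>.\<close>

lemma nabla_basis_frame:
  "nabla (\<iota> X) (\<iota> X) p = \<iota> (\<alpha> *\<^sub>R Z) p" "nabla (\<iota> X) (\<iota> Y) p = \<iota> ((- \<theta> / 2) *\<^sub>R W) p"
  "nabla (\<iota> X) (\<iota> Z) p = \<iota> ((- \<alpha>) *\<^sub>R X) p" "nabla (\<iota> X) (\<iota> W) p = \<iota> ((\<theta> / 2) *\<^sub>R Y) p"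
  "nabla (\<iota> Y) (\<iota> X) p = \<iota> ((\<theta> / 2) *\<^sub>R W) p" "nabla (\<iota> Y) (\<iota> Y) p = \<iota> (\<alpha> *\<^sub>R Z) p"
  "nabla (\<iota> Y) (\<iota> Z) p = \<iota> ((- \<alpha>) *\<^sub>R Y) p" "nabla (\<iota> Y) (\<iota> W) p = \<iota> ((- \<theta> / 2) *\<^sub>R X) p"
  "nabla (\<iota> Z) (\<iota> X) p = \<iota> (\<beta> *\<^sub>R Y) p" "nabla (\<iota> Z) (\<iota> Y) p = \<iota> ((- \<beta>) *\<^sub>R X) p"
  "nabla (\<iota> Z) (\<iota> Z) p = \<iota> 0 p" "nabla (\<iota> Z) (\<iota> W) p = \<iota> 0 p"
  "nabla (\<iota> W) (\<iota> X) p = \<iota> ((\<theta> / 2) *\<^sub>R Y) p" "nabla (\<iota> W) (\<iota> Y) p = \<iota> ((- \<theta> / 2) *\<^sub>R X) p"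
  "nabla (\<iota> W) (\<iota> Z) p = \<iota> ((- 2 * \<alpha>) *\<^sub>R W) p" "nabla (\<iota> W) (\<iota> W) p = \<iota> ((2 * \<alpha>) *\<^sub>R Z) p"
  by (rule nabla_frame; simp add: brs frame_simps g_simps)+

lemma nabla_basis:
  "nabla (\<iota> X) (\<iota> X) = \<alpha> *\<^sub>R \<iota> Z" "nabla (\<iota> X) (\<iota> Y) = (- \<theta> / 2) *\<^sub>R \<iota> W"
  "nabla (\<iota> X) (\<iota> Z) = (- \<alpha>) *\<^sub>R \<iota> X" "nabla (\<iota> X) (\<iota> W) = (\<theta> / 2) *\<^sub>R \<iota> Y"
  "nabla (\<iota> Y) (\<iota> X) = (\<theta> / 2) *\<^sub>R \<iota> W" "nabla (\<iota> Y) (\<iota> Y) = \<alpha> *\<^sub>R \<iota> Z"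
  "nabla (\<iota> Y) (\<iota> Z) = (- \<alpha>) *\<^sub>R \<iota> Y" "nabla (\<iota> Y) (\<iota> W) = (- \<theta> / 2) *\<^sub>R \<iota> X"
  "nabla (\<iota> Z) (\<iota> X) = \<beta> *\<^sub>R \<iota> Y" "nabla (\<iota> Z) (\<iota> Y) = (- \<beta>) *\<^sub>R \<iota> X"
  "nabla (\<iota> Z) (\<iota> Z) = 0" "nabla (\<iota> Z) (\<iota> W) = 0"
  "nabla (\<iota> W) (\<iota> X) = (\<theta> / 2) *\<^sub>R \<iota> Y" "nabla (\<iota> W) (\<iota> Y) = (- \<theta> / 2) *\<^sub>R \<iota> X"
  "nabla (\<iota> W) (\<iota> Z) = (- 2 * \<alpha>) *\<^sub>R \<iota> W" "nabla (\<iota> W) (\<iota> W) = (2 * \<alpha>) *\<^sub>R \<iota> Z"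
  by (rule ext, simp only: nabla_basis_frame frame_simps)+

lemma nabla_expand_apply:
  assumes "vector_field A U" "vector_field A V"
  shows "nabla U V p = g p (U p) (\<iota> X p) *\<^sub>R nabla (\<iota> X) V p + g p (U p) (\<iota> Y p) *\<^sub>R nabla (\<iota> Y) V p
    + g p (U p) (\<iota> Z p) *\<^sub>R nabla (\<iota> Z) V p + g p (U p) (\<iota> W p) *\<^sub>R nabla (\<iota> W) V p"
  unfolding nabla_expand[OF assms] by (simp add: sum_fun_apply fun_times_apply neqs)

text \<open>Metric compatibility moves the derivative onto the frame field, so a component of the
  derivative of \<open>V\<close> is found without differentiating the coefficients of
  \<open>V\<close>.\<close>

lemma nabla_g_frame:
  assumes "vector_field A U" "vector_field A V" "\<And>q. g q (V q) (\<iota> b q) = 0"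
  shows "g p (nabla U V p) (\<iota> b p) = - g p (V p) (nabla U (\<iota> b) p)"
proof -
  have "U p (\<lambda>q. g q (V q) (\<iota> b q)) = 0"
    using tangent_const[OF vector_field_tangent[OF assms(1)]] assms(3) by simp
  then show ?thesis
    using metric_compatible[OF assms(1,2) vf_frame, of p b] by simp
qed

abbreviation "vert \<equiv> subframe {Z, W}"
abbreviation "hor \<equiv> subframe {X, Y}"

lemma basis_minus: "{X, Y, Z, W} - {Z, W} = {X, Y}" "{X, Y, Z, W} - {X, Y} = {Z, W}"
  using neqs by auto

lemma vert_iff: "v \<in> vert p \<longleftrightarrow> v \<in> tangent_space A p \<and> g p v (\<iota> X p) = 0 \<and> g p v (\<iota> Y p) = 0"
  by (simp add: subframe_def basis_minus)

lemma hor_iff: "v \<in> hor p \<longleftrightarrow> v \<in> tangent_space A p \<and> g p v (\<iota> Z p) = 0 \<and> g p v (\<iota> W p) = 0"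
  by (simp add: subframe_def basis_minus)

lemma vert_span: "vert = (\<lambda>p. span {\<iota> Z p, \<iota> W p})"
  using span_subframe[of "{Z, W}"] by (simp add: fun_eq_iff)

lemma orth_compl_vert: "orth_compl A g vert = hor"
  using orth_compl_subframe[of "{Z, W}"] by (simp add: basis_minus)

lemma sections_vert_iff: "U \<in> sections A vert \<longleftrightarrow>
    vector_field A U \<and> (\<forall>p. g p (U p) (\<iota> X p) = 0 \<and> g p (U p) (\<iota> Y p) = 0)"
  by (auto simp: sections_def vert_iff vector_field_tangent)

lemma sections_hor_iff: "U \<in> sections A hor \<longleftrightarrow>
    vector_field A U \<and> (\<forall>p. g p (U p) (\<iota> Z p) = 0 \<and> g p (U p) (\<iota> W p) = 0)"
  by (auto simp: sections_def hor_iff vector_field_tangent)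

text \<open>Along vertical directions \<open>X\<close> and \<open>Y\<close> only rotate into each
  other, with speed \<beta> along \<open>Z\<close> and \<theta>/2 along \<open>W\<close>, so their
  derivatives are orthogonal to vertical fields. Involutivity and minimality both rest on
  this.\<close>

lemma nabla_vert_geodesic:
  assumes U: "U \<in> sections A vert" and V: "V \<in> sections A vert"
  shows "g p (nabla U V p) (\<iota> X p) = 0" "g p (nabla U V p) (\<iota> Y p) = 0"
proof -
  have vf: "vector_field A U" "vector_field A V" using U V by (simp_all add: sections_vert_iff)
  have t: "V p \<in> tangent_space A p" using vector_field_tangent[OF vf(2)] .
  have 0: "g p (V p) (r *\<^sub>R \<iota> X p + s *\<^sub>R \<iota> Y p) = 0" for r s
    using V t by (simp add: g_add_right g_scaleR_right frame_tangent tangent_scaleR sections_vert_iff)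
  define c d where "c = g p (U p) (\<iota> Z p)" and "d = g p (U p) (\<iota> W p)"
  \<comment> \<open>The zero coefficients give both derivatives the shape of fact
    \<open>0\<close>.\<close>
  have "nabla U (\<iota> X) p = 0 *\<^sub>R \<iota> X p + (c * \<beta> + d * \<theta> / 2) *\<^sub>R \<iota> Y p"
    "nabla U (\<iota> Y) p = (- c * \<beta> - d * \<theta> / 2) *\<^sub>R \<iota> X p + 0 *\<^sub>R \<iota> Y p"
    unfolding nabla_expand_apply[OF vf(1) vf_frame] using U
    by (simp_all add: sections_vert_iff nabla_basis c_def d_def algebra_simps)
  then show "g p (nabla U V p) (\<iota> X p) = 0" "g p (nabla U V p) (\<iota> Y p) = 0"
    using V by (simp_all only: nabla_g_frame[OF vf] sections_vert_iff 0 minus_zero)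
qed

lemma involutive_vert: "involutive A vert"
  unfolding involutive_def
proof (intro ballI)
  fix U V assume U: "U \<in> sections A vert" and V: "V \<in> sections A vert"
  then have vf: "vector_field A U" "vector_field A V" by (simp_all add: sections_vert_iff)
  show "lie_bracket A U V \<in> sections A vert"
    using nabla_vert_geodesic[OF U V] nabla_vert_geodesic[OF V U] vf
    by (simp add: sections_vert_iff vf_lie_bracket torsion_free[symmetric] g_diff tangent_nabla frame_tangent vector_field_diff vf_nabla)
qed

lemma vert_totally_geodesic:
  assumes U: "U \<in> sections A vert" and V: "V \<in> sections A vert"
  shows "B_ver A g nabla vert U V p = 0"
proof -
  have vf: "vector_field A U" "vector_field A V" using U V by (simp_all add: sections_vert_iff)
  have "orth_proj g hor (nabla U V + nabla V U) p = 0"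
    using nabla_vert_geodesic[OF U V, of p] nabla_vert_geodesic[OF V U, of p] neqs
    by (subst orth_proj_subframe) (simp_all add: vf tangent_add tangent_nabla g_add frame_tangent)
  then show ?thesis by (simp add: B_ver_def orth_compl_vert)
qed

text \<open>The leaves are even totally geodesic, so each summand of the trace vanishes whichever
  frame was chosen.\<close>

lemma minimal_vert: "minimal_foliation A g nabla vert"
  unfolding minimal_foliation_def
proof (intro conjI allI involutive_vert)
  fix p
  have S: "{Z, W} \<subseteq> {X, Y, Z, W}" by auto
  obtain E where E: "orthonormal_at A g vert p E" and tr: "metric_trace A g vert (B_ver A g nabla vert) p
      = (\<Sum>i<card {Z, W}. B_ver A g nabla vert (E i) (E i) p)"
    by (rule metric_trace_subframe[OF S])
  have "E i \<in> sections A vert" if "i < card {Z, W}" for i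
    using E that by (simp add: orthonormal_at_def dim_subframe[OF S])
  then show "metric_trace A g vert (B_ver A g nabla vert) p = 0"
    unfolding tr by (intro sum.neutral ballI vert_totally_geodesic) auto
qed

text \<open>For horizontal E the derivative of \<open>Z\<close> along E is -\<alpha> E, a multiple
  of the identity; this is the source of conformality.\<close>

lemma nabla_hor_Z:
  assumes E: "E \<in> sections A hor" and F: "F \<in> sections A hor"
  shows "g p (nabla E F p) (\<iota> Z p) = \<alpha> * g p (E p) (F p)"
proof -
  have vf: "vector_field A E" "vector_field A F" using E F by (simp_all add: sections_hor_iff)
  have t: "E p \<in> tangent_space A p" "F p \<in> tangent_space A p" using vector_field_tangent vf by blast+
  have "E p = g p (E p) (\<iota> X p) *\<^sub>R \<iota> X p + g p (E p) (\<iota> Y p) *\<^sub>R \<iota> Y p"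
    using subframe_expand[of "{X, Y}" "E p" p] E neqs by (simp add: sections_def)
  moreover have "nabla E (\<iota> Z) p = (- \<alpha>) *\<^sub>R (g p (E p) (\<iota> X p) *\<^sub>R \<iota> X p + g p (E p) (\<iota> Y p) *\<^sub>R \<iota> Y p)"
    unfolding nabla_expand_apply[OF vf(1) vf_frame] using E
    by (simp add: sections_hor_iff nabla_basis algebra_simps)
  ultimately have "nabla E (\<iota> Z) p = (- \<alpha>) *\<^sub>R E p" by simp
  then show ?thesis
    using F nabla_g_frame[OF vf, of Z p] g_scaleR_right[OF t, of "- \<alpha>"] g_sym[OF t]
    by (simp add: sections_hor_iff)
qed

text \<open>This component is skew in E and F, so it disappears when \<open>B_hor\<close>
  symmetrises. It comes from the bracket of \<open>X\<close> and \<open>Y\<close>.\<close>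

lemma nabla_hor_W:
  assumes E: "E \<in> sections A hor" and F: "F \<in> sections A hor"
  shows "g p (nabla E F p) (\<iota> W p)
    = \<theta> / 2 * (g p (E p) (\<iota> Y p) * g p (F p) (\<iota> X p) - g p (E p) (\<iota> X p) * g p (F p) (\<iota> Y p))"
proof -
  have vf: "vector_field A E" "vector_field A F" using E F by (simp_all add: sections_hor_iff)
  have t: "F p \<in> tangent_space A p" using vector_field_tangent vf by blast
  have "nabla E (\<iota> W) p = (\<theta> / 2 * g p (E p) (\<iota> X p)) *\<^sub>R \<iota> Y p + (- (\<theta> / 2) * g p (E p) (\<iota> Y p)) *\<^sub>R \<iota> X p"
    unfolding nabla_expand_apply[OF vf(1) vf_frame] using E
    by (simp add: sections_hor_iff nabla_basis algebra_simps)
  then have "g p (F p) (nabla E (\<iota> W) p)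
     = \<theta> / 2 * g p (E p) (\<iota> X p) * g p (F p) (\<iota> Y p) - \<theta> / 2 * g p (E p) (\<iota> Y p) * g p (F p) (\<iota> X p)"
    using t by (simp only: g_add_right g_scaleR_right frame_tangent tangent_scaleR)
  then show ?thesis
    using F nabla_g_frame[OF vf, of W p] by (simp add: sections_hor_iff algebra_simps)
qed

lemma conformal_vert: "conformal_foliation A g nabla vert"
  unfolding conformal_foliation_def orth_compl_vert
\<comment> \<open>The witness is read off from \<open>nabla_hor_Z\<close>: symmetrising gives
  2\<alpha> g(E, F) in direction \<open>Z\<close>, the \<open>W\<close> component cancels, and the
  factor 1/2 leaves \<alpha> \<open>Z\<close>.\<close>
proof (intro conjI bexI[of _ "\<alpha> *\<^sub>R \<iota> Z"] ballI involutive_vert)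
  show "\<alpha> *\<^sub>R \<iota> Z \<in> sections A vert"
    by (simp add: sections_vert_iff vf_frame vector_field_scaleR g_simps)
next
  fix E F assume E: "E \<in> sections A hor" and F: "F \<in> sections A hor"
  show "B_hor g nabla vert E F = fun_times (\<lambda>p. g p (E p) (F p)) (\<alpha> *\<^sub>R \<iota> Z)"
  proof (rule ext)
    fix p
    have vf: "vector_field A E" "vector_field A F" using E F by (simp_all add: sections_hor_iff)
    have t: "E p \<in> tangent_space A p" "F p \<in> tangent_space A p" using vector_field_tangent vf by blast+
    let ?S = "nabla E F + nabla F E"
    have "g p (?S p) (\<iota> b p) = g p (nabla E F p) (\<iota> b p) + g p (nabla F E p) (\<iota> b p)" for b
      by (simp add: g_add tangent_nabla vf frame_tangent)
    then have "g p (?S p) (\<iota> Z p) = 2 * \<alpha> * g p (E p) (F p)" "g p (?S p) (\<iota> W p) = 0"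
      by (simp_all only: nabla_hor_Z[OF E F] nabla_hor_Z[OF F E] nabla_hor_W[OF E F] nabla_hor_W[OF F E] g_sym[OF t(2) t(1)])
        (simp_all add: algebra_simps)
    moreover have "orth_proj g vert ?S p = (\<Sum>b\<in>{Z, W}. g p (?S p) (\<iota> b p) *\<^sub>R \<iota> b p)"
      by (rule orth_proj_subframe) (simp_all add: vf tangent_add tangent_nabla)
    ultimately have "orth_proj g vert ?S p = (2 * \<alpha> * g p (E p) (F p)) *\<^sub>R \<iota> Z p"
      using neqs by (simp del: plus_fun_apply)
    then show "B_hor g nabla vert E F p = fun_times (\<lambda>p. g p (E p) (F p)) (\<alpha> *\<^sub>R \<iota> Z) p"
      by (simp add: B_hor_def fun_times_apply)
  qed
qed

lemma codimension_vert: "has_codimension A vert 2"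
  using dim_subframe[of "{X, Y, Z, W}"] dim_subframe[of "{Z, W}"] neqs
  by (simp add: has_codimension_def subframe_B)

text \<open>The operator R(., Z)Z is diagonal in the frame; the zero multiple of \<open>Z\<close> is
  spelled out to match the hypothesis of \<open>ricci_diagonal\<close>.\<close>

lemma curvature_Z:
  "curvature A nabla (\<iota> X) (\<iota> Z) (\<iota> Z) = (- \<alpha>\<^sup>2) *\<^sub>R \<iota> X" "curvature A nabla (\<iota> Y) (\<iota> Z) (\<iota> Z) = (- \<alpha>\<^sup>2) *\<^sub>R \<iota> Y"
  "curvature A nabla (\<iota> Z) (\<iota> Z) (\<iota> Z) = 0 *\<^sub>R \<iota> Z" "curvature A nabla (\<iota> W) (\<iota> Z) (\<iota> Z) = (- 4 * \<alpha>\<^sup>2) *\<^sub>R \<iota> W"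
  by (simp_all add: curvature_def bracket_frame brs frame_simps nabla_basis nabla_simps nabla_diff_left algebra_simps power2_eq_square)

lemma curvature_W:
  "curvature A nabla (\<iota> X) (\<iota> W) (\<iota> W) = (\<theta>\<^sup>2 / 4 - 2 * \<alpha>\<^sup>2) *\<^sub>R \<iota> X"
  "curvature A nabla (\<iota> Y) (\<iota> W) (\<iota> W) = (\<theta>\<^sup>2 / 4 - 2 * \<alpha>\<^sup>2) *\<^sub>R \<iota> Y"
  "curvature A nabla (\<iota> Z) (\<iota> W) (\<iota> W) = (- 4 * \<alpha>\<^sup>2) *\<^sub>R \<iota> Z" "curvature A nabla (\<iota> W) (\<iota> W) (\<iota> W) = 0 *\<^sub>R \<iota> W"
  by (simp_all add: curvature_def bracket_frame brs frame_simps nabla_basis nabla_simps nabla_diff_left algebra_simps power2_eq_square)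

text \<open>Both Ric(Z, Z) = -6 \<alpha>^2 and Ric(W, W) = \<theta>^2 / 2 - 8 \<alpha>^2 would have
  to be the Einstein constant; they agree only if \<theta>^2 = 4 \<alpha>^2.\<close>

lemma not_einstein:
  assumes "4 * \<alpha>\<^sup>2 \<noteq> \<theta>\<^sup>2" shows "\<not> einstein A g nabla"
proof
  assume "einstein A g nabla"
  then obtain c where c: "\<And>V W p. vector_field A V \<Longrightarrow> vector_field A W \<Longrightarrow>
       ricci A g nabla V W p = c * g p (V p) (W p)"
    unfolding einstein_def by blast
  have "ricci A g nabla (\<iota> Z) (\<iota> Z) undefined = (\<Sum>b\<in>{X, Y, Z, W}. if b = Z then 0 else if b = W then - 4 * \<alpha>\<^sup>2 else - \<alpha>\<^sup>2)"
    by (rule ricci_diagonal[OF vf_frame vf_frame]) (use curvature_Z neqs in auto)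
  then have Z: "c = - 6 * \<alpha>\<^sup>2"
    using c[OF vf_frame vf_frame, of Z Z undefined] by (simp add: neqs orths)
  have "ricci A g nabla (\<iota> W) (\<iota> W) undefined = (\<Sum>b\<in>{X, Y, Z, W}. if b = W then 0 else if b = Z then - 4 * \<alpha>\<^sup>2 else \<theta>\<^sup>2 / 4 - 2 * \<alpha>\<^sup>2)"
    by (rule ricci_diagonal[OF vf_frame vf_frame]) (use curvature_W neqs in auto)
  then have "c = \<theta>\<^sup>2 / 2 - 8 * \<alpha>\<^sup>2"
    using c[OF vf_frame vf_frame, of W W undefined] by (simp add: neqs orths)
  with Z assms show False by simp
qed

section \<open>Local submersions to the complex numbers cutting out the leaves\<close>

lemma vert_kernel: "vert q = {\<iota> u q | u. \<kappa> u = 0}"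
proof -
  have "\<iota> u q \<in> vert q \<longleftrightarrow> \<kappa> u = 0" for u
    by (simp add: vert_iff frame_tangent g_frame_representation \<kappa>_def complex_eq_iff)
  moreover have "v \<in> vert q \<Longrightarrow> \<exists>u. v = \<iota> u q" for v
    using tangent_frame[of q] by (auto simp: vert_iff)
  ultimately show ?thesis by blast
qed

lemma frame_in_basis:
  "\<iota> u = representation {X, Y, Z, W} u X *\<^sub>R \<iota> X + representation {X, Y, Z, W} u Y *\<^sub>R \<iota> Y
    + representation {X, Y, Z, W} u Z *\<^sub>R \<iota> Z + representation {X, Y, Z, W} u W *\<^sub>R \<iota> W"
proof
  fix p
  have "(\<Sum>b\<in>{X, Y, Z, W}. representation {X, Y, Z, W} u b *\<^sub>R \<iota> b p)
    = representation {X, Y, Z, W} u X *\<^sub>R \<iota> X p + representation {X, Y, Z, W} u Y *\<^sub>R \<iota> Y p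
    + representation {X, Y, Z, W} u Z *\<^sub>R \<iota> Z p + representation {X, Y, Z, W} u W *\<^sub>R \<iota> W p"
    by (simp add: neqs)
  then show "\<iota> u p = (representation {X, Y, Z, W} u X *\<^sub>R \<iota> X + representation {X, Y, Z, W} u Y *\<^sub>R \<iota> Y
    + representation {X, Y, Z, W} u Z *\<^sub>R \<iota> Z + representation {X, Y, Z, W} u W *\<^sub>R \<iota> W) p"
    by (simp add: frame_representation(2))
qed

lemma kernel_complex_diff:
  assumes "\<exists>m. m \<noteq> 0 \<and> (\<forall>u. complex_diff \<phi> (\<iota> u q) = m * \<kappa> u)"
  shows "{v \<in> tangent_space A q. complex_diff \<phi> v = 0} = vert q"
  using assms unfolding vert_kernel tangent_frame by auto

text \<open>On horizontal vectors \<kappa> is an isometry to the complex plane, and multiplication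
  by the nonzero complex number M scales lengths by its modulus, which is therefore the
  dilation.\<close>

lemma horizontally_conformal:
  assumes sm: "smooth_fun A U \<phi>"
    and d: "\<And>q. q \<in> U \<Longrightarrow> \<exists>m. m \<noteq> 0 \<and> (\<forall>u. complex_diff \<phi> (\<iota> u q) = m * \<kappa> u)"
  shows "horizontally_conformal_submersion A g U \<phi>"
proof -
  obtain M where M: "\<And>q. q \<in> U \<Longrightarrow> M q \<noteq> 0" "\<And>q u. q \<in> U \<Longrightarrow> complex_diff \<phi> (\<iota> u q) = M q * \<kappa> u"
    using d by metis
  have "complex_diff \<phi> ` tangent_space A q = UNIV" if q: "q \<in> U" for q
  proof -
    have "complex_diff \<phi> (\<iota> (inv \<kappa> (z / M q)) q) = z" for z
      using M(1)[OF q] by (simp add: M(2)[OF q] surj_f_inv_f[OF surj_\<kappa>])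
    then have "z \<in> complex_diff \<phi> ` tangent_space A q" for z
      by (metis frame_tangent imageI)
    then show ?thesis by blast
  qed
  moreover have "complex_diff \<phi> u \<bullet> complex_diff \<phi> v = (cmod (M q))\<^sup>2 * g q u v"
    if q: "q \<in> U" and u: "u \<in> orth_compl A g (\<lambda>x. {v \<in> tangent_space A x. complex_diff \<phi> v = 0}) q"
      and v: "v \<in> orth_compl A g (\<lambda>x. {v \<in> tangent_space A x. complex_diff \<phi> v = 0}) q" for q u v
  proof -
    have "orth_compl A g (\<lambda>x. {v \<in> tangent_space A x. complex_diff \<phi> v = 0}) q = hor q"
      unfolding orth_compl_vert[symmetric] orth_compl_def kernel_complex_diff[OF d[OF q]] ..
    then have uv: "u \<in> hor q" "v \<in> hor q" using u v by simp_all
    then obtain a b where ab: "u = \<iota> a q" "v = \<iota> b q"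
      using tangent_frame[of q] by (auto simp: hor_iff)
    have "g q u v = (\<Sum>b\<in>{X, Y}. g q u (\<iota> b q) * g q v (\<iota> b q))"
      by (rule g_subframe[OF uv(1)]) (use uv in \<open>auto simp: hor_iff\<close>)
    also have "\<dots> = \<kappa> a \<bullet> \<kappa> b"
      by (simp add: neqs ab g_frame_representation \<kappa>_def inner_complex_def)
    finally have "g q u v = \<kappa> a \<bullet> \<kappa> b" .
    moreover have "(m * x) \<bullet> (m * y) = (cmod m)\<^sup>2 * (x \<bullet> y)" for m x y
      by (simp add: inner_complex_def cmod_power2) (simp add: power2_eq_square algebra_simps)
    ultimately show ?thesis by (simp add: ab M(2)[OF q])
  qed
  ultimately show ?thesis
    using sm M(1) unfolding horizontally_conformal_submersion_def Let_def
    by (intro conjI ballI exI[of _ "\<lambda>q. cmod (M q)"]) auto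
qed

lemma submersion_at:
  obtains U \<phi> where "open U" "p \<in> U" "smooth_fun A U \<phi>" "horizontally_conformal_submersion A g U \<phi>"
    "\<And>q. q \<in> U \<Longrightarrow> \<exists>m. m \<noteq> 0 \<and> (\<forall>u. complex_diff \<phi> (\<iota> u q) = m * \<kappa> u)"
    "\<And>q. q \<in> U \<Longrightarrow> {x \<in> U. \<phi> x = \<phi> q} = leaf A vert U q"
proof (rule local_complex_submersion[OF linear_\<zeta> linear_\<kappa> surj_\<kappa> \<zeta>_closed \<kappa>_bracket vert_kernel, of p])
  fix U \<phi>
  assume "open U" "p \<in> U" and s: "smooth_fun A U \<phi>"
    and d: "\<And>q. q \<in> U \<Longrightarrow> \<exists>m. m \<noteq> 0 \<and> (\<forall>u. complex_diff \<phi> (\<iota> u q) = m * \<kappa> u)"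
    and "\<And>q. q \<in> U \<Longrightarrow> {x \<in> U. \<phi> x = \<phi> q} = leaf A vert U q"
  then show thesis using that horizontally_conformal[OF s d] by simp
qed

lemma integrable_vert: "integrable_distribution A vert"
  unfolding integrable_distribution_def
proof
  fix p
  obtain U \<phi> where U: "open U" "p \<in> U" and s: "smooth_fun A U \<phi>"
    and d: "\<And>q. q \<in> U \<Longrightarrow> \<exists>m. m \<noteq> 0 \<and> (\<forall>u. complex_diff \<phi> (\<iota> u q) = m * \<kappa> u)"
    using submersion_at[of p] by metis
  \<comment> \<open>The real and imaginary parts of \<phi> are the two real components; the value at
    indices above 1 is a mere filler.\<close>
  define \<psi> :: "nat \<Rightarrow> 'a \<Rightarrow> real" where "\<psi> i = (if i = 0 then Re \<circ> \<phi> else Im \<circ> \<phi>)" for i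
  have sm: "smooth_fun A U (\<psi> i)" for i
    using smooth_fun_linear[OF bounded_linear_Re U(1) s] smooth_fun_linear[OF bounded_linear_Im U(1) s]
    by (simp add: \<psi>_def comp_def)
  have ker: "vert x = {v \<in> tangent_space A x. \<forall>i<2. v (\<psi> i) = 0} \<and>
      dim (tangent_space A x) = dim (vert x) + 2" if "x \<in> U" for x
  proof -
    have "(\<forall>i<2. v (\<psi> i) = 0) \<longleftrightarrow> complex_diff \<phi> v = 0" for v
      by (auto simp: \<psi>_def complex_diff_def complex_eq_iff less_2_cases_iff)
    then have "vert x = {v \<in> tangent_space A x. \<forall>i<2. v (\<psi> i) = 0}"
      using kernel_complex_diff[OF d[OF that]] by simp
    moreover have "dim (tangent_space A x) = dim (vert x) + 2"
      using codimension_vert unfolding has_codimension_def ..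
    ultimately show ?thesis ..
  qed
  have *: "open U \<and> p \<in> U \<and> (\<forall>i<2. smooth_fun A U (\<psi> i)) \<and>
       (\<forall>x\<in>U. vert x = {v \<in> tangent_space A x. \<forall>i<2. v (\<psi> i) = 0} \<and>
              dim (tangent_space A x) = dim (vert x) + 2)"
    by (intro conjI[OF U(1)] conjI[OF U(2)] conjI[OF allI ballI] impI sm ker)
  show "\<exists>U q \<psi>. open U \<and> p \<in> U \<and> (\<forall>i<q. smooth_fun A U (\<psi> i)) \<and>
       (\<forall>x\<in>U. vert x = {v \<in> tangent_space A x. \<forall>i<q. v (\<psi> i) = 0} \<and>
              dim (tangent_space A x) = dim (vert x) + q)"
    by (intro exI) (rule *)
qed

section \<open>The two complex structures in one computation, with \<open>s\<close> = 1 for the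
  first and \<open>s\<close> = -1 for the second\<close>

context
  fixes J :: "'a endo" and s :: real
  assumes J: "almost_hermitian A g J" and s: "s = 1 \<or> s = -1"
    and J_basis: "endo_app J (\<iota> X) = \<iota> Y" "endo_app J (\<iota> Y) = - \<iota> X"
      "endo_app J (\<iota> Z) = s *\<^sub>R \<iota> W" "endo_app J (\<iota> W) = - (s *\<^sub>R \<iota> Z)"
begin

lemmas J_simps = endo_app_simps[OF J] J_basis

lemma s_square: "s * s = 1"
  using s by auto

text \<open>The Nijenhuis tensor vanishes automatically on a pair U, JU. On the remaining mixed
  pairs it vanishes for either sign because ad \<open>Z\<close> commutes with the rotation taking
  \<open>X\<close> to \<open>Y\<close>, and \<open>W\<close> commutes with \<open>X\<close> and
  \<open>Y\<close>.\<close>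

lemma hermitian_J: "hermitian A g J"
proof -
  have 0: "\<forall>b\<in>{X, Y, Z, W}. \<forall>c\<in>{X, Y, Z, W}. nijenhuis A J (\<iota> b) (\<iota> c) = 0"
    by (simp add: nijenhuis_def J_simps lie_bracket_simps vector_field_intros brs frame_simps s_square
        scaleR_add_right scaleR_diff_right)
  have "nijenhuis A J U V = 0" if "vector_field A U" "vector_field A V" for U V
    by (rule nijenhuis_eq_0[OF J _ that]) (use 0 in blast)
  then show ?thesis
    using J by (simp add: hermitian_def)
qed

text \<open>The single component of the covariant derivative of J on the pair \<open>X\<close>,
  \<open>X\<close>, namely -(\<theta>/2 + s\<alpha>) \<open>W\<close>, forces the condition; under
  the condition all components in the frame vanish.\<close>

lemma kaehler_J_iff: "kaehler A g nabla J \<longleftrightarrow> \<theta> = - 2 * s * \<alpha>"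
proof
  assume "kaehler A g nabla J"
  then have "nabla (\<iota> X) (endo_app J (\<iota> X)) - endo_app J (nabla (\<iota> X) (\<iota> X)) = 0"
    using vf_frame unfolding kaehler_def by blast
  then have "(- \<theta> / 2 - \<alpha> * s) *\<^sub>R \<iota> W = 0"
    by (simp add: J_simps vf_frame nabla_basis algebra_simps)
  then have "(- \<theta> / 2 - \<alpha> * s) *\<^sub>R \<iota> W p = 0" for p
    by (metis scaleR_fun_apply zero_fun_apply)
  then have "(- \<theta> / 2 - \<alpha> * s) * g p (\<iota> W p) (\<iota> W p) = 0" for p
    using g_scaleR[OF frame_tangent frame_tangent, of p "- \<theta> / 2 - \<alpha> * s" W W] g_zero[OF frame_tangent] by metis
  then show "\<theta> = - 2 * s * \<alpha>" by (simp add: orths algebra_simps)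
next
  assume \<theta>: "\<theta> = - 2 * s * \<alpha>"
  have 0: "\<forall>b\<in>{X, Y, Z, W}. \<forall>c\<in>{X, Y, Z, W}. nabla_J J (\<iota> b) (\<iota> c) = 0"
    by (simp add: nabla_J_def[OF J] J_simps nabla_simps nabla_basis \<theta>) (simp add: s_square)
  have "nabla_J J U V = 0" if "vector_field A U" "vector_field A V" for U V
    by (rule nabla_J_eq_0[OF J _ that]) (use 0 in blast)
  then show "kaehler A g nabla J"
    by (simp add: kaehler_def hermitian_J nabla_J_def[OF J])
qed

text \<open>J turns \<open>X\<close> into \<open>Y\<close>, which under \<kappa> is multiplication
  by i, while the vertical part lies in the kernel of \<kappa>. Hence the sign \<open>s\<close> does
  not affect holomorphy.\<close>

lemma complex_diff_J:
  assumes d: "\<forall>u. complex_diff \<phi> (\<iota> u q) = m * \<kappa> u" and v: "v \<in> tangent_space A q"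
  shows "complex_diff \<phi> (J q v) = \<i> * complex_diff \<phi> v"
proof -
  obtain u where u: "v = \<iota> u q" using v tangent_frame by blast
  define r where "r = representation {X, Y, Z, W} u"
  let ?w = "r X *\<^sub>R Y + (- r Y) *\<^sub>R X + (s * r Z) *\<^sub>R W + (- s * r W) *\<^sub>R Z"
  have "endo_app J (\<iota> u) = \<iota> ?w"
    unfolding frame_in_basis[of u] r_def[symmetric]
    by (simp add: J_simps vector_field_intros frame_simps mult.commute)
  then have "J q v = \<iota> ?w q"
    unfolding u endo_app_def by (rule fun_cong)
  moreover have "\<kappa> ?w = \<i> * \<kappa> u"
    by (simp add: \<kappa>_simps complex_eq_iff) (simp add: \<kappa>_def r_def)
  ultimately show ?thesis using d by (simp add: u)
qed

lemma holomorphic_J: "holomorphic_foliation A g nabla vert J"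
  unfolding holomorphic_foliation_def
proof (intro conjI conformal_vert codimension_vert hermitian_J allI)
  fix p
  obtain U \<phi> where U: "open U" "p \<in> U" "horizontally_conformal_submersion A g U \<phi>"
    and d: "\<forall>q\<in>U. \<exists>m. m \<noteq> 0 \<and> (\<forall>u. complex_diff \<phi> (\<iota> u q) = m * \<kappa> u)"
    and l: "\<forall>q\<in>U. {x \<in> U. \<phi> x = \<phi> q} = leaf A vert U q"
    by (rule submersion_at[of p]) blast
  have "complex_diff \<phi> (J q v) = \<i> * complex_diff \<phi> v" if "q \<in> U" "v \<in> tangent_space A q" for q v
    using d that complex_diff_J by blast
  then show "\<exists>U \<phi>. open U \<and> p \<in> U \<and> horizontally_conformal_submersion A g U \<phi> \<and>
       (\<forall>q\<in>U. {x \<in> U. \<phi> x = \<phi> q} = leaf A vert U q) \<and>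
       (\<forall>q\<in>U. \<forall>v\<in>tangent_space A q. complex_diff \<phi> (J q v) = \<i> * complex_diff \<phi> v)"
    using U l by blast
qed

end

end

theorem mainTheorem2:
  fixes \<alpha> \<beta> \<theta>\<^sub>2 :: real
    and X Y Z W :: "'g::real_vector"
    and br :: "'g \<Rightarrow> 'g \<Rightarrow> 'g"
  assumes "\<alpha> \<noteq> 0" and "\<beta> \<noteq> 0" and "\<theta>\<^sub>2 \<noteq> 0"
    and "distinct [X, Y, Z, W]" and "independent {X, Y, Z, W}" and "span {X, Y, Z, W} = UNIV"
    and "bilinear br" and "\<forall>u v. br u v = - br v u"
    and "br W Z = (- 2 * \<alpha>) *\<^sub>R W"
    and "br Z X = \<alpha> *\<^sub>R X + \<beta> *\<^sub>R Y"
    and "br Z Y = (- \<beta>) *\<^sub>R X + \<alpha> *\<^sub>R Y"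
    and "br Y X = \<theta>\<^sub>2 *\<^sub>R W"
    and "br W X = 0" and "br W Y = 0"
  shows "lie_algebra br \<and>
    (\<forall>(A :: ('a::{second_countable_topology, t2_space}, 'e::euclidean_space) chart set)
       mul e ginv \<iota> g nabla D J\<^sub>1 J\<^sub>2.
       lie_group A mul e ginv \<and> lie_algebra_of A mul br \<iota> \<and>
       riemannian_metric A g \<and> left_invariant_metric A mul g \<and>
       (\<forall>p. \<forall>u\<in>{X, Y, Z, W}. \<forall>v\<in>{X, Y, Z, W}. g p (\<iota> u p) (\<iota> v p) = (if u = v then 1 else 0)) \<and>
       levi_civita A g nabla \<and>
       D = (\<lambda>p. span {\<iota> Z p, \<iota> W p}) \<and>
       almost_hermitian A g J\<^sub>1 \<and> left_invariant_endo A mul J\<^sub>1 \<and>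
       endo_app J\<^sub>1 (\<iota> X) = \<iota> Y \<and> endo_app J\<^sub>1 (\<iota> Y) = - \<iota> X \<and>
       endo_app J\<^sub>1 (\<iota> Z) = \<iota> W \<and> endo_app J\<^sub>1 (\<iota> W) = - \<iota> Z \<and>
       almost_hermitian A g J\<^sub>2 \<and> left_invariant_endo A mul J\<^sub>2 \<and>
       endo_app J\<^sub>2 (\<iota> X) = \<iota> Y \<and> endo_app J\<^sub>2 (\<iota> Y) = - \<iota> X \<and>
       endo_app J\<^sub>2 (\<iota> W) = \<iota> Z \<and> endo_app J\<^sub>2 (\<iota> Z) = - \<iota> W
       \<longrightarrow>
       (involutive A D \<and> integrable_distribution A D \<and>
        conformal_foliation A g nabla D \<and> minimal_foliation A g nabla D \<and>
        has_codimension A D 2) \<and>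
       (hermitian A g J\<^sub>1 \<and> hermitian A g J\<^sub>2 \<and>
        holomorphic_foliation A g nabla D J\<^sub>1 \<and> holomorphic_foliation A g nabla D J\<^sub>2) \<and>
       ((kaehler A g nabla J\<^sub>1 \<longleftrightarrow> \<theta>\<^sub>2 = - 2 * \<alpha>) \<and>
        (kaehler A g nabla J\<^sub>2 \<longleftrightarrow> \<theta>\<^sub>2 = 2 * \<alpha>) \<and>
        (\<not> kaehler A g nabla J\<^sub>1 \<or> \<not> kaehler A g nabla J\<^sub>2)) \<and>
       (4 * \<alpha>\<^sup>2 \<noteq> \<theta>\<^sub>2\<^sup>2 \<longrightarrow> \<not> einstein A g nabla))"
proof -
  interpret alg: solvable_algebra br X Y Z W \<alpha> \<beta> \<theta>\<^sub>2
    by (rule solvable_algebra.intro) (fact assms assms(8)[rule_format])+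
  show ?thesis
  proof (intro conjI[OF alg.lie_algebra] allI impI, elim conjE)
    fix A :: "('a, 'e) chart set" and mul e ginv \<iota> g nabla D J\<^sub>1 J\<^sub>2
    assume lg: "lie_group A mul e ginv" and la: "lie_algebra_of A mul br \<iota>"
      and rm: "riemannian_metric A g"
      and on: "\<forall>p. \<forall>u\<in>{X, Y, Z, W}. \<forall>v\<in>{X, Y, Z, W}. g p (\<iota> u p) (\<iota> v p) = (if u = v then 1 else 0)"
      and lc: "levi_civita A g nabla" and D: "D = (\<lambda>p. span {\<iota> Z p, \<iota> W p})"
      and J1: "almost_hermitian A g J\<^sub>1" "endo_app J\<^sub>1 (\<iota> X) = \<iota> Y" "endo_app J\<^sub>1 (\<iota> Y) = - \<iota> X"
        "endo_app J\<^sub>1 (\<iota> Z) = \<iota> W" "endo_app J\<^sub>1 (\<iota> W) = - \<iota> Z"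
      and J2: "almost_hermitian A g J\<^sub>2" "endo_app J\<^sub>2 (\<iota> X) = \<iota> Y" "endo_app J\<^sub>2 (\<iota> Y) = - \<iota> X"
        "endo_app J\<^sub>2 (\<iota> W) = \<iota> Z" "endo_app J\<^sub>2 (\<iota> Z) = - \<iota> W"
    interpret lie_group_manifold A mul e ginv
      by unfold_locales (use lg in \<open>auto simp: lie_group_def\<close>)
    interpret riemannian_manifold A g
      by unfold_locales (rule rm)
    have \<iota>: "linear \<iota>" "range \<iota> = left_invariant_fields A mul" "\<And>u v. lie_bracket A (\<iota> u) (\<iota> v) = \<iota> (br u v)"
      using la by (auto simp: lie_algebra_of_def bij_betw_def)
    have vf: "vector_field A (\<iota> u)" for u
      using \<iota>(2) by (auto simp: left_invariant_fields_def)
    \<comment> \<open>Orthonormality at each point gives the pointwise independence that the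
      dimension count for the tangent spaces requires.\<close>
    have ind: "inj_on (\<lambda>b. \<iota> b p) {X, Y, Z, W}" "independent ((\<lambda>b. \<iota> b p) ` {X, Y, Z, W})" for p
      using orthonormal_independent[of "{X, Y, Z, W}" "\<lambda>b. \<iota> b p" p] vector_field_tangent[OF vf] on by simp_all
    have tangent: "tangent_space A p = range (\<lambda>u. \<iota> u p)" for p
      by (rule tangent_space_frame[OF \<iota>(1,2) _ assms(6) ind]) simp
    have finite: "finite {X, Y, Z, W}" by simp
    have on': "g p (\<iota> u p) (\<iota> v p) = (if u = v then 1 else 0)"
      if "u \<in> {X, Y, Z, W}" "v \<in> {X, Y, Z, W}" for u v p
      using on that by blast
    have "riemannian_frame A g nabla \<iota> br {X, Y, Z, W}"
      by (intro riemannian_frame.intro riemannian_frame_axioms.intro)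
        (fact riemannian_manifold_axioms lc \<iota> vf finite assms(5,6) on' tangent)+
    then interpret foliated_lie_group A g nabla \<iota> br X Y Z W \<alpha> \<beta> \<theta>\<^sub>2
      by (rule foliated_lie_group.intro) (fact alg.solvable_algebra_axioms)
    have DV: "D = vert" using D vert_span by simp
    note j1 = hermitian_J[of J\<^sub>1 1] kaehler_J_iff[of J\<^sub>1 1] holomorphic_J[of J\<^sub>1 1]
    note j2 = hermitian_J[of J\<^sub>2 "-1"] kaehler_J_iff[of J\<^sub>2 "-1"] holomorphic_J[of J\<^sub>2 "-1"]
    show "(involutive A D \<and> integrable_distribution A D \<and>
        conformal_foliation A g nabla D \<and> minimal_foliation A g nabla D \<and>
        has_codimension A D 2) \<and>
       (hermitian A g J\<^sub>1 \<and> hermitian A g J\<^sub>2 \<and>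
        holomorphic_foliation A g nabla D J\<^sub>1 \<and> holomorphic_foliation A g nabla D J\<^sub>2) \<and>
       ((kaehler A g nabla J\<^sub>1 \<longleftrightarrow> \<theta>\<^sub>2 = - 2 * \<alpha>) \<and>
        (kaehler A g nabla J\<^sub>2 \<longleftrightarrow> \<theta>\<^sub>2 = 2 * \<alpha>) \<and>
        (\<not> kaehler A g nabla J\<^sub>1 \<or> \<not> kaehler A g nabla J\<^sub>2)) \<and>
       (4 * \<alpha>\<^sup>2 \<noteq> \<theta>\<^sub>2\<^sup>2 \<longrightarrow> \<not> einstein A g nabla)"
      \<comment> \<open>As \<alpha> is nonzero, \<theta> cannot equal both -2\<alpha> and 2\<alpha>,
        so at most one of the two structures is Kaehler.\<close>
      unfolding DV
      using j1 j2 J1 J2 assms(1) involutive_vert integrable_vert conformal_vert minimal_vert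
        codimension_vert not_einstein by auto
  qed
qed

end
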